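(* Let $(\mu_k)$ be a sequence of finite signed Borel measures on $\mathbf{R}^d$ with uniformly bounded total variation, $\|\mu_k\|\le C$, and assume that for almost all $(\omega,p)\in S^{d-1}\times\mathbf{R}$ the limit $\lim_{k\to\infty}\mu_k(H_{\omega,p})=a(\omega,p)$ exists. Then there is a unique finite signed measure $\mu$ on $\mathbf{R}^d$ with $\|\mu\|\le C$ such that $\lim_{k\to\infty}\int\varphi\,d\mu_k=\int\varphi\,d\mu$ for all $\varphi\in C_0(\mathbf{R}^d)$. The measure $\mu$ is characterized by $R\mu=\partial_pa$ on $S^{d-1}\times\mathbf{R}$ (derivative in the distribution sense). If in addition $\lim_{k\to\infty}\|\mu_k\|=\|\mu\|$, then $\lim_{k\to\infty}\int\varphi\,d\mu_k=\int\varphi\,d\mu$ for all bounded continuous $\varphi$ on $\mathbf{R}^d$.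
   Context: $\|\nu\|$ denotes total variation norm. $H_{\omega,p}=\{x\in\mathbf{R}^d:x\cdot\omega<p\}$; "almost all" is with respect to surface measure on $S^{d-1}$ times Lebesgue measure. $C_0(\mathbf{R}^d)$: continuous functions vanishing at infinity. The Radon transform $R\mu$ of a finite measure is the measure on $S^{d-1}\times\mathbf{R}$ defined by $\langle R\mu,\psi\rangle=\int R^*\psi\,d\mu$ for $\psi\in C_0(S^{d-1}\times\mathbf{R})$, where $R^*\psi(x)=\int_{S^{d-1}}\psi(\omega,x\cdot\omega)\,d\omega$ with $d\omega$ normalized surface measure. $\partial_pa$ is the distribution $\psi\mapsto-\iint a(\omega,p)\partial_p\psi(\omega,p)\,dp\,d\omega$ on smooth compactly supported $\psi$. *)

theory Defs
  imports "HOL-Analysis.Analysis"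
begin

definition signed_measure :: "('a::euclidean_space set \<Rightarrow> real) \<Rightarrow> bool" where
  "signed_measure \<nu> \<longleftrightarrow>
     (\<forall>A. A \<notin> sets borel \<longrightarrow> \<nu> A = 0) \<and>
     (\<forall>A :: nat \<Rightarrow> 'a set. range A \<subseteq> sets borel \<longrightarrow> disjoint_family A \<longrightarrow>
         (\<lambda>i. \<nu> (A i)) sums \<nu> (\<Union>i. A i))"

definition total_variation :: "('a::euclidean_space set \<Rightarrow> real) \<Rightarrow> real" where
  "total_variation \<nu> = Sup {(\<Sum>i<n. \<bar>\<nu> (A i)\<bar>) | (n::nat) (A :: nat \<Rightarrow> 'a set).
       (\<forall>i<n. A i \<in> sets borel) \<and> disjoint_family_on A {..<n}}"

definition pos_variation :: "('a::euclidean_space set \<Rightarrow> real) \<Rightarrow> 'a measure" where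
  "pos_variation \<nu> = measure_of UNIV (sets borel)
     (\<lambda>A. ennreal (SUP B\<in>{B. B \<in> sets borel \<and> B \<subseteq> A}. \<nu> B))"

definition neg_variation :: "('a::euclidean_space set \<Rightarrow> real) \<Rightarrow> 'a measure" where
  "neg_variation \<nu> = pos_variation (\<lambda>A. - \<nu> A)"

definition signed_integral :: "('a::euclidean_space set \<Rightarrow> real) \<Rightarrow> ('a \<Rightarrow> real) \<Rightarrow> real" where
  "signed_integral \<nu> \<phi> = integral\<^sup>L (pos_variation \<nu>) \<phi> - integral\<^sup>L (neg_variation \<nu>) \<phi>"

definition halfspace :: "'a::euclidean_space \<Rightarrow> real \<Rightarrow> 'a set" where
  "halfspace \<omega> p = {x. x \<bullet> \<omega> < p}"

text \<open>Normalised surface measure on the unit sphere, realised as the (normalised) cone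
  measure, which coincides with normalised surface measure on the sphere.\<close>
definition sphere_cone :: "'a::euclidean_space set \<Rightarrow> 'a set" where
  "sphere_cone A = {r *\<^sub>R x | r x. 0 < r \<and> r \<le> 1 \<and> x \<in> A}"

definition sphere_measure :: "'a::euclidean_space measure" where
  "sphere_measure = measure_of (sphere 0 1) (sets (restrict_space borel (sphere 0 1)))
     (\<lambda>A. emeasure lborel (sphere_cone A) / emeasure lborel (ball (0::'a) 1))"

definition C0 :: "('a::real_normed_vector \<Rightarrow> real) \<Rightarrow> bool" where
  "C0 \<phi> \<longleftrightarrow> continuous_on UNIV \<phi> \<and> (\<phi> \<longlongrightarrow> 0) at_infinity"

definition Cb :: "('a::real_normed_vector \<Rightarrow> real) \<Rightarrow> bool" where
  "Cb \<phi> \<longleftrightarrow> continuous_on UNIV \<phi> \<and> bounded (range \<phi>)"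

fun iter_dderiv :: "('a::real_normed_vector \<Rightarrow> real) \<Rightarrow> 'a list \<Rightarrow> 'a \<Rightarrow> real" where
  "iter_dderiv f [] = f"
| "iter_dderiv f (v # vs) = (\<lambda>x. frechet_derivative (iter_dderiv f vs) (at x) v)"

definition smooth_fun :: "('a::real_normed_vector \<Rightarrow> real) \<Rightarrow> bool" where
  "smooth_fun f \<longleftrightarrow> (\<forall>vs x. iter_dderiv f vs differentiable (at x))"

text \<open>Test functions on S^{d-1} x R: restrictions of smooth compactly supported functions
  on R^d x R.\<close>
definition test_fun :: "('a::euclidean_space \<times> real \<Rightarrow> real) \<Rightarrow> bool" where
  "test_fun \<psi> \<longleftrightarrow> smooth_fun \<psi> \<and> compact (closure {z. \<psi> z \<noteq> 0})"

definition dual_radon :: "('a::euclidean_space \<times> real \<Rightarrow> real) \<Rightarrow> 'a \<Rightarrow> real" where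
  "dual_radon \<psi> x = integral\<^sup>L sphere_measure (\<lambda>\<omega>. \<psi> (\<omega>, x \<bullet> \<omega>))"

text \<open>R nu = partial_p a in the sense of distributions on S^{d-1} x R.\<close>
definition radon_eq_dp :: "('a::euclidean_space set \<Rightarrow> real) \<Rightarrow> ('a \<times> real \<Rightarrow> real) \<Rightarrow> bool" where
  "radon_eq_dp \<nu> a \<longleftrightarrow> (\<forall>\<psi>. test_fun \<psi> \<longrightarrow>
     signed_integral \<nu> (dual_radon \<psi>) =
       - integral\<^sup>L (completion (sphere_measure \<Otimes>\<^sub>M lborel))
           (\<lambda>z. a z * deriv (\<lambda>p. \<psi> (fst z, p)) (snd z)))"

end

(*
Convergence of the distribution functions on almost all half-spaces determines the limit of the
integrals of all ridge averages (R* psi)(x), because integration by parts in p turns the integral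
of R* psi against mu_k into minus the integral of mu_k(H_{omega,p}) times the p-derivative of psi,
and dominated convergence applies.

The ridge averages are rich enough.  Computing the Fourier transform of exp (-|xi|_1) once as a
product of one-dimensional integrals and once in polar coordinates exhibits the Cauchy kernel
K(x) = prod_i 2 / (1 + x_i^2) as R* psi with psi(omega, p) = const * Re (|omega|_1 - i p)^(-d).  Its
translates and dilates are of the same form and are an approximate identity, so the integrals of all
functions in C_0 converge.  The limit functional is represented by a signed measure (Riesz), built
from a Daniell-type outer measure.

For the uniqueness in R nu = d_p a, test functions polynomial * bump approximate the ridge functions
by Stone-Weierstrass, so nu and mu agree on the approximate identity.  For the last claim, a function f
in C_0 with |f| <= 1 and integral close to |mu| absorbs almost all of the mass of mu_k for large k.
*)
theory Submission
  imports Defs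
begin

section \<open>Signed measures\<close>

text \<open>The function exp (-|xi|_1) is chosen for two reasons: it factors over the coordinates,
  so its transform is an elementary product, and its exponent is homogeneous along rays, so for
  fixed \<omega> the radial integral is a Gamma integral with the complex rate |\<omega>|_1 - i p.
  As |\<omega>|_1 \<ge> 1 on the sphere, the resulting psi has no singularity there. The obstacle is
  that this psi has no compact support and is no test function. Integration by parts is therefore
  set up for a wider class, with a p-derivative of order 1/(1 + p^2): half-space masses are bounded
  but do not decay, so integrability has to come from the derivative. In the uniqueness proof psi is
  reached from test functions by two bounded pointwise limits. The limit a is prescribed only almost
  everywhere, so integrals with it live on the completed product measure. Vague limits see only C_0,
  so the Radon equation also needs R* psi to vanish at infinity for test functions psi; it does
  because the directions orthogonal to a given vector form a null set.\<close>

lemma signed_measure_sums: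
  assumes "signed_measure \<nu>" "range A \<subseteq> sets borel" "disjoint_family A"
  shows "(\<lambda>i. \<nu> (A i)) sums \<nu> (\<Union>i. A i)"
  using assms unfolding signed_measure_def by blast

text \<open>A constant sequence of empty sets is disjoint, and a constant series converges only if
  its terms are 0.\<close>

lemma signed_measure_empty: "signed_measure \<nu> \<Longrightarrow> \<nu> {} = 0"
proof -
  assume "signed_measure \<nu>"
  from signed_measure_sums[OF this, of "\<lambda>_. {}"] have "(\<lambda>i::nat. \<nu> {}) sums \<nu> {}"
    by (simp add: disjoint_family_on_def)
  hence "summable (\<lambda>i::nat. \<nu> {})" by (rule sums_summable)
  thus "\<nu> {} = 0" by (simp only: summable_const_iff)
qed

lemma signed_measure_Un:
  assumes "signed_measure \<nu>" "A \<in> sets borel" "B \<in> sets borel" "A \<inter> B = {}"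
  shows "\<nu> (A \<union> B) = \<nu> A + \<nu> B"
proof -
  have "(\<lambda>i. \<nu> (binaryset A B i)) sums \<nu> (\<Union>i. binaryset A B i)"
    using assms by (intro signed_measure_sums)
      (auto simp: binaryset_def disjoint_family_on_def)
  moreover have "(\<lambda>i. \<nu> (binaryset A B i)) sums (\<nu> A + \<nu> B)"
    using signed_measure_empty[OF assms(1)] by (rule binaryset_sums)
  ultimately show ?thesis by (simp add: sums_unique2 UN_binaryset_eq)
qed

lemma signed_measure_Diff:
  assumes "signed_measure \<nu>" "A \<in> sets borel" "B \<in> sets borel" "B \<subseteq> A"
  shows "\<nu> (A - B) = \<nu> A - \<nu> B"
proof -
  have "(A - B) \<union> B = A" "(A - B) \<inter> B = {}" using assms(4) by blast+
  thus ?thesis using signed_measure_Un[OF assms(1), of "A - B" B] assms(2,3) by auto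
qed

lemma signed_measure_uminus: "signed_measure \<nu> \<Longrightarrow> signed_measure (\<lambda>A. - \<nu> A)"
  unfolding signed_measure_def by (auto intro!: sums_minus)

text \<open>If \<open>\<nu>\<close> were unbounded, one could repeatedly split off sets of mass at least 1, always keeping
  a part on which \<open>\<nu>\<close> is still unbounded.\<close>
lemma signed_measure_bounded:
  fixes \<nu> :: "'a::euclidean_space set \<Rightarrow> real"
  assumes sm: "signed_measure \<nu>"
  shows "\<exists>B. \<forall>A. \<bar>\<nu> A\<bar> \<le> B"
proof (rule ccontr)
  define U where "U A \<longleftrightarrow> A \<in> sets borel \<and> (\<forall>b. \<exists>B\<in>sets borel. B \<subseteq> A \<and> \<bar>\<nu> B\<bar> > b)" for A
  assume "\<not> ?thesis"
  hence unb: "\<exists>A. \<bar>\<nu> A\<bar> > b" for b by (meson not_less)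
  have U0: "U UNIV" unfolding U_def
  proof (intro conjI allI)
    fix b :: real
    obtain A where A: "\<bar>\<nu> A\<bar> > \<bar>b\<bar>" using unb by blast
    hence "A \<in> sets borel" using sm unfolding signed_measure_def by force
    thus "\<exists>B\<in>sets borel. B \<subseteq> UNIV \<and> \<bar>\<nu> B\<bar> > b" using A by force
  qed simp
  have step: "\<exists>B. U B \<and> B \<subseteq> A \<and> \<bar>\<nu> (A - B)\<bar> \<ge> 1" if UA: "U A" for A
  proof -
    have A: "A \<in> sets borel" using UA U_def by blast
    \<comment> \<open>The margin 1 + |\<nu> A| makes both |\<nu> B| and |\<nu> (A - B)| exceed 1, so
      whichever of the two pieces stays unbounded, the discarded one has mass at least 1.\<close>
    obtain B where B: "B \<in> sets borel" "B \<subseteq> A" "\<bar>\<nu> B\<bar> > 1 + \<bar>\<nu> A\<bar>"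
      using UA unfolding U_def by blast
    have d: "\<nu> (A - B) = \<nu> A - \<nu> B" using signed_measure_Diff[OF sm A B(1,2)] .
    have "U B \<or> U (A - B)"
    proof (rule ccontr)
      assume "\<not> ?thesis"
      hence nU: "\<not> U B" "\<not> U (A - B)" by blast+
      from nU(1) obtain b where b: "\<And>C. C \<in> sets borel \<Longrightarrow> C \<subseteq> B \<Longrightarrow> \<bar>\<nu> C\<bar> \<le> b"
        using B(1) unfolding U_def not_less[symmetric] by blast
      from nU(2) obtain c where c: "\<And>C. C \<in> sets borel \<Longrightarrow> C \<subseteq> A - B \<Longrightarrow> \<bar>\<nu> C\<bar> \<le> c"
        using sets.Diff[OF A B(1)] unfolding U_def not_less[symmetric] by blast
      obtain C where C: "C \<in> sets borel" "C \<subseteq> A" "\<bar>\<nu> C\<bar> > b + c" using UA unfolding U_def by blast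
      have "C = (C \<inter> B) \<union> (C - B)" by blast
      hence "\<nu> C = \<nu> (C \<inter> B) + \<nu> (C - B)"
        using signed_measure_Un[OF sm, of "C \<inter> B" "C - B"] C B by auto
      moreover have "\<bar>\<nu> (C \<inter> B)\<bar> \<le> b" using C B by (intro b) auto
      moreover have "\<bar>\<nu> (C - B)\<bar> \<le> c" using C B by (intro c) auto
      ultimately show False using C(3) by arith
    qed
    thus ?thesis
    proof
      assume "U B" thus ?thesis using B d by (intro exI[of _ B]) auto
    next
      assume "U (A - B)"
      moreover have "A - (A - B) = B" using B by blast
      ultimately show ?thesis using B by (intro exI[of _ "A - B"]) auto
    qed
  qed
  obtain f where f: "f 0 = UNIV" "\<And>n. U (f n)" "\<And>n. f (Suc n) \<subseteq> f n \<and> \<bar>\<nu> (f n - f (Suc n))\<bar> \<ge> 1"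
  proof -
    have "\<exists>f. \<forall>n. (U (f n) \<and> (n = 0 \<longrightarrow> f n = UNIV)) \<and> (f (Suc n) \<subseteq> f n \<and> \<bar>\<nu> (f n - f (Suc n))\<bar> \<ge> 1)"
    proof (rule dependent_nat_choice)
      show "\<exists>x. U x \<and> (0 = (0::nat) \<longrightarrow> x = UNIV)" using U0 by blast
      fix A and n :: nat assume "U A \<and> (n = 0 \<longrightarrow> A = UNIV)"
      then obtain B where "U B \<and> B \<subseteq> A \<and> \<bar>\<nu> (A - B)\<bar> \<ge> 1" using step by blast
      thus "\<exists>B. (U B \<and> (Suc n = 0 \<longrightarrow> B = UNIV)) \<and> B \<subseteq> A \<and> \<bar>\<nu> (A - B)\<bar> \<ge> 1" by blast
    qed
    thus ?thesis using that by blast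
  qed
  \<comment> \<open>The discarded pieces are disjoint, so their masses form a convergent series; its
    terms would have to tend to 0, yet each is at least 1 in modulus.\<close>
  define D where "D n = f n - f (Suc n)" for n
  have dec: "f m \<subseteq> f n" if "n \<le> m" for n m
    using that by (rule lift_Suc_antimono_le[of f, rotated]) (use f(3) in blast)
  have "disjoint_family D" unfolding disjoint_family_on_def D_def
  proof (intro ballI impI)
    fix m n :: nat assume "m \<noteq> n"
    then consider "Suc m \<le> n" | "Suc n \<le> m" by linarith
    thus "(f m - f (Suc m)) \<inter> (f n - f (Suc n)) = {}"
      by cases (use dec in blast)+
  qed
  moreover have "range D \<subseteq> sets borel" using f(2) unfolding D_def U_def by auto
  ultimately have "(\<lambda>n. \<nu> (D n)) \<longlonglongrightarrow> 0"
    using signed_measure_sums[OF sm] sums_summable summable_LIMSEQ_zero by blast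
  from order_tendstoD(2)[OF tendsto_rabs_zero[OF this], of 1]
  have "eventually (\<lambda>n. \<bar>\<nu> (D n)\<bar> < 1) sequentially" by simp
  moreover have "\<not> \<bar>\<nu> (D n)\<bar> < 1" for n using f(3) unfolding D_def by (simp add: not_less)
  ultimately show False by simp
qed

section \<open>Jordan decomposition\<close>

definition upper_variation :: "('a::euclidean_space set \<Rightarrow> real) \<Rightarrow> 'a set \<Rightarrow> real" where
  "upper_variation \<nu> A = (SUP B\<in>{B. B \<in> sets borel \<and> B \<subseteq> A}. \<nu> B)"

text \<open>Boundedness of \<nu> supplies the upper bound without which the real supremum in
  \<open>upper_variation\<close> would be meaningless.\<close>

lemma upper_variation_upper:
  assumes "signed_measure \<nu>" "B \<in> sets borel" "B \<subseteq> A"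
  shows "\<nu> B \<le> upper_variation \<nu> A"
  unfolding upper_variation_def
proof (rule cSUP_upper)
  obtain b where "\<And>A. \<bar>\<nu> A\<bar> \<le> b" using signed_measure_bounded[OF assms(1)] by blast
  thus "bdd_above (\<nu> ` {B \<in> sets borel. B \<subseteq> A})" by (intro bdd_aboveI2[of _ _ b]) (auto simp: abs_le_iff)
qed (use assms in auto)

lemma upper_variation_least:
  assumes "\<And>B. B \<in> sets borel \<Longrightarrow> B \<subseteq> A \<Longrightarrow> \<nu> B \<le> b"
  shows "upper_variation \<nu> A \<le> b"
  unfolding upper_variation_def by (rule cSUP_least) (use assms in auto)

lemma upper_variation_nonneg: "signed_measure \<nu> \<Longrightarrow> 0 \<le> upper_variation \<nu> A"
  using upper_variation_upper[of \<nu> "{}" A] signed_measure_empty[of \<nu>] by simp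

lemma upper_variation_empty: "signed_measure \<nu> \<Longrightarrow> upper_variation \<nu> {} = 0"
  using upper_variation_nonneg[of \<nu> "{}"] upper_variation_least[of "{}" \<nu> 0] signed_measure_empty[of \<nu>]
  by fastforce

lemma upper_variation_mono:
  "signed_measure \<nu> \<Longrightarrow> A \<subseteq> B \<Longrightarrow> upper_variation \<nu> A \<le> upper_variation \<nu> B"
  by (rule upper_variation_least) (auto intro!: upper_variation_upper)

text \<open>Unions of competitors for A and for B compete for A \<union> B. Taking the two suprema
  one after the other avoids approximating sequences.\<close>

lemma upper_variation_Un:
  assumes "signed_measure \<nu>" "A \<inter> B = {}"
  shows "upper_variation \<nu> A + upper_variation \<nu> B \<le> upper_variation \<nu> (A \<union> B)"
proof -
  have "upper_variation \<nu> A \<le> upper_variation \<nu> (A \<union> B) - upper_variation \<nu> B"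
  proof (rule upper_variation_least)
    fix X assume X: "X \<in> sets borel" "X \<subseteq> A"
    have "upper_variation \<nu> B \<le> upper_variation \<nu> (A \<union> B) - \<nu> X"
    proof (rule upper_variation_least)
      fix Y assume Y: "Y \<in> sets borel" "Y \<subseteq> B"
      have "\<nu> (X \<union> Y) \<le> upper_variation \<nu> (A \<union> B)"
        using upper_variation_upper[OF assms(1) sets.Un[OF X(1) Y(1)] Un_mono[OF X(2) Y(2)]] .
      moreover have "X \<inter> Y = {}" using X(2) Y(2) assms(2) by blast
      hence "\<nu> (X \<union> Y) = \<nu> X + \<nu> Y" by (rule signed_measure_Un[OF assms(1) X(1) Y(1)])
      ultimately show "\<nu> Y \<le> upper_variation \<nu> (A \<union> B) - \<nu> X" by simp
    qed
    thus "\<nu> X \<le> upper_variation \<nu> (A \<union> B) - upper_variation \<nu> B" by simp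
  qed
  thus ?thesis by simp
qed

text \<open>Superadditivity on finite unions bounds the series from above. Conversely, a Borel set
  inside the union is cut along the \<open>A i\<close>, and countable additivity of \<nu> bounds its
  mass by the sum of the upper variations.\<close>

lemma upper_variation_countably_additive:
  assumes sm: "signed_measure \<nu>"
  shows "countably_additive (sets borel) (\<lambda>A. ennreal (upper_variation \<nu> A))"
proof (rule countably_additiveI)
  fix A :: "nat \<Rightarrow> 'a set"
  assume A: "range A \<subseteq> sets borel" "disjoint_family A"
  have fin: "(\<Sum>i<n. upper_variation \<nu> (A i)) \<le> upper_variation \<nu> (\<Union>i<n. A i)" for n
  proof (induction n)
    case (Suc n)
    have "(\<Union>i<n. A i) \<inter> A n = {}"
      using A(2) unfolding disjoint_family_on_def by (metis UN_E UNIV_I disjoint_iff lessThan_iff nat_neq_iff)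
    from upper_variation_Un[OF sm this] Suc show ?case by (simp add: lessThan_Suc Un_commute)
  qed (simp add: upper_variation_empty sm)
  show "(\<Sum>i. ennreal (upper_variation \<nu> (A i))) = ennreal (upper_variation \<nu> (\<Union>i. A i))"
  proof (rule antisym)
    show "(\<Sum>i. ennreal (upper_variation \<nu> (A i))) \<le> ennreal (upper_variation \<nu> (\<Union>i. A i))"
    proof (rule suminf_le_const[OF summableI])
      fix n
      have "(\<Sum>i<n. upper_variation \<nu> (A i)) \<le> upper_variation \<nu> (\<Union>i. A i)"
        by (rule order_trans[OF fin upper_variation_mono[OF sm]]) blast
      thus "(\<Sum>i<n. ennreal (upper_variation \<nu> (A i))) \<le> ennreal (upper_variation \<nu> (\<Union>i. A i))"
        by (simp add: sum_ennreal upper_variation_nonneg sm ennreal_leI)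
    qed
    show "ennreal (upper_variation \<nu> (\<Union>i. A i)) \<le> (\<Sum>i. ennreal (upper_variation \<nu> (A i)))"
    proof (cases "\<Sum>i. ennreal (upper_variation \<nu> (A i))")
      case (real s)
      have ps: "(\<Sum>i<n. upper_variation \<nu> (A i)) \<le> s" for n
      proof -
        have "ennreal (\<Sum>i<n. upper_variation \<nu> (A i)) = (\<Sum>i<n. ennreal (upper_variation \<nu> (A i)))"
          by (simp add: upper_variation_nonneg sm)
        also have "\<dots> \<le> ennreal s" unfolding real(2)[symmetric] by (intro sum_le_suminf) auto
        finally show ?thesis using real(1) by simp
      qed
      have "upper_variation \<nu> (\<Union>i. A i) \<le> s"
      proof (rule upper_variation_least)
        fix B assume B: "B \<in> sets borel" "B \<subseteq> (\<Union>i. A i)"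
        have BA: "B \<inter> A i \<in> sets borel" for i using A(1) B(1) by (intro sets.Int) auto
        have "(\<lambda>i. \<nu> (B \<inter> A i)) sums \<nu> (\<Union>i. B \<inter> A i)"
        proof (intro signed_measure_sums sm)
          show "range (\<lambda>i. B \<inter> A i) \<subseteq> sets borel" using BA by blast
          show "disjoint_family (\<lambda>i. B \<inter> A i)" using A(2) unfolding disjoint_family_on_def by blast
        qed
        moreover have "(\<Union>i. B \<inter> A i) = B" using B by blast
        ultimately have "(\<lambda>n. \<Sum>i<n. \<nu> (B \<inter> A i)) \<longlonglongrightarrow> \<nu> B" by (simp add: sums_def)
        moreover have "(\<Sum>i<n. \<nu> (B \<inter> A i)) \<le> s" for n
        proof (rule order_trans[OF sum_mono ps[of n]])
          show "\<nu> (B \<inter> A i) \<le> upper_variation \<nu> (A i)" for i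
            by (rule upper_variation_upper[OF sm BA]) blast
        qed
        ultimately show "\<nu> B \<le> s" by (intro LIMSEQ_le_const2) auto
      qed
      thus ?thesis using real by (simp add: ennreal_leI)
    qed simp
  qed
qed

lemma sigma_sets_borel: "sigma_sets UNIV (sets borel) = sets borel"
  using sets.sigma_sets_eq[of borel] by simp

lemma pos_variation_eq:
  "pos_variation \<nu> = measure_of UNIV (sets borel) (\<lambda>A. ennreal (upper_variation \<nu> A))"
  unfolding pos_variation_def upper_variation_def ..

lemma sets_pos_variation [measurable_cong, simp]: "sets (pos_variation \<nu>) = sets borel"
  unfolding pos_variation_eq by (simp add: sigma_sets_borel)

lemma space_pos_variation [simp]: "space (pos_variation \<nu>) = UNIV"
  unfolding pos_variation_eq by simp

text \<open>\<open>measure_of\<close> returns the given set function only once countable additivity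
  is known; from here on \<open>pos_variation\<close> is a genuine measure.\<close>

lemma emeasure_pos_variation:
  assumes "signed_measure \<nu>" "A \<in> sets borel"
  shows "emeasure (pos_variation \<nu>) A = ennreal (upper_variation \<nu> A)"
  unfolding pos_variation_eq
  by (rule emeasure_measure_of[OF refl])
     (use assms upper_variation_countably_additive in
       \<open>auto simp: positive_def upper_variation_empty pos_variation_eq sigma_sets_borel\<close>)

lemma sets_neg_variation [measurable_cong, simp]: "sets (neg_variation \<nu>) = sets borel"
  unfolding neg_variation_def by simp

lemma space_neg_variation [simp]: "space (neg_variation \<nu>) = UNIV"
  unfolding neg_variation_def by simp

lemma finite_pos_variation: "signed_measure \<nu> \<Longrightarrow> finite_measure (pos_variation \<nu>)"
  by (rule finite_measureI) (simp add: emeasure_pos_variation)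

lemma finite_neg_variation: "signed_measure \<nu> \<Longrightarrow> finite_measure (neg_variation \<nu>)"
  unfolding neg_variation_def by (intro finite_pos_variation signed_measure_uminus)

lemma measure_pos_variation:
  assumes "signed_measure \<nu>" "A \<in> sets borel"
  shows "measure (pos_variation \<nu>) A = upper_variation \<nu> A"
  unfolding measure_def using emeasure_pos_variation[OF assms] upper_variation_nonneg[OF assms(1)] by simp

text \<open>Passing from B to A - B exchanges the two suprema, because - \<nu> B = \<nu> (A - B) -
  \<nu> A. This gives the Jordan decomposition without a Hahn decomposition of the space.\<close>

lemma measure_neg_variation:
  assumes "signed_measure \<nu>" "A \<in> sets borel"
  shows "measure (neg_variation \<nu>) A = upper_variation \<nu> A - \<nu> A"
proof -
  have um: "signed_measure (\<lambda>A. - \<nu> A)" by (intro signed_measure_uminus assms)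
  have "upper_variation (\<lambda>A. - \<nu> A) A = upper_variation \<nu> A - \<nu> A"
  proof (rule antisym)
    show "upper_variation (\<lambda>A. - \<nu> A) A \<le> upper_variation \<nu> A - \<nu> A"
    proof (rule upper_variation_least)
      fix B assume B: "B \<in> sets borel" "B \<subseteq> A"
      show "- \<nu> B \<le> upper_variation \<nu> A - \<nu> A"
        using upper_variation_upper[OF assms(1) sets.Diff[OF assms(2) B(1)], of A]
        by (simp add: signed_measure_Diff[OF assms B] Diff_subset)
    qed
    have "upper_variation \<nu> A \<le> upper_variation (\<lambda>A. - \<nu> A) A + \<nu> A"
    proof (rule upper_variation_least)
      fix B assume B: "B \<in> sets borel" "B \<subseteq> A"
      show "\<nu> B \<le> upper_variation (\<lambda>A. - \<nu> A) A + \<nu> A"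
        using upper_variation_upper[OF um sets.Diff[OF assms(2) B(1)], of A]
        by (simp add: signed_measure_Diff[OF assms B] Diff_subset)
    qed
    thus "upper_variation \<nu> A - \<nu> A \<le> upper_variation (\<lambda>A. - \<nu> A) A" by simp
  qed
  thus ?thesis unfolding neg_variation_def using measure_pos_variation[OF um assms(2)] by simp
qed

lemma signed_measure_decomp:
  assumes "signed_measure \<nu>"
  shows "\<nu> A = measure (pos_variation \<nu>) A - measure (neg_variation \<nu>) A"
proof (cases "A \<in> sets borel")
  case True
  thus ?thesis using assms by (simp add: measure_pos_variation measure_neg_variation)
next
  case False
  thus ?thesis using assms by (simp add: measure_notin_sets signed_measure_def)
qed

section \<open>Total variation\<close>

definition variation_sums :: "('a::euclidean_space set \<Rightarrow> real) \<Rightarrow> real set" where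
  "variation_sums \<nu> = {(\<Sum>i<n. \<bar>\<nu> (A i)\<bar>) | (n::nat) (A :: nat \<Rightarrow> 'a set).
       (\<forall>i<n. A i \<in> sets borel) \<and> disjoint_family_on A {..<n}}"

lemma variation_sums_le:
  fixes P N :: "'a::euclidean_space measure"
  assumes "finite_measure P" "finite_measure N" "sets P = sets borel" "sets N = sets borel"
    and \<nu>: "\<And>A. A \<in> sets borel \<Longrightarrow> \<nu> A = measure P A - measure N A"
    and s: "s \<in> variation_sums \<nu>"
  shows "s \<le> measure P UNIV + measure N UNIV"
proof -
  interpret P: finite_measure P by fact
  interpret N: finite_measure N by fact
  from s have "\<exists>(n::nat) (A :: nat \<Rightarrow> 'a set). s = (\<Sum>i<n. \<bar>\<nu> (A i)\<bar>) \<and> (\<forall>i<n. A i \<in> sets borel) \<and> disjoint_family_on A {..<n}"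
    unfolding variation_sums_def mem_Collect_eq .
  then obtain n :: nat and A :: "nat \<Rightarrow> 'a set" where
    *: "s = (\<Sum>i<n. \<bar>\<nu> (A i)\<bar>) \<and> (\<forall>i<n. A i \<in> sets borel) \<and> disjoint_family_on A {..<n}"
    by (elim exE)
  hence A: "\<And>i. i < n \<Longrightarrow> A i \<in> sets borel" "disjoint_family_on A {..<n}"
    and s: "s = (\<Sum>i<n. \<bar>\<nu> (A i)\<bar>)" by auto
  have "s \<le> (\<Sum>i<n. measure P (A i) + measure N (A i))" unfolding s
  proof (rule sum_mono)
    fix i assume "i \<in> {..<n}"
    thus "\<bar>\<nu> (A i)\<bar> \<le> measure P (A i) + measure N (A i)"
      using \<nu>[OF A(1)[of i]] measure_nonneg[of P "A i"] measure_nonneg[of N "A i"]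
      by (simp add: abs_le_iff)
  qed
  also have "\<dots> = measure P (\<Union>i<n. A i) + measure N (\<Union>i<n. A i)"
  proof -
    have "A ` {..<n} \<subseteq> sets P" "A ` {..<n} \<subseteq> sets N" using A(1) assms(3,4) by auto
    thus ?thesis
      using A(2) by (simp only: sum.distrib P.finite_measure_finite_Union N.finite_measure_finite_Union
          finite_lessThan)
  qed
  also have "\<dots> \<le> measure P UNIV + measure N UNIV"
    using assms(3,4) by (intro add_mono P.finite_measure_mono N.finite_measure_mono) auto
  finally show ?thesis .
qed

lemma total_variation_le:
  fixes P N :: "'a::euclidean_space measure"
  assumes "finite_measure P" "finite_measure N" "sets P = sets borel" "sets N = sets borel"
    and \<nu>: "\<And>A. A \<in> sets borel \<Longrightarrow> \<nu> A = measure P A - measure N A"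
  shows "total_variation \<nu> \<le> measure P UNIV + measure N UNIV"
proof -
  \<comment> \<open>The empty partition keeps the supremum from ranging over an empty set.\<close>
  have "0 \<in> variation_sums \<nu>" unfolding variation_sums_def
    by (intro CollectI exI[of _ "0::nat"] exI[of _ "\<lambda>_. {}"]) (auto simp: disjoint_family_on_def)
  hence "variation_sums \<nu> \<noteq> {}" by blast
  thus ?thesis unfolding total_variation_def variation_sums_def[symmetric]
    by (rule cSup_least) (rule variation_sums_le[OF assms])
qed

lemma total_variation_eq:
  assumes sm: "signed_measure \<nu>"
  shows "total_variation \<nu> = measure (pos_variation \<nu>) UNIV + measure (neg_variation \<nu>) UNIV"
proof (rule antisym)
  note fin = finite_pos_variation[OF sm] finite_neg_variation[OF sm]
    sets_pos_variation sets_neg_variation signed_measure_decomp[OF sm]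
  show "total_variation \<nu> \<le> measure (pos_variation \<nu>) UNIV + measure (neg_variation \<nu>) UNIV"
    by (rule total_variation_le[OF fin])
  have bdd: "bdd_above (variation_sums \<nu>)"
    by (rule bdd_aboveI, rule variation_sums_le[OF fin])
  \<comment> \<open>The partition into B and - B gives 2 * \<nu> B - \<nu> UNIV \<le>
    \<open>total_variation\<close> \<nu>, which is solved for \<nu> B. The two variations together
    have mass 2 * \<open>upper_variation\<close> \<nu> UNIV - \<nu> UNIV.\<close>
  have "upper_variation \<nu> UNIV \<le> (total_variation \<nu> + \<nu> UNIV) / 2"
  proof (rule upper_variation_least)
    fix B :: "'a set" assume B: "B \<in> sets borel"
    define A where "A i = (if i = 0 then B else - B)" for i :: nat
    have "(\<Sum>i<2. \<bar>\<nu> (A i)\<bar>) \<in> variation_sums \<nu>" unfolding variation_sums_def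
      by (intro CollectI exI[of _ "2::nat"] exI[of _ A])
         (auto simp: disjoint_family_on_def A_def less_2_cases_iff B borel_comp)
    hence "(\<Sum>i<2. \<bar>\<nu> (A i)\<bar>) \<le> total_variation \<nu>"
      unfolding total_variation_def variation_sums_def[symmetric] using bdd by (intro cSup_upper)
    moreover have "\<nu> (- B) = \<nu> UNIV - \<nu> B"
      using signed_measure_Diff[OF sm, of UNIV B] B by (simp add: Compl_eq_Diff_UNIV)
    ultimately show "\<nu> B \<le> (total_variation \<nu> + \<nu> UNIV) / 2"
      by (simp add: A_def numeral_2_eq_2)
  qed
  thus "measure (pos_variation \<nu>) UNIV + measure (neg_variation \<nu>) UNIV \<le> total_variation \<nu>"
    using sm by (simp add: measure_pos_variation measure_neg_variation)
qed

lemma signed_measure_diff_measure: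
  fixes P N :: "'a::euclidean_space measure"
  assumes "finite_measure P" "finite_measure N" "sets P = sets borel" "sets N = sets borel"
  shows "signed_measure (\<lambda>A. measure P A - measure N A)"
  unfolding signed_measure_def
proof (intro conjI allI impI)
  interpret P: finite_measure P by fact
  interpret N: finite_measure N by fact
  show "measure P A - measure N A = 0" if "A \<notin> sets borel" for A
    using that assms by (simp add: measure_notin_sets)
  show "(\<lambda>i. measure P (A i) - measure N (A i)) sums (measure P (\<Union>i. A i) - measure N (\<Union>i. A i))"
    if "range A \<subseteq> sets borel" "disjoint_family A" for A :: "nat \<Rightarrow> 'a set"
    using that assms by (intro sums_diff P.finite_measure_UNION N.finite_measure_UNION) auto
qed

section \<open>Integration against differences of finite measures\<close>

lemma integrable_bounded_borel:
  fixes f :: "'a::topological_space \<Rightarrow> 'b::{banach,second_countable_topology}"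
  assumes "finite_measure M" "sets M = sets borel" "f \<in> borel_measurable borel" "\<And>x. norm (f x) \<le> B"
  shows "integrable M f"
proof -
  interpret finite_measure M by fact
  have "f \<in> borel_measurable M" using measurable_cong_sets[OF assms(2) refl, of borel] assms(3) by blast
  thus ?thesis using assms by (intro integrable_const_bound[of _ B]) auto
qed

text \<open>Equality of sums is the subtraction-free form of an equality of differences, so the
  induction over nonnegative functions never meets a difference of infinite integrals.\<close>

lemma integral_sum_measures:
  fixes f :: "'a::euclidean_space \<Rightarrow> real"
  assumes P: "finite_measure P1" "finite_measure P2" "finite_measure Q1" "finite_measure Q2"
    and s: "sets P1 = sets borel" "sets P2 = sets borel" "sets Q1 = sets borel" "sets Q2 = sets borel"
    and e: "\<And>A. A \<in> sets borel \<Longrightarrow> measure P1 A + measure P2 A = measure Q1 A + measure Q2 A"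
    and f: "f \<in> borel_measurable borel" "\<And>x. \<bar>f x\<bar> \<le> B"
  shows "integral\<^sup>L P1 f + integral\<^sup>L P2 f = integral\<^sup>L Q1 f + integral\<^sup>L Q2 f"
proof -
  have int: "integrable M f" if "finite_measure M" "sets M = sets borel" for M
    by (rule integrable_bounded_borel[OF that f(1), of B]) (use f(2) in simp)
  have m: "u \<in> borel_measurable P1" "u \<in> borel_measurable P2" "u \<in> borel_measurable Q1" "u \<in> borel_measurable Q2"
    if "u \<in> borel_measurable borel" for u :: "'a \<Rightarrow> ennreal"
    using that s[THEN measurable_cong_sets[OF _ refl, of _ _ borel]] by blast+
  have em: "emeasure P1 A + emeasure P2 A = emeasure Q1 A + emeasure Q2 A" if A: "A \<in> sets borel" for A
  proof -
    have "ennreal (measure P1 A + measure P2 A) = ennreal (measure Q1 A + measure Q2 A)" using e[OF A] by simp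
    thus ?thesis using P by (simp add: finite_measure.emeasure_eq_measure ennreal_plus)
  qed
  have nn: "(\<integral>\<^sup>+x. g x \<partial>P1) + (\<integral>\<^sup>+x. g x \<partial>P2) = (\<integral>\<^sup>+x. g x \<partial>Q1) + (\<integral>\<^sup>+x. g x \<partial>Q2)"
    if "g \<in> borel_measurable borel" for g :: "'a \<Rightarrow> ennreal"
    using that
  proof (induction g)
    case (cong f g)
    have "f = g" using cong.hyps(3) by auto
    thus ?case using cong.IH by simp
  next
    case (set A)
    thus ?case using em s by simp
  next
    case (mult u c)
    have *: "(\<integral>\<^sup>+x. c * u x \<partial>R) = c * (\<integral>\<^sup>+x. u x \<partial>R)" if "R \<in> {P1, P2, Q1, Q2}" for R
      using that m[OF mult.hyps(2)] by (intro nn_integral_cmult) blast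
    show ?case
      unfolding *[of P1, simplified] *[of P2, simplified] *[of Q1, simplified] *[of Q2, simplified]
        distrib_left[symmetric] mult.IH ..
  next
    case (add u v)
    have *: "(\<integral>\<^sup>+x. v x + u x \<partial>R) = (\<integral>\<^sup>+x. v x \<partial>R) + (\<integral>\<^sup>+x. u x \<partial>R)" if "R \<in> {P1, P2, Q1, Q2}" for R
      using that m[OF add.hyps(1)] m[OF add.hyps(3)] by (intro nn_integral_add) blast+
    show ?case
      unfolding *[of P1, simplified] *[of P2, simplified] *[of Q1, simplified] *[of Q2, simplified]
      using arg_cong2[OF add.IH, of "(+)"] by (simp only: add_ac)
  next
    case (seq U)
    have *: "integral\<^sup>N R (Sup (range U)) = (SUP i. integral\<^sup>N R (U i))" if "R \<in> {P1, P2, Q1, Q2}" for R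
    proof -
      have "(\<integral>\<^sup>+x. (SUP i. U i x) \<partial>R) = (SUP i. integral\<^sup>N R (U i))"
        by (rule nn_integral_monotone_convergence_SUP) (use that m[OF seq.hyps(1)] seq.hyps(3) in blast)+
      moreover have "Sup (range U) = (\<lambda>x. SUP i. U i x)" by (simp add: fun_eq_iff image_comp)
      ultimately show ?thesis by (simp only:)
    qed
    have inc: "incseq (\<lambda>i. integral\<^sup>N R (U i))" for R
      using seq.hyps(3) by (intro incseq_SucI nn_integral_mono) (simp add: incseq_Suc_iff le_fun_def)
    show ?case
      unfolding *[of P1, simplified] *[of P2, simplified] *[of Q1, simplified] *[of Q2, simplified]
      by (simp only: ennreal_SUP_add[OF inc inc, symmetric] seq.IH)
  qed
  have B: "0 \<le> B" using f(2)[of undefined] by linarith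
  \<comment> \<open>Adding the bound B makes f nonnegative; the extra terms B *
    \<open>measure M UNIV\<close> balance out by the hypothesis applied to UNIV.\<close>
  have *: "integral\<^sup>L M f = enn2real (\<integral>\<^sup>+x. ennreal (f x + B) \<partial>M) - B * measure M UNIV
      \<and> (\<integral>\<^sup>+x. ennreal (f x + B) \<partial>M) < top"
    if "finite_measure M" "sets M = sets borel" for M
  proof -
    interpret finite_measure M by fact
    have nn: "AE x in M. 0 \<le> f x + B" using f(2) by (intro AE_I2) (smt (verit))
    have i: "integrable M f" by (rule int[OF that])
    hence "integrable M (\<lambda>x. f x + B)" by simp
    from nn_integral_eq_integral[OF this nn]
    have eq: "(\<integral>\<^sup>+x. ennreal (f x + B) \<partial>M) = ennreal (integral\<^sup>L M (\<lambda>x. f x + B))" .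
    have "0 \<le> integral\<^sup>L M (\<lambda>x. f x + B)" using nn by (rule integral_nonneg_AE)
    moreover have "integral\<^sup>L M (\<lambda>x. f x + B) = integral\<^sup>L M f + B * measure M UNIV"
      using i sets_eq_imp_space_eq[OF that(2)] by simp
    ultimately show ?thesis using eq by simp
  qed
  have "(\<integral>\<^sup>+x. ennreal (f x + B) \<partial>P1) + (\<integral>\<^sup>+x. ennreal (f x + B) \<partial>P2)
      = (\<integral>\<^sup>+x. ennreal (f x + B) \<partial>Q1) + (\<integral>\<^sup>+x. ennreal (f x + B) \<partial>Q2)"
    by (rule nn) (use f in simp)
  hence "enn2real (\<integral>\<^sup>+x. ennreal (f x + B) \<partial>P1) + enn2real (\<integral>\<^sup>+x. ennreal (f x + B) \<partial>P2)
      = enn2real (\<integral>\<^sup>+x. ennreal (f x + B) \<partial>Q1) + enn2real (\<integral>\<^sup>+x. ennreal (f x + B) \<partial>Q2)"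
    by (simp only: enn2real_plus[OF conjunct2[OF *[OF P(1) s(1)]] conjunct2[OF *[OF P(2) s(2)]], symmetric]
      enn2real_plus[OF conjunct2[OF *[OF P(3) s(3)]] conjunct2[OF *[OF P(4) s(4)]], symmetric])
  moreover have "B * measure P1 UNIV + B * measure P2 UNIV = B * measure Q1 UNIV + B * measure Q2 UNIV"
    using e[OF borel_open[OF open_UNIV]] by (simp only: distrib_left[symmetric])
  ultimately show ?thesis
    using *[OF P(1) s(1)] *[OF P(2) s(2)] *[OF P(3) s(3)] *[OF P(4) s(4)] by linarith
qed

text \<open>\<open>pos_variation\<close> + N and P + \<open>neg_variation\<close> agree on Borel
  sets, so a signed integral can be computed from any splitting.\<close>

lemma signed_integral_diff_measure:
  fixes P N :: "'a::euclidean_space measure"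
  assumes "finite_measure P" "finite_measure N" "sets P = sets borel" "sets N = sets borel"
    and f: "f \<in> borel_measurable borel" "\<And>x. \<bar>f x\<bar> \<le> B"
  shows "signed_integral (\<lambda>A. measure P A - measure N A) f = integral\<^sup>L P f - integral\<^sup>L N f"
proof -
  define \<nu> where "\<nu> = (\<lambda>A. measure P A - measure N A)"
  have sm: "signed_measure \<nu>" unfolding \<nu>_def by (rule signed_measure_diff_measure[OF assms(1-4)])
  have "integral\<^sup>L (pos_variation \<nu>) f + integral\<^sup>L N f = integral\<^sup>L P f + integral\<^sup>L (neg_variation \<nu>) f"
  proof (rule integral_sum_measures[OF finite_pos_variation[OF sm] assms(2,1) finite_neg_variation[OF sm]])
    fix A :: "'a set"
    show "measure (pos_variation \<nu>) A + measure N A = measure P A + measure (neg_variation \<nu>) A"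
      using signed_measure_decomp[OF sm, of A] by (simp add: \<nu>_def)
  qed (use assms f in auto)
  thus ?thesis unfolding \<nu>_def[symmetric] signed_integral_def by simp
qed

section \<open>Functions vanishing at infinity and the Riesz representation\<close>

lemma C0_const [simp]: "C0 (\<lambda>x. 0)"
  by (simp add: C0_def)

lemma C0_add: "C0 f \<Longrightarrow> C0 g \<Longrightarrow> C0 (\<lambda>x. f x + g x)"
  unfolding C0_def by (auto intro!: continuous_intros tendsto_add_zero)

lemma C0_cmult: "C0 f \<Longrightarrow> C0 (\<lambda>x. c * f x)"
  unfolding C0_def by (auto intro!: continuous_intros tendsto_mult_right_zero)

lemma C0_divide: "C0 f \<Longrightarrow> C0 (\<lambda>x. f x / c)"
  using C0_cmult[of f "1 / c"] by simp

lemma C0_diff: "C0 f \<Longrightarrow> C0 g \<Longrightarrow> C0 (\<lambda>x. f x - g x)"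
  using C0_add[of f "\<lambda>x. -1 * g x"] C0_cmult[of g "-1"] by simp

lemma C0_dominated:
  assumes "C0 f" "continuous_on UNIV g" "\<And>x. \<bar>g x\<bar> \<le> \<bar>f x\<bar>"
  shows "C0 g"
  unfolding C0_def
proof
  have "((\<lambda>x. \<bar>f x\<bar>) \<longlongrightarrow> 0) at_infinity"
    using assms(1) unfolding C0_def by (intro tendsto_rabs_zero) auto
  thus "(g \<longlongrightarrow> 0) at_infinity"
    by (rule Lim_null_comparison[rotated]) (use assms(3) in simp)
qed fact

lemma C0_eventually_small:
  assumes "C0 f" "e > 0"
  obtains r where "r > 0" "\<And>x. norm x \<ge> r \<Longrightarrow> \<bar>f x\<bar> < e"
proof -
  have "eventually (\<lambda>x. \<bar>f x\<bar> < e) at_infinity"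
    using assms unfolding C0_def by (auto dest!: tendstoD[of _ 0 _ e] simp: dist_real_def)
  then obtain b where "\<And>x. norm x \<ge> b \<Longrightarrow> \<bar>f x\<bar> < e" unfolding eventually_at_infinity by blast
  thus ?thesis using that[of "max b 1"] by simp
qed

lemma C0_continuous: "C0 f \<Longrightarrow> continuous_on UNIV f"
  by (simp add: C0_def)

lemma C0_measurable [measurable_dest]: "C0 f \<Longrightarrow> f \<in> borel_measurable borel"
  by (rule borel_measurable_continuous_onI[OF C0_continuous])

lemma C0_compact_support:
  fixes f :: "'a::euclidean_space \<Rightarrow> real"
  assumes "continuous_on UNIV f" "\<And>x. norm x \<ge> r \<Longrightarrow> f x = 0"
  shows "C0 f"
  unfolding C0_def
proof
  have "eventually (\<lambda>x. f x = 0) at_infinity" unfolding eventually_at_infinity using assms(2) by blast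
  thus "(f \<longlongrightarrow> 0) at_infinity" by (rule tendsto_eventually)
qed fact

lemma C0_bounded:
  fixes f :: "'a::euclidean_space \<Rightarrow> real"
  assumes "C0 f"
  obtains B where "B > 0" "\<And>x. \<bar>f x\<bar> \<le> B"
proof -
  obtain r where r: "\<And>x. norm x \<ge> r \<Longrightarrow> \<bar>f x\<bar> < 1" using C0_eventually_small[OF assms, of 1] by auto
  have "bounded (f ` cball 0 r)"
    using C0_continuous[OF assms] by (intro compact_imp_bounded compact_continuous_image)
      (auto intro: continuous_on_subset)
  then obtain B where "\<forall>y\<in>f ` cball 0 r. norm y \<le> B" unfolding bounded_iff by blast
  hence B: "\<bar>f x\<bar> \<le> B" if "norm x \<le> r" for x using that by auto
  have "\<bar>f x\<bar> \<le> max B 1" for x using r[of x] B[of x] by (cases "norm x \<le> r") auto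
  thus ?thesis using that[of "max B 1"] by simp
qed

text \<open>The horizontal slice of f between the heights c and c + d, used below to compare a
  functional with an integral layer by layer.\<close>

lemma C0_cutoff:
  assumes "C0 f" "0 \<le> c" "0 \<le> d"
  shows "C0 (\<lambda>x. min (max (f x - c) 0) d)"
proof (rule C0_dominated[OF assms(1)])
  show "continuous_on UNIV (\<lambda>x. min (max (f x - c) 0) d)"
    using C0_continuous[OF assms(1)] by (intro continuous_intros)
  show "\<bar>min (max (f x - c) 0) d\<bar> \<le> \<bar>f x\<bar>" for x using assms(2,3) by auto
qed

definition C0_nonneg :: "('a::euclidean_space \<Rightarrow> real) \<Rightarrow> bool" where
  "C0_nonneg f \<longleftrightarrow> C0 f \<and> (\<forall>x. 0 \<le> f x)"

text \<open>A continuous exhaustion: 1 on the ball of radius n - 1, 0 outside radius n, increasing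
  in n. That \<open>ramp 0\<close> is zero lets the telescoping sums of its increments start from
  0.\<close>

definition ramp :: "nat \<Rightarrow> 'a::euclidean_space \<Rightarrow> real" where
  "ramp n x = min 1 (max 0 (real n - norm x))"

lemma C0_ramp: "C0 (ramp n)"
  unfolding ramp_def
  by (rule C0_compact_support[where r = "real n"]) (auto intro!: continuous_intros)

lemma ramp_nonneg: "0 \<le> ramp n x" and ramp_le_1: "ramp n x \<le> 1"
  and ramp_mono: "ramp n x \<le> ramp (Suc n) x" and ramp_0: "ramp 0 x = 0"
  and ramp_eq_1: "norm x + 1 \<le> real n \<Longrightarrow> ramp n x = 1"
  by (auto simp: ramp_def)

lemma C0_nonneg_ramp: "C0_nonneg (ramp n)"
  by (simp add: C0_nonneg_def C0_ramp ramp_nonneg)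

section \<open>Riesz representation of a positive functional\<close>

locale C0_positive_functional =
  fixes P :: "('a::euclidean_space \<Rightarrow> real) \<Rightarrow> real" and m :: real
  assumes P_nonneg: "C0_nonneg f \<Longrightarrow> 0 \<le> P f"
    and P_add: "C0_nonneg f \<Longrightarrow> C0_nonneg g \<Longrightarrow> P (\<lambda>x. f x + g x) = P f + P g"
    and P_cmult: "C0_nonneg f \<Longrightarrow> 0 \<le> c \<Longrightarrow> P (\<lambda>x. c * f x) = c * P f"
    and P_le: "C0_nonneg f \<Longrightarrow> (\<And>x. f x \<le> 1) \<Longrightarrow> P f \<le> m"
begin

lemma P_zero: "P (\<lambda>x. 0) = 0"
  using P_cmult[of "\<lambda>x. 0" 0] by (simp add: C0_nonneg_def)

lemma m_nonneg: "0 \<le> m"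
  using P_le[of "\<lambda>x. 0"] P_zero by (simp add: C0_nonneg_def)

lemma P_mono:
  assumes "C0_nonneg f" "C0_nonneg g" "\<And>x. f x \<le> g x"
  shows "P f \<le> P g"
proof -
  have d: "C0_nonneg (\<lambda>x. g x - f x)" using assms by (auto simp: C0_nonneg_def intro: C0_diff)
  have "P g = P (\<lambda>x. f x + (g x - f x))" by simp
  also have "\<dots> = P f + P (\<lambda>x. g x - f x)" using assms d by (intro P_add)
  finally show ?thesis using P_nonneg[OF d] by simp
qed

lemma P_sum:
  assumes "\<And>i. i < (n::nat) \<Longrightarrow> C0_nonneg (f i)"
  shows "C0_nonneg (\<lambda>x. \<Sum>i<n. f i x) \<and> P (\<lambda>x. \<Sum>i<n. f i x) = (\<Sum>i<n. P (f i))"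
  using assms
proof (induction n)
  case 0
  thus ?case by (simp add: P_zero C0_nonneg_def)
next
  case (Suc n)
  hence IH: "C0_nonneg (\<lambda>x. \<Sum>i<n. f i x)" "P (\<lambda>x. \<Sum>i<n. f i x) = (\<Sum>i<n. P (f i))" by simp_all
  moreover have "C0_nonneg (\<lambda>x. (\<Sum>i<n. f i x) + f n x)"
    using IH(1) Suc.prems[of n] by (auto simp: C0_nonneg_def intro: C0_add)
  ultimately show ?case using P_add[OF IH(1) Suc.prems[of n]] by simp
qed

text \<open>Covering by functions rather than by open sets makes the outer measure directly
  comparable with P. The series takes values in \<open>ennreal\<close>, so it may diverge.\<close>

definition covers :: "'a set \<Rightarrow> (nat \<Rightarrow> 'a \<Rightarrow> real) set" where
  "covers A = {f. (\<forall>n. C0_nonneg (f n)) \<and> (\<forall>x\<in>A. 1 \<le> (\<Sum>n. ennreal (f n x)))}"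

definition om :: "'a set \<Rightarrow> ennreal" where
  "om A = (INF f\<in>covers A. \<Sum>n. ennreal (P (f n)))"

lemma om_le: "f \<in> covers A \<Longrightarrow> om A \<le> (\<Sum>n. ennreal (P (f n)))"
  unfolding om_def by (rule INF_lower)

lemma om_mono: "A \<subseteq> B \<Longrightarrow> om A \<le> om B"
  unfolding om_def by (rule INF_superset_mono) (auto simp: covers_def)

lemma om_le_single:
  assumes "C0_nonneg f" "\<And>x. x \<in> A \<Longrightarrow> 1 \<le> f x"
  shows "om A \<le> ennreal (P f)"
proof -
  define g where "g n = (if n = 0 then f else (\<lambda>x. 0))" for n :: nat
  have s: "(\<Sum>n. ennreal (g n x)) = ennreal (f x)" for x
    using suminf_finite[of "{0}" "\<lambda>n. ennreal (g n x)"] by (simp add: g_def)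
  have "g \<in> covers A" unfolding covers_def mem_Collect_eq s
    using assms by (auto simp: g_def C0_nonneg_def)
  from om_le[OF this] show ?thesis
    using suminf_finite[of "{0}" "\<lambda>n. ennreal (P (g n))"] by (simp add: g_def P_zero)
qed

lemma om_empty: "om {} = 0"
  using om_le_single[of "\<lambda>x. 0" "{}"] by (simp add: P_zero C0_nonneg_def)

lemma om_close: "om A < e \<Longrightarrow> \<exists>f\<in>covers A. (\<Sum>n. ennreal (P (f n))) < e"
  unfolding om_def INF_less_iff .

text \<open>Near-optimal covers with errors e / 2^(n+1) are merged into one sequence by
  \<open>prod_decode\<close>; in \<open>ennreal\<close> the double series of function values and of
  costs may be rearranged freely.\<close>

lemma om_countably_subadditive: "om (\<Union>i. A i) \<le> (\<Sum>i. om (A i))" for A :: "nat \<Rightarrow> 'a set"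
proof (rule ennreal_le_epsilon)
  fix e :: real assume e: "0 < e" and fin: "(\<Sum>i. om (A i)) < top"
  have *: "om (A n) < om (A n) + e * (1/2)^Suc n" for n
    using e fin by (auto simp add: less_top dest!: ennreal_suminf_lessD)
  from om_close[OF *] have "\<forall>n. \<exists>f. f \<in> covers (A n) \<and> (\<Sum>i. ennreal (P (f i))) < om (A n) + e * (1/2)^Suc n"
    by blast
  then obtain B where B: "\<And>n. B n \<in> covers (A n)"
    and Ble: "\<And>n. (\<Sum>i. ennreal (P (B n i))) < om (A n) + e * (1/2)^Suc n" by metis
  define C where "C k = B (fst (prod_decode k)) (snd (prod_decode k))" for k
  have "C \<in> covers (\<Union>i. A i)" unfolding covers_def
  proof (intro CollectI conjI allI ballI)
    show "C0_nonneg (C n)" for n using B unfolding C_def covers_def by blast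
    fix x assume "x \<in> (\<Union>i. A i)"
    then obtain i where "x \<in> A i" by blast
    hence "1 \<le> (\<Sum>n. ennreal (B i n x))" using B[of i] unfolding covers_def by blast
    also have "\<dots> = (\<Sum>j<Suc i. if j = i then \<Sum>n. ennreal (B j n x) else 0)" by simp
    also have "\<dots> \<le> (\<Sum>j<Suc i. \<Sum>n. ennreal (B j n x))" by (intro sum_mono) auto
    also have "\<dots> \<le> (\<Sum>j. \<Sum>n. ennreal (B j n x))" by (intro sum_le_suminf) auto
    also have "\<dots> = (\<Sum>k. (\<lambda>(j, n). ennreal (B j n x)) (prod_decode k))"
      by (rule suminf_ennreal_2dimen[symmetric]) simp
    finally show "1 \<le> (\<Sum>n. ennreal (C n x))" by (simp add: C_def case_prod_beta)
  qed
  from om_le[OF this] have "om (\<Union>i. A i) \<le> (\<Sum>k. (\<lambda>(j, n). ennreal (P (B j n))) (prod_decode k))"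
    by (simp add: C_def case_prod_beta)
  also have "\<dots> = (\<Sum>j. \<Sum>n. ennreal (P (B j n)))" by (rule suminf_ennreal_2dimen) simp
  also have "\<dots> \<le> (\<Sum>n. om (A n) + e * (1/2)^Suc n)"
    using Ble by (intro suminf_le summableI less_imp_le)
  also have "\<dots> = (\<Sum>n. om (A n)) + (\<Sum>n. ennreal e * ennreal ((1/2) ^ Suc n))"
    using e by (subst suminf_add[symmetric])
                       (auto simp del: ennreal_suminf_cmult simp add: ennreal_mult[symmetric])
  also have "\<dots> = (\<Sum>n. om (A n)) + e"
    unfolding ennreal_suminf_cmult
    by (subst suminf_ennreal_eq[OF zero_le_power power_half_series]) auto
  finally show "om (\<Union>i. A i) \<le> (\<Sum>i. om (A i)) + ennreal e" .
qed

lemma om_outer_measure_space: "outer_measure_space (Pow UNIV) om"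
  unfolding outer_measure_space_def positive_def increasing_def countably_subadditive_def
  using om_empty om_mono om_countably_subadditive by auto

lemma om_Un: "om (A \<union> B) \<le> om A + om B"
proof -
  have "(\<lambda>n. om (binaryset A B n)) sums (om A + om B)"
    by (rule binaryset_sums) (rule om_empty)
  thus ?thesis using om_countably_subadditive[of "binaryset A B"]
    by (simp add: UN_binaryset_eq sums_iff)
qed


text \<open>The increments of h after index j, divided by c, cover every point where h still grows
  by c, and their costs telescope. This takes the place of a monotone convergence property of
  P.\<close>

lemma covers_scale:
  assumes "\<And>n. C0_nonneg (h n)" "\<And>n x. h n x \<le> h (Suc n) x" "\<And>n. P (h n) \<le> s"
    and c: "0 < c" and A: "\<And>x. x \<in> A \<Longrightarrow> \<exists>N. c \<le> h N x - h j x"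
  shows "om A \<le> ennreal ((s - P (h j)) / c)"
proof -
  define f where "f n x = (1 / c) * (h (Suc (j + n)) x - h (j + n) x)" for n x
  have d: "C0_nonneg (\<lambda>x. h (Suc n) x - h n x)" for n
    using assms(1)[of n] assms(1)[of "Suc n"] assms(2) by (auto simp: C0_nonneg_def intro: C0_diff)
  have f: "C0_nonneg (f n)" for n unfolding f_def
    using d[of "j + n"] c C0_cmult[of "\<lambda>x. h (Suc (j + n)) x - h (j + n) x" "1 / c"]
    by (simp add: C0_nonneg_def)
  have Pd: "P (\<lambda>x. h (Suc n) x - h n x) = P (h (Suc n)) - P (h n)" for n
    using P_add[OF d[of n] assms(1)[of n]] by simp
  have Pf: "P (f n) = (1 / c) * (P (h (Suc (j + n))) - P (h (j + n)))" for n
    unfolding f_def using P_cmult[OF d[of "j + n"], of "1 / c"] c Pd[of "j + n"] by simp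
  have mono: "h n x \<le> h m x" if "n \<le> m" for n m x
    using that by (rule lift_Suc_mono_le[of "\<lambda>n. h n x", rotated]) (rule assms(2))
  have "f \<in> covers A" unfolding covers_def
  proof (intro CollectI conjI allI ballI f)
    fix x assume "x \<in> A"
    then obtain N where N: "c \<le> h N x - h j x" using A by blast
    have "(\<Sum>n<N. f n x) = (1 / c) * (\<Sum>n<N. h (j + Suc n) x - h (j + n) x)"
      unfolding f_def sum_distrib_left by simp
    also have "(\<Sum>n<N. h (j + Suc n) x - h (j + n) x) = h (j + N) x - h j x"
      using sum_lessThan_telescope[of "\<lambda>n. h (j + n) x" N] by simp
    also have "(1 / c) * \<dots> \<ge> (1 / c) * c"
      using N mono[of N "j + N" x] c by (intro mult_left_mono) auto
    finally have "1 \<le> (\<Sum>n<N. f n x)" using c by simp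
    hence "1 \<le> ennreal (\<Sum>n<N. f n x)" by (metis ennreal_1 ennreal_leI)
    also have "\<dots> = (\<Sum>n<N. ennreal (f n x))"
      using f by (intro sum_ennreal[symmetric]) (simp add: C0_nonneg_def)
    also have "\<dots> \<le> (\<Sum>n. ennreal (f n x))" by (intro sum_le_suminf) auto
    finally show "1 \<le> (\<Sum>n. ennreal (f n x))" .
  qed
  hence "om A \<le> (\<Sum>n. ennreal (P (f n)))" by (rule om_le)
  also have "\<dots> \<le> ennreal ((s - P (h j)) / c)"
  proof (rule suminf_le_const[OF summableI])
    fix N
    have "(\<Sum>n<N. P (f n)) = (1 / c) * (\<Sum>n<N. P (h (j + Suc n)) - P (h (j + n)))"
      unfolding Pf sum_distrib_left by simp
    also have "(\<Sum>n<N. P (h (j + Suc n)) - P (h (j + n))) = P (h (j + N)) - P (h j)"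
      using sum_lessThan_telescope[of "\<lambda>n. P (h (j + n))" N] by simp
    also have "(1 / c) * \<dots> \<le> (1 / c) * (s - P (h j))"
      using assms(3)[of "j + N"] c by (intro mult_left_mono) auto
    finally have "(\<Sum>n<N. P (f n)) \<le> (s - P (h j)) / c" by simp
    thus "(\<Sum>n<N. ennreal (P (f n))) \<le> ennreal ((s - P (h j)) / c)"
      using P_nonneg[OF f] by (simp add: ennreal_leI)
  qed
  finally show ?thesis .
qed

text \<open>The increments of the ramps sum to 1 at every point, at a total cost of at most
  m.\<close>

lemma om_UNIV_le: "om UNIV \<le> ennreal m"
proof -
  have "om UNIV \<le> ennreal ((m - P (ramp 0)) / 1)"
  proof (rule covers_scale)
    show "P (ramp n) \<le> m" for n by (rule P_le[OF C0_nonneg_ramp ramp_le_1])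
    fix x :: 'a
    obtain N where "norm x + 1 \<le> real N" using real_arch_simple by blast
    thus "\<exists>N. 1 \<le> ramp N x - ramp 0 x" by (intro exI[of _ N]) (simp add: ramp_eq_1 ramp_0)
  qed (use C0_nonneg_ramp ramp_mono in auto)
  moreover have "ramp 0 = (\<lambda>x :: 'a. 0)" by (auto simp: ramp_0)
  ultimately show ?thesis by (simp add: P_zero)
qed

text \<open>A cover f of X is split into f * \<phi> and f * (1 - \<phi>) with \<phi> close to the
  indicator of U. The halves cover the part of X where \<phi> = 1 and the part outside U; what is
  left of U has outer measure at most e.\<close>

lemma open_measurable_om:
  assumes "open U"
  shows "U \<in> lambda_system UNIV (Pow UNIV) om"
\<comment> \<open>By convention \<open>infdist\<close> to the empty set is 0, so the whole space
  needs a case of its own.\<close>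
proof (cases "U = UNIV")
  case True
  thus ?thesis by (simp add: lambda_system_def om_empty)
next
  case False
  \<comment> \<open>Increases to the indicator of U while vanishing exactly off U; the factor
    \<open>ramp n\<close> makes it vanish at infinity.\<close>
  define h where "h n x = min 1 (real n * infdist x (- U)) * ramp n x" for n x
  have h01: "0 \<le> h n x" "h n x \<le> 1" for n x
    unfolding h_def by (auto simp: infdist_nonneg ramp_nonneg ramp_le_1 intro!: mult_nonneg_nonneg mult_le_one)
  have h: "C0_nonneg (h n)" for n
  proof -
    have "C0 (h n)"
    proof (rule C0_dominated[OF C0_ramp[of n]])
      show "continuous_on UNIV (h n)" unfolding h_def
        using C0_continuous[OF C0_ramp[of n]] by (intro continuous_intros)
      show "\<bar>h n x\<bar> \<le> \<bar>ramp n x\<bar>" for x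
        unfolding h_def abs_mult by (rule mult_left_le_one_le) (auto simp: infdist_nonneg)
    qed
    thus ?thesis using h01 by (simp add: C0_nonneg_def)
  qed
  have hm: "h n x \<le> h (Suc n) x" for n x
    unfolding h_def
    by (intro mult_mono ramp_mono min.mono mult_right_mono) (auto simp: infdist_nonneg ramp_nonneg)
  have hU: "h n x = 0" if "x \<notin> U" for n x unfolding h_def using that by simp
  have h1: "\<exists>N. h N x = 1" if "x \<in> U" for x
  proof -
    have "0 < infdist x (- U)"
      using that False assms by (intro infdist_pos_not_in_closed) auto
    then obtain n1 where n1: "1 < real n1 * infdist x (- U)" using reals_Archimedean3 by blast
    obtain n2 where n2: "norm x + 1 \<le> real n2" using real_arch_simple by blast
    have "real n1 * infdist x (- U) \<le> real (max n1 n2) * infdist x (- U)"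
      by (intro mult_right_mono) (auto simp: infdist_nonneg)
    hence "h (max n1 n2) x = 1" unfolding h_def using n1 n2 ramp_eq_1[of x "max n1 n2"] by auto
    thus ?thesis by blast
  qed
  have "incseq (\<lambda>n. P (h n))" by (intro incseq_SucI P_mono h hm)
  moreover have "P (h n) \<le> m" for n by (rule P_le[OF h h01(2)])
  ultimately obtain s where s: "(\<lambda>n. P (h n)) \<longlonglongrightarrow> s" "\<And>n. P (h n) \<le> s"
    using incseq_convergent[of "\<lambda>n. P (h n)" m] by blast
  have key: "om (X \<inter> U) + om (X - U) \<le> om X" for X
    unfolding om_def[of X]
  proof (rule INF_greatest)
    fix f assume f: "f \<in> covers X"
    show "om (X \<inter> U) + om (X - U) \<le> (\<Sum>n. ennreal (P (f n)))"
    proof (rule ennreal_le_epsilon)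
      fix e :: real assume "0 < e"
      \<comment> \<open>The gap e / 2 becomes e when \<open>covers_scale\<close> divides by c =
        1/2.\<close>
      hence "eventually (\<lambda>n. s - e / 2 < P (h n)) sequentially"
        by (intro order_tendstoD(1)[OF s(1)]) simp
      then obtain j where j: "s - e / 2 < P (h j)" by (auto simp: eventually_sequentially)
      \<comment> \<open>Doubling and truncating yields the value 1 wherever \<open>h j\<close> \<ge>
        1/2, and still 0 off U.\<close>
      define \<phi> where "\<phi> x = min 1 (2 * h j x)" for x
      have \<phi>: "0 \<le> \<phi> x" "\<phi> x \<le> 1" for x using h01[of j x] by (auto simp: \<phi>_def)
      have \<phi>c: "continuous_on UNIV \<phi>" unfolding \<phi>_def
        using C0_continuous[of "h j"] h[of j] by (intro continuous_intros) (simp add: C0_nonneg_def)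
      have fn: "C0_nonneg (f n)" for n using f by (simp add: covers_def)
      have f1: "C0_nonneg (\<lambda>x. f n x * \<phi> x)" and f2: "C0_nonneg (\<lambda>x. f n x * (1 - \<phi> x))" for n
      proof -
        have c: "C0 (f n)" "0 \<le> f n x" for x using fn by (auto simp: C0_nonneg_def)
        have "C0 (\<lambda>x. f n x * \<phi> x)"
          by (rule C0_dominated[OF c(1)])
             (use \<phi>c C0_continuous[OF c(1)] \<phi> in \<open>auto intro!: continuous_intros mult_left_le simp: abs_mult\<close>)
        thus "C0_nonneg (\<lambda>x. f n x * \<phi> x)" using c(2) \<phi> by (simp add: C0_nonneg_def)
        have "C0 (\<lambda>x. f n x * (1 - \<phi> x))"
          by (rule C0_dominated[OF c(1)])
             (use \<phi>c C0_continuous[OF c(1)] \<phi> in \<open>auto intro!: continuous_intros mult_left_le simp: abs_mult\<close>)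
        thus "C0_nonneg (\<lambda>x. f n x * (1 - \<phi> x))" using c(2) \<phi> by (simp add: C0_nonneg_def)
      qed
      define V where "V = {x \<in> U. h j x < 1/2}"
      have "om V \<le> ennreal ((s - P (h j)) / (1/2))"
      proof (rule covers_scale[of h])
        fix x assume "x \<in> V"
        then obtain N where "h N x = 1" "h j x < 1/2" using h1 unfolding V_def by blast
        thus "\<exists>N. 1/2 \<le> h N x - h j x" by (intro exI[of _ N]) simp
      qed (use h hm s(2) in auto)
      also have "\<dots> \<le> ennreal e" using j by (intro ennreal_leI) simp
      finally have V: "om V \<le> ennreal e" .
      have c: "1 \<le> (\<Sum>n. ennreal (f n x))" if "x \<in> X" for x using f that by (simp add: covers_def)
      have W: "om {x \<in> X. \<phi> x = 1} \<le> (\<Sum>n. ennreal (P (\<lambda>x. f n x * \<phi> x)))"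
        by (rule om_le) (use f1 c in \<open>simp add: covers_def\<close>)
      have Z: "om (X - U) \<le> (\<Sum>n. ennreal (P (\<lambda>x. f n x * (1 - \<phi> x))))"
        by (rule om_le) (use f2 c hU in \<open>simp add: covers_def \<phi>_def\<close>)
      have "om (X \<inter> U) \<le> om ({x \<in> X. \<phi> x = 1} \<union> V)"
        by (rule om_mono) (auto simp: V_def \<phi>_def)
      also have "\<dots> \<le> (\<Sum>n. ennreal (P (\<lambda>x. f n x * \<phi> x))) + ennreal e"
        by (rule order_trans[OF om_Un add_mono[OF W V]])
      finally have "om (X \<inter> U) + om (X - U)
        \<le> ((\<Sum>n. ennreal (P (\<lambda>x. f n x * \<phi> x))) + ennreal e) + (\<Sum>n. ennreal (P (\<lambda>x. f n x * (1 - \<phi> x))))"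
        using Z by (rule add_mono)
      also have "\<dots> = (\<Sum>n. ennreal (P (\<lambda>x. f n x * \<phi> x)) + ennreal (P (\<lambda>x. f n x * (1 - \<phi> x)))) + ennreal e"
        by (simp add: suminf_add[OF summableI summableI, symmetric] ac_simps)
      also have "(\<lambda>n. ennreal (P (\<lambda>x. f n x * \<phi> x)) + ennreal (P (\<lambda>x. f n x * (1 - \<phi> x)))) = (\<lambda>n. ennreal (P (f n)))"
      proof
        fix n
        have "P (f n) = P (\<lambda>x. f n x * \<phi> x + f n x * (1 - \<phi> x))" by (simp add: algebra_simps)
        also have "\<dots> = P (\<lambda>x. f n x * \<phi> x) + P (\<lambda>x. f n x * (1 - \<phi> x))" by (rule P_add[OF f1 f2])
        finally show "ennreal (P (\<lambda>x. f n x * \<phi> x)) + ennreal (P (\<lambda>x. f n x * (1 - \<phi> x))) = ennreal (P (f n))"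
          using P_nonneg[OF f1] P_nonneg[OF f2] by simp
      qed
      finally show "om (X \<inter> U) + om (X - U) \<le> (\<Sum>n. ennreal (P (f n))) + ennreal e" .
    qed
  qed
  have "om (X \<inter> U) + om (X - U) = om X" for X
    using key[of X] om_Un[of "X \<inter> U" "X - U"] by (simp add: Int_Diff_Un antisym)
  thus ?thesis by (auto simp: lambda_system_def Int_commute Diff_eq)
qed

text \<open>A Dini-type argument: on the compact set where g \<ge> \<epsilon> some partial sum of
  the cover exceeds 1 - \<epsilon>. As g \<le> 1, that partial sum dominates max (g - \<epsilon>) 0
  everywhere, and the rest min g \<epsilon> costs at most \<epsilon> * m.\<close>

lemma P_le_om:
  assumes g: "C0_nonneg g" "\<And>x. g x \<le> 1" "\<And>x. x \<notin> U \<Longrightarrow> g x = 0"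
  shows "ennreal (P g) \<le> om U"
  unfolding om_def
proof (rule INF_greatest)
  fix F assume F: "F \<in> covers U"
  hence Fn: "C0_nonneg (F n)" for n by (simp add: covers_def)
  hence Fc: "continuous_on UNIV (F n)" and F0: "0 \<le> F n x" for n x
    by (auto simp: C0_nonneg_def C0_continuous)
  have g0: "0 \<le> g x" and gC: "C0 g" for x using g(1) by (auto simp: C0_nonneg_def)
  show "ennreal (P g) \<le> (\<Sum>n. ennreal (P (F n)))"
  proof (rule ennreal_le_epsilon)
    fix e :: real assume e: "0 < e"
    \<comment> \<open>The summand 1 keeps \<epsilon> positive also when m = 0.\<close>
    define \<epsilon> where "\<epsilon> = e / (m + 1)"
    have \<epsilon>: "0 < \<epsilon>" "\<epsilon> * m \<le> e" using e m_nonneg by (auto simp: \<epsilon>_def field_simps)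
    define K where "K = {x. \<epsilon> \<le> g x}"
    obtain r where r: "\<And>x. norm x \<ge> r \<Longrightarrow> \<bar>g x\<bar> < \<epsilon>" using C0_eventually_small[OF gC \<epsilon>(1)] by blast
    have "K \<subseteq> cball 0 r"
    proof
      fix x assume "x \<in> K"
      hence "\<not> \<bar>g x\<bar> < \<epsilon>" by (auto simp: K_def)
      hence "\<not> r \<le> norm x" using r by blast
      thus "x \<in> cball 0 r" by simp
    qed
    moreover have "closed K" unfolding K_def
      using C0_continuous[OF gC] by (intro closed_Collect_le) (auto intro!: continuous_intros)
    ultimately have K: "compact K" using bounded_subset[OF bounded_cball] compact_eq_bounded_closed by blast
    define O' where "O' N = {x. 1 - \<epsilon> < (\<Sum>n<N. F n x)}" for N
    have opn: "open (O' N)" for N unfolding O'_def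
      using Fc by (intro open_Collect_less continuous_intros)
    have cov: "K \<subseteq> (\<Union>N. O' N)"
    proof
      fix x assume "x \<in> K"
      hence "x \<in> U" using g(3) \<epsilon> by (force simp: K_def)
      hence "1 \<le> (\<Sum>n. ennreal (F n x))" using F by (simp add: covers_def)
      moreover have "ennreal (1 - \<epsilon>) < 1" using \<epsilon> by (metis ennreal_1 ennreal_less_zero_iff diff_gt_0_iff_gt diff_less_eq ennreal_lessI less_add_same_cancel1 zero_less_one)
      ultimately have "ennreal (1 - \<epsilon>) < (\<Sum>n. ennreal (F n x))" by (rule order_less_le_trans[rotated])
      hence "ennreal (1 - \<epsilon>) < (SUP N. \<Sum>n<N. ennreal (F n x))" by (simp only: suminf_eq_SUP)
      then obtain N where N: "ennreal (1 - \<epsilon>) < (\<Sum>n<N. ennreal (F n x))" by (auto simp: less_SUP_iff)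
      also have "(\<Sum>n<N. ennreal (F n x)) = ennreal (\<Sum>n<N. F n x)" using F0 by simp
      finally have "1 - \<epsilon> < (\<Sum>n<N. F n x)" by (meson ennreal_leI not_less)
      thus "x \<in> (\<Union>N. O' N)" by (auto simp: O'_def)
    qed
    obtain D where D: "finite D" "K \<subseteq> (\<Union>N\<in>D. O' N)"
      by (rule compactE_image[OF K opn cov])
    define N where "N = Max D"
    have N: "n \<le> N" if "n \<in> D" for n using D(1) that by (simp add: N_def)
    have KN: "1 - \<epsilon> < (\<Sum>n<N. F n x)" if "x \<in> K" for x
    proof -
      have "x \<in> (\<Union>N\<in>D. O' N)" using that D(2) by blast
      then obtain n where n: "n \<in> D" "1 - \<epsilon> < (\<Sum>i<n. F i x)" by (auto simp: O'_def)
      have "(\<Sum>i<n. F i x) \<le> (\<Sum>i<N. F i x)" using N[OF n(1)] F0 by (intro sum_mono2) auto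
      thus ?thesis using n(2) by simp
    qed
    define g1 where "g1 x = max (g x - \<epsilon>) 0" for x
    define g2 where "g2 x = min (g x) \<epsilon>" for x
    have "C0 g1" "C0 g2"
      by (rule C0_dominated[OF gC]; use g0 \<epsilon> C0_continuous[OF gC] in
            \<open>auto simp: g1_def[abs_def] g2_def[abs_def] intro!: continuous_intros\<close>)+
    hence g12: "C0_nonneg g1" "C0_nonneg g2" using g0 \<epsilon> by (auto simp: C0_nonneg_def g1_def g2_def)
    have "P g1 \<le> P (\<lambda>x. \<Sum>n<N. F n x)"
    proof (rule P_mono)
      fix x
      show "g1 x \<le> (\<Sum>n<N. F n x)"
      proof (cases "\<epsilon> < g x")
        case True
        thus ?thesis using KN[of x] g(2)[of x] by (simp add: K_def g1_def)
      next
        case False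
        thus ?thesis using F0 by (simp add: g1_def sum_nonneg)
      qed
    qed (use g12 P_sum[of N F] Fn in auto)
    hence 1: "P g1 \<le> (\<Sum>n<N. P (F n))" using P_sum[of N F] Fn by simp
    have g3: "C0_nonneg (\<lambda>x. (1 / \<epsilon>) * g2 x)" using g12 \<epsilon> by (auto simp: C0_nonneg_def intro: C0_divide)
    have "P g2 = P (\<lambda>x. \<epsilon> * ((1 / \<epsilon>) * g2 x))" using \<epsilon> by simp
    also have "\<dots> = \<epsilon> * P (\<lambda>x. (1 / \<epsilon>) * g2 x)" using \<epsilon> g3 by (intro P_cmult) auto
    also have "\<dots> \<le> \<epsilon> * m"
      using \<epsilon> g3 by (intro mult_left_mono P_le) (auto simp: g2_def field_simps)
    finally have 2: "P g2 \<le> e" using \<epsilon> by simp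
    have "g = (\<lambda>x. g1 x + g2 x)" by (auto simp: g1_def g2_def)
    hence "P g = P g1 + P g2" using P_add[OF g12] by simp
    hence "ennreal (P g) \<le> ennreal ((\<Sum>n<N. P (F n)) + e)" using 1 2 by (intro ennreal_leI) simp
    also have "\<dots> = (\<Sum>n<N. ennreal (P (F n))) + ennreal e"
      using P_nonneg[OF Fn] e by (simp add: sum_nonneg)
    also have "\<dots> \<le> (\<Sum>n. ennreal (P (F n))) + ennreal e" by (intro add_right_mono sum_le_suminf) auto
    finally show "ennreal (P g) \<le> (\<Sum>n. ennreal (P (F n))) + ennreal e" .
  qed
qed

text \<open>The discrete layer-cake decomposition of a nonnegative number into layers of thickness
  \<delta>.\<close>

lemma layer_sum:
  fixes t \<delta> :: real
  assumes "0 \<le> t" "0 \<le> \<delta>"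
  shows "(\<Sum>k<n. min (max (t - real k * \<delta>) 0) \<delta>) = min t (real n * \<delta>)"
proof (induction n)
  case (Suc n)
  have "min t (real n * \<delta>) + min (max (t - real n * \<delta>) 0) \<delta> = min t (real n * \<delta> + \<delta>)"
    using assms by (simp add: min_def max_def)
  thus ?case using Suc by (simp add: algebra_simps)
qed (use assms in simp)

text \<open>For the k-th slice of f, both the integral and P lie between \<delta> times the measure
  of {f \<ge> (k+1) \<delta>} and \<delta> times that of {f \<ge> k \<delta>}; for P these bounds
  are \<open>om_le_single\<close> and \<open>P_le_om\<close>. The gaps telescope and leave an error
  of at most \<delta> * m.\<close>

theorem riesz_positive:
  obtains M where "finite_measure M" "sets M = sets borel" "\<And>f. C0_nonneg f \<Longrightarrow> integral\<^sup>L M f = P f"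
proof -
  define M where "M = measure_of (UNIV :: 'a set) (sets borel) om"
  have ms: "measure_space UNIV (lambda_system UNIV (Pow UNIV) om) om"
    by (rule sigma_algebra.caratheodory_lemma[OF sigma_algebra_Pow om_outer_measure_space])
  hence "sigma_algebra UNIV (lambda_system UNIV (Pow UNIV) om)" by (simp add: measure_space_def)
  \<comment> \<open>Open sets are Caratheodory measurable, hence so are all Borel sets, and
    \<open>om\<close> restricts to a measure on them.\<close>
  from sigma_algebra.sigma_sets_subset[OF this, of "{U. open U}"]
  have sub: "sets borel \<subseteq> lambda_system UNIV (Pow UNIV) om"
    using open_measurable_om by (auto simp: borel_def)
  have "measure_space UNIV (sets borel) om"
    by (rule measure_down[OF ms _ sub]) (use sets.sigma_algebra_axioms[of "borel :: 'a measure"] in simp)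
  hence em: "emeasure M A = om A" if "A \<in> sets borel" for A
    using that unfolding M_def measure_space_def
    by (intro emeasure_measure_of[OF refl]) (auto simp: sigma_sets_borel)
  have sM [measurable_cong, simp]: "sets M = sets borel" by (simp add: M_def sigma_sets_borel)
  have spM [simp]: "space M = UNIV" by (simp add: M_def)
  interpret M: finite_measure M
  proof (rule finite_measureI)
    have "emeasure M UNIV \<le> ennreal m" using em[of UNIV] om_UNIV_le by simp
    thus "emeasure M (space M) \<noteq> \<infinity>" using ennreal_less_top[of m] by (metis infinity_ennreal_def leD spM)
  qed
  have mM: "ennreal (measure M A) = om A" if "A \<in> sets borel" for A
    using em[OF that] by (simp add: M.emeasure_eq_measure)
  have "ennreal (measure M UNIV) \<le> ennreal m" using mM[of UNIV] om_UNIV_le by simp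
  hence mU: "measure M UNIV \<le> m" using m_nonneg by (simp only: ennreal_le_iff)
  have "integral\<^sup>L M f = P f" if f: "C0_nonneg f" for f
  proof -
    have fC: "C0 f" and f0: "\<And>x. 0 \<le> f x" using f by (auto simp: C0_nonneg_def)
    have [measurable]: "f \<in> borel_measurable borel" by (rule C0_measurable[OF fC])
    obtain b where b: "b > 0" "\<And>x. \<bar>f x\<bar> \<le> b" using C0_bounded[OF fC] by blast
    have est: "\<bar>integral\<^sup>L M f - P f\<bar> \<le> \<delta> * m" if \<delta>: "0 < \<delta>" for \<delta>
    proof -
      obtain n where n: "b \<le> real n * \<delta>" using reals_Archimedean3[OF \<delta>] less_imp_le by blast
      define F where "F k x = min (max (f x - real k * \<delta>) 0) \<delta>" for k x
      have "C0 (F k)" for k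
        unfolding F_def[abs_def] by (rule C0_cutoff[OF fC]) (use \<delta> in auto)
      hence F: "C0_nonneg (F k)" for k using \<delta> by (auto simp: C0_nonneg_def F_def)
      have [measurable]: "F k \<in> borel_measurable borel" for k
        using F C0_measurable by (auto simp: C0_nonneg_def)
      have F01: "0 \<le> F k x" "F k x \<le> \<delta>" for k x using \<delta> by (auto simp: F_def)
      have fs: "f x = (\<Sum>k<n. F k x)" for x
        using layer_sum[OF f0[of x], of \<delta> n] \<delta> b(2)[of x] n by (simp add: F_def)
      define B where "B k = {x. real k * \<delta> \<le> f x}" for k
      have [measurable]: "B k \<in> sets borel" for k unfolding B_def by measurable
      have intF: "integrable M (F k)" for k
        using F01[of k] by (intro M.integrable_const_bound[of _ \<delta>]) auto
      have intB: "integrable M (\<lambda>x. \<delta> * indicator (B k) x)" for k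
        by (intro integrable_mult_right) (simp add: integrable_indicator_iff M.emeasure_eq_measure)
      have up: "integral\<^sup>L M (F k) \<le> \<delta> * measure M (B k)" for k
      proof -
        have "integral\<^sup>L M (F k) \<le> (\<integral>x. \<delta> * indicator (B k) x \<partial>M)"
          by (rule integral_mono[OF intF intB]) (use F01 in \<open>auto simp: F_def B_def indicator_def\<close>)
        thus ?thesis by simp
      qed
      have lo: "\<delta> * measure M (B (Suc k)) \<le> integral\<^sup>L M (F k)" for k
      proof -
        have "(\<integral>x. \<delta> * indicator (B (Suc k)) x \<partial>M) \<le> integral\<^sup>L M (F k)"
          by (rule integral_mono[OF intB intF])
             (use \<delta> in \<open>auto simp: F_def B_def indicator_def algebra_simps\<close>)
        thus ?thesis by simp
      qed
      have sc: "C0_nonneg (\<lambda>x. (1 / \<delta>) * F k x)" "P (\<lambda>x. (1 / \<delta>) * F k x) = P (F k) / \<delta>" for k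
        using F[of k] \<delta> P_cmult[of "F k" "1 / \<delta>"] by (auto simp: C0_nonneg_def intro: C0_divide)
      have Pup: "P (F k) \<le> \<delta> * measure M (B k)" for k
      proof -
        have "ennreal (P (F k) / \<delta>) \<le> om (B k)"
          unfolding sc(2)[symmetric]
          by (rule P_le_om[OF sc(1)]) (use \<delta> F01[of k] in \<open>auto simp: B_def F_def\<close>)
        hence "P (F k) / \<delta> \<le> measure M (B k)" by (simp flip: mM)
        thus ?thesis using \<delta> by (simp add: field_simps)
      qed
      have Plo: "\<delta> * measure M (B (Suc k)) \<le> P (F k)" for k
      proof -
        have "om (B (Suc k)) \<le> ennreal (P (F k) / \<delta>)"
          unfolding sc(2)[symmetric]
          by (rule om_le_single[OF sc(1)]) (use \<delta> in \<open>auto simp: B_def F_def field_simps\<close>)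
        moreover have "0 \<le> P (F k) / \<delta>" using P_nonneg[OF F[of k]] \<delta> by simp
        ultimately have "measure M (B (Suc k)) \<le> P (F k) / \<delta>" by (simp flip: mM)
        thus ?thesis using \<delta> by (simp add: field_simps)
      qed
      have "integral\<^sup>L M f = (\<Sum>k<n. integral\<^sup>L M (F k))"
        unfolding fs[abs_def] by (rule Bochner_Integration.integral_sum) (rule intF)
      moreover have "P f = (\<Sum>k<n. P (F k))"
        using P_sum[of n F] F unfolding fs[abs_def] by blast
      ultimately have "\<bar>integral\<^sup>L M f - P f\<bar> \<le> (\<Sum>k<n. \<bar>integral\<^sup>L M (F k) - P (F k)\<bar>)"
        by (simp add: sum_subtractf[symmetric] sum_abs)
      also have "\<dots> \<le> (\<Sum>k<n. \<delta> * (measure M (B k) - measure M (B (Suc k))))"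
      proof (rule sum_mono)
        fix k
        show "\<bar>integral\<^sup>L M (F k) - P (F k)\<bar> \<le> \<delta> * (measure M (B k) - measure M (B (Suc k)))"
          using up[of k] lo[of k] Pup[of k] Plo[of k] unfolding right_diff_distrib by linarith
      qed
      also have "\<dots> = \<delta> * (measure M (B 0) - measure M (B n))"
        by (simp only: sum_distrib_left[symmetric] sum_lessThan_telescope'[of "\<lambda>k. measure M (B k)"])
      also have "\<dots> \<le> \<delta> * m"
      proof (rule mult_left_mono)
        have "measure M (B 0) \<le> measure M UNIV" using M.bounded_measure[of "B 0"] by simp
        thus "measure M (B 0) - measure M (B n) \<le> m" using mU measure_nonneg[of M "B n"] by linarith
      qed (use \<delta> in simp)
      finally show ?thesis .
    qed
    have "\<bar>integral\<^sup>L M f - P f\<bar> \<le> 0 + e" if "0 < e" for e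
    proof -
      have "e / (m + 1) * m \<le> e" using that m_nonneg by (simp add: field_simps)
      moreover have "0 < e / (m + 1)" using that m_nonneg by simp
      ultimately show ?thesis using est[of "e / (m + 1)"] by linarith
    qed
    hence "\<bar>integral\<^sup>L M f - P f\<bar> \<le> 0" by (rule field_le_epsilon)
    thus ?thesis by simp
  qed
  thus thesis using that[of M] M.finite_measure_axioms sM by blast
qed

end

text \<open>The positive part of \<open>L\<close> is \<open>f \<mapsto> sup {L g | 0 \<le> g \<le> f}\<close>; it is additive because any
  \<open>h\<close> with \<open>0 \<le> h \<le> f + g\<close> splits as \<open>min h f + (h - min h f)\<close>.\<close>
lemma riesz_signed:
  fixes L :: "('a::euclidean_space \<Rightarrow> real) \<Rightarrow> real"
  assumes L_add: "\<And>f g. C0 f \<Longrightarrow> C0 g \<Longrightarrow> L (\<lambda>x. f x + g x) = L f + L g"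
    and L_cmult: "\<And>f c. C0 f \<Longrightarrow> L (\<lambda>x. c * f x) = c * L f"
    and L_bound: "\<And>f. C0 f \<Longrightarrow> (\<And>x. \<bar>f x\<bar> \<le> 1) \<Longrightarrow> L f \<le> C"
  obtains \<mu> where "signed_measure \<mu>" "\<And>\<phi>. C0 \<phi> \<Longrightarrow> signed_integral \<mu> \<phi> = L \<phi>"
    "\<And>e. e < total_variation \<mu> \<Longrightarrow> \<exists>f. C0 f \<and> (\<forall>x. \<bar>f x\<bar> \<le> 1) \<and> e < L f"
proof -
  define S where "S f = {g. C0_nonneg g \<and> (\<forall>x. g x \<le> f x)}" for f :: "'a \<Rightarrow> real"
  define P where "P f = (SUP g\<in>S f. L g)" for f
  have L_zero: "L (\<lambda>x. 0) = 0" using L_cmult[of "\<lambda>x. 0" 0] by simp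
  have L_diff: "L (\<lambda>x. f x - g x) = L f - L g" if "C0 f" "C0 g" for f g
    using L_add[OF that(1) C0_cmult[OF that(2), of "-1"]] L_cmult[OF that(2), of "-1"] by simp
  have C: "0 \<le> C" using L_bound[of "\<lambda>x. 0"] L_zero by simp
  have Lscale: "L g \<le> B * C" if "C0 g" "\<And>x. \<bar>g x\<bar> \<le> B" "0 < B" for g B
  proof -
    have "L (\<lambda>x. (1 / B) * g x) \<le> C"
      by (rule L_bound[OF C0_cmult[OF that(1)]]) (use that in \<open>simp add: abs_mult\<close>)
    hence "B * ((1 / B) * L g) \<le> B * C"
      using L_cmult[OF that(1), of "1 / B"] that(3) by (intro mult_left_mono) auto
    thus ?thesis using that(3) by simp
  qed
  have bdd: "bdd_above (L ` S f)" if f: "C0_nonneg f" for f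
  proof -
    obtain B where B: "0 < B" "\<And>x. \<bar>f x\<bar> \<le> B" using C0_bounded[of f] f by (auto simp: C0_nonneg_def)
    have "L g \<le> B * C" if "g \<in> S f" for g
    proof (rule Lscale[OF _ _ B(1)])
      show "C0 g" using that by (simp add: S_def C0_nonneg_def)
      fix x
      have "0 \<le> g x" "g x \<le> f x" using that by (auto simp: S_def C0_nonneg_def)
      thus "\<bar>g x\<bar> \<le> B" using B(2)[of x] by linarith
    qed
    thus ?thesis by (intro bdd_aboveI2[of _ _ "B * C"])
  qed
  have S0: "(\<lambda>x. 0) \<in> S f" if "C0_nonneg f" for f using that by (simp add: S_def C0_nonneg_def)
  have Sf: "f \<in> S f" if "C0_nonneg f" for f using that by (simp add: S_def)
  have P_upper: "L g \<le> P f" if "C0_nonneg f" "g \<in> S f" for f g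
    unfolding P_def by (rule cSUP_upper[OF that(2) bdd[OF that(1)]])
  have P_least: "P f \<le> b" if "C0_nonneg f" "\<And>g. g \<in> S f \<Longrightarrow> L g \<le> b" for f b
    unfolding P_def by (rule cSUP_least) (use S0[OF that(1)] that(2) in auto)
  have Padd: "P (\<lambda>x. f x + g x) = P f + P g" if f: "C0_nonneg f" and g: "C0_nonneg g" for f g
  proof (rule antisym)
    have fg: "C0_nonneg (\<lambda>x. f x + g x)" using f g by (auto simp: C0_nonneg_def intro: C0_add)
    show "P (\<lambda>x. f x + g x) \<le> P f + P g"
    proof (rule P_least[OF fg])
      fix h assume h: "h \<in> S (\<lambda>x. f x + g x)"
      hence hC: "C0 h" and h0: "\<And>x. 0 \<le> h x" and hl: "\<And>x. h x \<le> f x + g x"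
        by (auto simp: S_def C0_nonneg_def)
      have f': "C0 f" "\<And>x. 0 \<le> f x" and g': "\<And>x. 0 \<le> g x" using f g by (auto simp: C0_nonneg_def)
      define h1 where "h1 x = min (h x) (f x)" for x
      have h1C: "C0 h1"
      proof (rule C0_dominated[OF hC])
        show "continuous_on UNIV h1" unfolding h1_def
          using C0_continuous[OF hC] C0_continuous[OF f'(1)] by (intro continuous_intros)
        show "\<bar>h1 x\<bar> \<le> \<bar>h x\<bar>" for x using h0[of x] f'(2)[of x] by (simp add: h1_def)
      qed
      have "h1 \<in> S f" using h1C h0 f' by (auto simp: S_def C0_nonneg_def h1_def)
      moreover have "(\<lambda>x. h x - h1 x) \<in> S g" unfolding S_def C0_nonneg_def
      proof (intro CollectI conjI allI)
        show "C0 (\<lambda>x. h x - h1 x)" by (rule C0_diff[OF hC h1C])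
        show "0 \<le> h x - h1 x" "h x - h1 x \<le> g x" for x
          using hl[of x] g'[of x] by (auto simp: h1_def min_def)
      qed
      ultimately have "L h1 \<le> P f" "L (\<lambda>x. h x - h1 x) \<le> P g" using P_upper f g by auto
      thus "L h \<le> P f + P g" using L_diff[OF hC h1C] by simp
    qed
    have "P f \<le> P (\<lambda>x. f x + g x) - P g"
    proof (rule P_least[OF f])
      fix u assume u: "u \<in> S f"
      have "P g \<le> P (\<lambda>x. f x + g x) - L u"
      proof (rule P_least[OF g])
        fix v assume v: "v \<in> S g"
        have uv: "C0 u" "C0 v" using u v by (auto simp: S_def C0_nonneg_def)
        have "(\<lambda>x. u x + v x) \<in> S (\<lambda>x. f x + g x)"
          using u v C0_add[OF uv] by (auto simp: S_def C0_nonneg_def intro: add_mono)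
        from P_upper[OF fg this] show "L v \<le> P (\<lambda>x. f x + g x) - L u" using L_add[OF uv] by simp
      qed
      thus "L u \<le> P (\<lambda>x. f x + g x) - P g" by simp
    qed
    thus "P f + P g \<le> P (\<lambda>x. f x + g x)" by simp
  qed
  have Pcmult_le: "P (\<lambda>x. c * f x) \<le> c * P f" if f: "C0_nonneg f" and c: "0 < c" for f c
  proof (rule P_least)
    show "C0_nonneg (\<lambda>x. c * f x)" using f c by (auto simp: C0_nonneg_def intro: C0_cmult)
    fix g assume g: "g \<in> S (\<lambda>x. c * f x)"
    hence gC: "C0 g" by (simp add: S_def C0_nonneg_def)
    have "(\<lambda>x. (1 / c) * g x) \<in> S f"
      using g c C0_cmult[OF gC, of "1 / c"] by (auto simp: S_def C0_nonneg_def field_simps)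
    from P_upper[OF f this] have "(1 / c) * L g \<le> P f" using L_cmult[OF gC, of "1 / c"] by simp
    thus "L g \<le> c * P f" using c by (simp add: field_simps)
  qed
  have Pcmult: "P (\<lambda>x. c * f x) = c * P f" if f: "C0_nonneg f" and c: "0 \<le> c" for f c
  proof (cases "c = 0")
    case True
    have "P (\<lambda>x. 0) = 0"
      using Padd[of "\<lambda>x. 0" "\<lambda>x. 0"] by (simp add: C0_nonneg_def)
    thus ?thesis using True by simp
  next
    case False
    with c have c: "0 < c" by simp
    have cf: "C0_nonneg (\<lambda>x. c * f x)" using f c by (auto simp: C0_nonneg_def intro: C0_cmult)
    have "P (\<lambda>x. (1 / c) * (c * f x)) \<le> (1 / c) * P (\<lambda>x. c * f x)"
      using Pcmult_le[OF cf, of "1 / c"] c by simp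
    hence "P f \<le> (1 / c) * P (\<lambda>x. c * f x)" using c by simp
    hence "c * P f \<le> P (\<lambda>x. c * f x)" using c by (simp add: field_simps)
    thus ?thesis using Pcmult_le[OF f c] by simp
  qed
  have P0: "0 \<le> P f" if "C0_nonneg f" for f using P_upper[OF that S0[OF that]] L_zero by simp
  have P1: "P f \<le> C" if f: "C0_nonneg f" and "\<And>x. f x \<le> 1" for f
  proof (rule P_least[OF f])
    fix g assume "g \<in> S f"
    hence "C0 g" "\<And>x. 0 \<le> g x" "\<And>x. g x \<le> f x" by (auto simp: S_def C0_nonneg_def)
    thus "L g \<le> C" using that(2) by (intro L_bound) (auto simp: abs_le_iff intro: order_trans)
  qed
  interpret P: C0_positive_functional P C
    by unfold_locales (use P0 Padd Pcmult P1 in auto)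
  \<comment> \<open>The negative part P - L is again additive and nonnegative, so the same
    construction represents it. For f \<le> 1 both P f and L (- f) are at most C, whence the bound 2
    * C.\<close>
  interpret N: C0_positive_functional "\<lambda>f. P f - L f" "2 * C"
  proof
    fix f g :: "'a \<Rightarrow> real" assume f: "C0_nonneg f"
    hence fC: "C0 f" by (simp add: C0_nonneg_def)
    show "0 \<le> P f - L f" using P_upper[OF f Sf[OF f]] by simp
    show "P (\<lambda>x. f x + g x) - L (\<lambda>x. f x + g x) = P f - L f + (P g - L g)" if g: "C0_nonneg g"
      using Padd[OF f g] L_add[OF fC, of g] g by (simp add: C0_nonneg_def)
    show "P (\<lambda>x. c * f x) - L (\<lambda>x. c * f x) = c * (P f - L f)" if "0 \<le> c" for c
      using Pcmult[OF f that] L_cmult[OF fC, of c] by (simp add: right_diff_distrib)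
    assume f1: "\<And>x. f x \<le> 1"
    have "L (\<lambda>x. -1 * f x) \<le> C"
      using C0_cmult[OF fC, of "-1"] f1 f by (intro L_bound) (auto simp: C0_nonneg_def)
    thus "P f - L f \<le> 2 * C" using L_cmult[OF fC, of "-1"] P1[OF f f1] by simp
  qed
  obtain Mp where Mp: "finite_measure Mp" "sets Mp = sets borel" "\<And>f. C0_nonneg f \<Longrightarrow> integral\<^sup>L Mp f = P f"
    using P.riesz_positive by blast
  obtain Mn where Mn: "finite_measure Mn" "sets Mn = sets borel" "\<And>f. C0_nonneg f \<Longrightarrow> integral\<^sup>L Mn f = P f - L f"
    using N.riesz_positive by blast
  define \<mu> where "\<mu> = (\<lambda>A. measure Mp A - measure Mn A)"
  have sm: "signed_measure \<mu>" unfolding \<mu>_def by (rule signed_measure_diff_measure) (use Mp Mn in auto)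
  have si: "signed_integral \<mu> \<phi> = L \<phi>" if \<phi>: "C0 \<phi>" for \<phi>
  proof -
    define p where "p x = max (\<phi> x) 0" for x
    define q where "q x = max (- \<phi> x) 0" for x
    have c: "C0 p" "C0 q" unfolding p_def q_def
      by (rule C0_dominated[OF \<phi>]; use C0_continuous[OF \<phi>] in \<open>auto intro!: continuous_intros\<close>)+
    hence pq: "C0_nonneg p" "C0_nonneg q" by (auto simp: C0_nonneg_def p_def q_def)
    have eq: "\<phi> = (\<lambda>x. p x - q x)" by (auto simp: p_def q_def)
    obtain B where B: "\<And>x. \<bar>\<phi> x\<bar> \<le> B" using C0_bounded[OF \<phi>] by blast
    have int: "integral\<^sup>L M \<phi> = integral\<^sup>L M p - integral\<^sup>L M q" if "finite_measure M" "sets M = sets borel" for M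
    proof -
      obtain B1 where B1: "\<And>x. \<bar>p x\<bar> \<le> B1" using C0_bounded[OF c(1)] by blast
      obtain B2 where B2: "\<And>x. \<bar>q x\<bar> \<le> B2" using C0_bounded[OF c(2)] by blast
      have "integrable M p"
        by (rule integrable_bounded_borel[OF that C0_measurable[OF c(1)], of B1]) (use B1 in simp)
      moreover have "integrable M q"
        by (rule integrable_bounded_borel[OF that C0_measurable[OF c(2)], of B2]) (use B2 in simp)
      ultimately show ?thesis unfolding eq by (rule Bochner_Integration.integral_diff)
    qed
    have "signed_integral \<mu> \<phi> = integral\<^sup>L Mp \<phi> - integral\<^sup>L Mn \<phi>" unfolding \<mu>_def
      by (rule signed_integral_diff_measure[OF Mp(1) Mn(1) Mp(2) Mn(2) C0_measurable[OF \<phi>] B])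
    also have "\<dots> = L p - L q"
      unfolding int[OF Mp(1,2)] int[OF Mn(1,2)] Mp(3)[OF pq(1)] Mp(3)[OF pq(2)] Mn(3)[OF pq(1)] Mn(3)[OF pq(2)]
      by simp
    also have "\<dots> = L \<phi>" unfolding eq using L_diff[OF c] by simp
    finally show ?thesis .
  qed
  \<comment> \<open>Only an inequality, since Mp and Mn are not compared with the Jordan parts; it
    has the direction that turns e < \<open>total_variation\<close> \<mu> into e < Mp UNIV + Mn
    UNIV.\<close>
  have tv: "total_variation \<mu> \<le> measure Mp UNIV + measure Mn UNIV"
    by (rule total_variation_le) (use Mp Mn in \<open>auto simp: \<mu>_def\<close>)
  have "\<exists>f. C0 f \<and> (\<forall>x. \<bar>f x\<bar> \<le> 1) \<and> e < L f" if e: "e < total_variation \<mu>" for e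
  proof -
    have lim: "(\<lambda>n. integral\<^sup>L M (ramp n)) \<longlonglongrightarrow> measure M UNIV"
      if M: "finite_measure M" "sets M = sets borel" for M :: "'a measure"
    proof -
      interpret finite_measure M by fact
      have sp: "space M = UNIV" using sets_eq_imp_space_eq[OF M(2)] by simp
      have "(\<lambda>n. integral\<^sup>L M (ramp n)) \<longlonglongrightarrow> (\<integral>x. 1 \<partial>M)"
      proof (rule integral_dominated_convergence[where w = "\<lambda>_. 1"])
        show "ramp n \<in> borel_measurable M" for n
          using C0_measurable[OF C0_ramp, of n] measurable_cong_sets[OF M(2) refl, of borel] by blast
        show "AE x in M. (\<lambda>n. ramp n x) \<longlonglongrightarrow> 1"
        proof (rule AE_I2)
          fix x :: 'a
          obtain N where N: "norm x + 1 \<le> real N" using real_arch_simple by blast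
          have "ramp n x = 1" if "N \<le> n" for n using that N by (intro ramp_eq_1) linarith
          thus "(\<lambda>n. ramp n x) \<longlonglongrightarrow> 1"
            by (intro tendsto_eventually) (auto simp: eventually_sequentially)
        qed
        show "AE x in M. norm (ramp n x) \<le> 1" for n
          by (rule AE_I2) (simp add: ramp_nonneg ramp_le_1)
      qed auto
      thus ?thesis using sp by simp
    qed
    \<comment> \<open>The ramps increase to 1, so the values of P and P - L on them approximate the
      total masses of the two representing measures.\<close>
    have "(\<lambda>n. P (ramp n) + (P (ramp n) - L (ramp n))) \<longlonglongrightarrow> measure Mp UNIV + measure Mn UNIV"
      using tendsto_add[OF lim[OF Mp(1,2)] lim[OF Mn(1,2)]]
      by (simp only: Mp(3)[OF C0_nonneg_ramp] Mn(3)[OF C0_nonneg_ramp])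
    from order_tendstoD(1)[OF this, of e] obtain n where
      n: "e < P (ramp n) + (P (ramp n) - L (ramp n))"
      using e tv by (auto simp: eventually_sequentially)
    \<comment> \<open>The function 2 * g - \<open>ramp n\<close> stays between -
      \<open>ramp n\<close> and \<open>ramp n\<close>, and L takes the value 2 * L g - L (ramp n) on
      it. The threshold is the wish to have this above e, solved for L g.\<close>
    have "\<exists>g\<in>S (ramp n). (e + L (ramp n)) / 2 < L g"
    proof (rule ccontr)
      assume "\<not> ?thesis"
      hence "P (ramp n) \<le> (e + L (ramp n)) / 2"
        by (intro P_least C0_nonneg_ramp) (simp add: not_less)
      thus False using n by (simp add: field_simps)
    qed
    then obtain g where g: "g \<in> S (ramp n)" "(e + L (ramp n)) / 2 < L g" by blast
    hence g': "C0 g" "\<And>x. 0 \<le> g x" "\<And>x. g x \<le> ramp n x" by (auto simp: S_def C0_nonneg_def)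
    show ?thesis
    proof (intro exI conjI allI)
      show "C0 (\<lambda>x. 2 * g x - ramp n x)" by (intro C0_diff C0_cmult g' C0_ramp)
      show "\<bar>2 * g x - ramp n x\<bar> \<le> 1" for x using g'(2,3)[of x] ramp_le_1[of n x] by linarith
      show "e < L (\<lambda>x. 2 * g x - ramp n x)"
        using L_diff[OF C0_cmult[OF g'(1)] C0_ramp[of n], of 2] L_cmult[OF g'(1), of 2] g(2)
        by (simp add: field_simps)
    qed
  qed
  thus thesis using that[OF sm si] by blast
qed

section \<open>Surface measure and polar coordinates\<close>

abbreviation "uball \<equiv> cball 0 1 - {0 :: 'a::euclidean_space}"

text \<open>Scaling by r > 0 does not change the direction, so the cone consists of the points of
  the punctured ball that lie over A. In this form the cone measure becomes an image measure under
  \<open>sgn\<close>.\<close>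

lemma sphere_cone_eq:
  assumes "A \<subseteq> sphere 0 1"
  shows "sphere_cone A = sgn -` A \<inter> uball"
proof (intro set_eqI iffI)
  fix y assume "y \<in> sphere_cone A"
  then obtain r x where y: "y = r *\<^sub>R x" "0 < r" "r \<le> 1" "x \<in> A" unfolding sphere_cone_def by blast
  moreover from this have "norm x = 1" using assms by auto
  ultimately show "y \<in> sgn -` A \<inter> uball" by (auto simp: sgn_scaleR sgn_div_norm)
next
  fix y assume "y \<in> sgn -` A \<inter> uball"
  hence "y = norm y *\<^sub>R sgn y" "0 < norm y" "norm y \<le> 1" "sgn y \<in> A" by (auto simp: sgn_div_norm)
  thus "y \<in> sphere_cone A" unfolding sphere_cone_def by blast
qed

definition unit_vol :: "'a::euclidean_space itself \<Rightarrow> real" where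
  "unit_vol _ = unit_ball_vol (real DIM('a))"

lemma unit_vol_pos: "0 < unit_vol TYPE('a::euclidean_space)"
  by (simp add: unit_vol_def)

lemma emeasure_uball: "emeasure lborel (uball :: 'a::euclidean_space set) = ennreal (unit_vol TYPE('a))"
  by (subst emeasure_Diff) (auto simp: emeasure_cball unit_vol_def)

text \<open>Push-forward of normalised Lebesgue measure on the punctured unit ball under radial
  projection. It is a measure by construction and lends its countable additivity to
  \<open>sphere_measure\<close>.\<close>

definition radial_image :: "'a::euclidean_space measure" where
  "radial_image = scale_measure (ennreal (1 / unit_vol TYPE('a)))
     (distr (restrict_space lborel uball) (restrict_space borel (sphere 0 1)) sgn)"

lemma sgn_measurable_sphere:
  "sgn \<in> restrict_space lborel uball \<rightarrow>\<^sub>M restrict_space borel (sphere 0 1 :: 'a::euclidean_space set)"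
  by (rule measurable_restrict_space2)
     (auto simp: space_restrict_space norm_sgn intro!: measurable_restrict_space1)

lemma space_sphere_measure [simp]: "space sphere_measure = sphere 0 1"
  unfolding sphere_measure_def by (rule space_measure_of) (auto simp: sets_restrict_space)

lemma sets_sphere_measure:
  "sets sphere_measure = sets (restrict_space borel (sphere (0::'a::euclidean_space) 1))"
proof -
  have "sets (sphere_measure :: 'a measure) = sigma_sets (sphere 0 1) (sets (restrict_space borel (sphere 0 1)))"
    unfolding sphere_measure_def by (rule sets_measure_of) (auto simp: sets_restrict_space)
  thus ?thesis using sets.sigma_sets_eq[of "restrict_space borel (sphere (0::'a) 1)"]
    by (simp add: space_restrict_space)
qed

lemma emeasure_radial_image:
  assumes "A \<in> sets (restrict_space borel (sphere (0::'a::euclidean_space) 1))"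
  shows "emeasure radial_image A = emeasure lborel (sphere_cone A) / emeasure lborel (ball (0::'a) 1)"
proof -
  have A: "A \<subseteq> sphere 0 1" using assms by (auto simp: sets_restrict_space)
  have "emeasure radial_image A = ennreal (1 / unit_vol TYPE('a)) * emeasure lborel (sgn -` A \<inter> uball)"
  proof -
    have "sgn -` A \<inter> uball \<subseteq> uball" by blast
    from emeasure_restrict_space[OF _ this, of lborel]
    show ?thesis unfolding radial_image_def emeasure_scale_measure
      by (subst emeasure_distr[OF sgn_measurable_sphere assms]) (simp add: space_restrict_space)
  qed
  also have "\<dots> = emeasure lborel (sphere_cone A) / emeasure lborel (ball (0::'a) 1)"
  proof -
    have "inverse (ennreal (unit_vol TYPE('a))) = ennreal (1 / unit_vol TYPE('a))"
      using inverse_ennreal[OF unit_vol_pos[where 'a='a]] by (simp add: inverse_eq_divide)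
    thus ?thesis
      by (simp add: sphere_cone_eq[OF A] emeasure_ball unit_vol_def divide_ennreal_def mult.commute)
  qed
  finally show ?thesis .
qed

text \<open>The cone formula gives equal set functions; the countable additivity that makes
  \<open>measure_of\<close> return these values is inherited from
  \<open>radial_image\<close>.\<close>

lemma sphere_measure_eq: "sphere_measure = radial_image"
proof (rule measure_eqI)
  have s: "sets (radial_image :: 'a measure) = sets (restrict_space borel (sphere (0::'a) 1))"
    by (simp add: radial_image_def)
  show "sets sphere_measure = sets (radial_image :: 'a measure)" unfolding s by (rule sets_sphere_measure)
  fix A :: "'a set" assume "A \<in> sets sphere_measure"
  hence A: "A \<in> sets (restrict_space borel (sphere (0::'a) 1))" by (simp add: sets_sphere_measure)
  show "emeasure sphere_measure A = emeasure radial_image A"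
    unfolding emeasure_radial_image[OF A]
  proof (rule emeasure_measure_of[OF sphere_measure_def, where X = A])
    show "countably_additive (sets (sphere_measure :: 'a measure))
       (\<lambda>A. emeasure lborel (sphere_cone A) / emeasure lborel (ball (0::'a) 1))"
      unfolding sets_sphere_measure
    proof (rule countably_additiveI)
      fix B :: "nat \<Rightarrow> 'a set"
      assume B: "range B \<subseteq> sets (restrict_space borel (sphere 0 1))" "disjoint_family B"
        "(\<Union>i. B i) \<in> sets (restrict_space borel (sphere 0 1))"
      have Bi: "B i \<in> sets (restrict_space borel (sphere 0 1))" for i using B(1) by blast
      have "(\<Sum>i. emeasure radial_image (B i)) = emeasure radial_image (\<Union>i. B i)"
        by (rule suminf_emeasure) (use B s in auto)
      thus "(\<Sum>i. emeasure lborel (sphere_cone (B i)) / emeasure lborel (ball (0::'a) 1)) =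
         emeasure lborel (sphere_cone (\<Union>i. B i)) / emeasure lborel (ball (0::'a) 1)"
        unfolding emeasure_radial_image[OF Bi] emeasure_radial_image[OF B(3)] .
    qed
  qed (use A in \<open>auto simp: sets_restrict_space positive_def sphere_cone_def sets_sphere_measure\<close>)
qed

lemma nn_integral_sphere:
  fixes f :: "'a::euclidean_space \<Rightarrow> ennreal"
  assumes "f \<in> borel_measurable sphere_measure"
  shows "(\<integral>\<^sup>+\<omega>. f \<omega> \<partial>sphere_measure)
       = ennreal (1 / unit_vol TYPE('a)) * (\<integral>\<^sup>+x. f (sgn x) * indicator uball x \<partial>lborel)"
proof -
  have f: "f \<in> borel_measurable (restrict_space borel (sphere 0 1))"
    using assms measurable_cong_sets[OF sets_sphere_measure refl, of borel] by blast
  have "(\<integral>\<^sup>+\<omega>. f \<omega> \<partial>sphere_measure) = ennreal (1 / unit_vol TYPE('a)) *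
     (\<integral>\<^sup>+\<omega>. f \<omega> \<partial>(distr (restrict_space lborel uball) (restrict_space borel (sphere 0 1)) sgn))"
    unfolding sphere_measure_eq radial_image_def
    by (rule nn_integral_scale_measure) (use f in simp)
  also have "(\<integral>\<^sup>+\<omega>. f \<omega> \<partial>(distr (restrict_space lborel uball) (restrict_space borel (sphere 0 1)) sgn))
     = (\<integral>\<^sup>+x. f (sgn x) \<partial>restrict_space lborel uball)"
    by (rule nn_integral_distr[OF sgn_measurable_sphere]) (use f in simp)
  also have "\<dots> = (\<integral>\<^sup>+x. f (sgn x) * indicator uball x \<partial>lborel)"
    by (rule nn_integral_restrict_space) simp
  finally show ?thesis .
qed

lemma prob_sphere_measure: "emeasure sphere_measure (sphere (0::'a::euclidean_space) 1) = 1"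
proof -
  have "emeasure sphere_measure (space (sphere_measure :: 'a measure)) = (\<integral>\<^sup>+\<omega>. 1 \<partial>(sphere_measure :: 'a measure))"
    by simp
  also have "\<dots> = ennreal (1 / unit_vol TYPE('a)) * (\<integral>\<^sup>+x. indicator uball x \<partial>(lborel :: 'a measure))"
    by (subst nn_integral_sphere) auto
  also have "\<dots> = 1"
    using unit_vol_pos[where 'a='a] by (simp add: emeasure_uball ennreal_mult[symmetric])
  finally show ?thesis by simp
qed

interpretation sphere: finite_measure "sphere_measure :: 'a::euclidean_space measure"
  by (rule finite_measureI) (simp add: prob_sphere_measure)

lemma id_measurable_sphere: "(\<lambda>\<omega>. \<omega>) \<in> borel_measurable sphere_measure"
  unfolding measurable_cong_sets[OF sets_sphere_measure refl]
  by (rule measurable_restrict_space1) simp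

lemma borel_measurable_sphere: "f \<in> borel_measurable borel \<Longrightarrow> f \<in> borel_measurable sphere_measure"
  using measurable_compose[OF id_measurable_sphere] .

section \<open>Polar coordinates\<close>

lemma nn_integral_inverse_power:
  assumes "0 < a" "0 < d"
  shows "(\<integral>\<^sup>+s. ennreal (1 / s ^ Suc d) * indicator {a..} s \<partial>lborel) = ennreal (1 / (real d * a ^ d))"
proof -
  obtain e where d: "d = Suc e" using assms(2) gr0_implies_Suc by blast
  have "(\<integral>\<^sup>+s. ennreal (1 / s ^ Suc d) * indicator {a..} s \<partial>lborel) = 0 - (- (1 / real d) * inverse a ^ d)"
  proof (rule nn_integral_FTC_atLeast)
    fix x assume x: "a \<le> x"
    with assms have x0: "0 < x" by simp
    have "((\<lambda>x. - (1 / real d) * inverse x ^ d) has_real_derivative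
        - (1 / real d) * ((1 + real e) * (- (inverse x ^ Suc (Suc 0)) * inverse x ^ e))) (at x)"
      using x0 unfolding d by (intro DERIV_cmult DERIV_power_Suc DERIV_inverse) simp
    also have "- (1 / real d) * ((1 + real e) * (- (inverse x ^ Suc (Suc 0)) * inverse x ^ e)) = 1 / x ^ Suc d"
      using x0 unfolding d by (simp add: field_simps)
    finally show "((\<lambda>x. - (1 / real d) * inverse x ^ d) has_real_derivative 1 / x ^ Suc d) (at x)" .
    show "0 \<le> 1 / x ^ Suc d" using x0 by simp
  next
    show "((\<lambda>x::real. - (1 / real d) * inverse x ^ d) \<longlongrightarrow> 0) at_top"
      using assms(2) by (intro tendsto_mult_right_zero tendsto_null_power tendsto_inverse_0_at_top filterlim_ident)
  qed simp
  thus ?thesis by (simp add: field_simps power_inverse)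
qed

lemma nn_integral_lborel_scale:
  fixes q :: "'a::euclidean_space \<Rightarrow> ennreal"
  assumes "q \<in> borel_measurable borel" "0 < c"
  shows "(\<integral>\<^sup>+x. q x \<partial>lborel) = ennreal (c ^ DIM('a)) * (\<integral>\<^sup>+x. q (c *\<^sub>R x) \<partial>lborel)"
  using assms
  by (subst lborel_affine[of c 0]) (auto simp: nn_integral_density nn_integral_distr nn_integral_cmult)

text \<open>The sphere integral is by definition a ball integral of a function of sgn x. Rescaling
  the radius by |x|, exchanging the integrals and rescaling x by s turns it into an integral over y
  with weight |y|^d * s^(-d-1) on s \<ge> |y|, and the s-integral of this weight is the constant
  1/d.\<close>

theorem nn_integral_polar:
  fixes F :: "'a::euclidean_space \<Rightarrow> ennreal"
  assumes F [measurable]: "F \<in> borel_measurable borel"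
  shows "(\<integral>\<^sup>+x. F x \<partial>lborel) = ennreal (DIM('a) * unit_vol TYPE('a)) *
    (\<integral>\<^sup>+\<omega>. (\<integral>\<^sup>+t. ennreal (t ^ (DIM('a) - 1)) * indicator {0<..} t * F (t *\<^sub>R \<omega>) \<partial>lborel) \<partial>sphere_measure)"
proof -
  let ?d = "DIM('a)"
  obtain n where n: "?d = Suc n" using DIM_positive[where 'a='a] gr0_implies_Suc by blast
  define k where "k s = ennreal (s ^ (?d - 1)) * indicator {0<..} s" for s :: real
  \<comment> \<open>The factor |x|^d is the Jacobian of t = |x| * s, since t^(d-1) dt = |x|^d *
    s^(d-1) ds.\<close>
  define h where "h x = ennreal (norm x ^ ?d) * indicator uball x" for x :: 'a
  define G where "G \<omega> = (\<integral>\<^sup>+t. k t * F (t *\<^sub>R \<omega>) \<partial>lborel)" for \<omega>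
  have [measurable]: "k \<in> borel_measurable borel" unfolding k_def by measurable
  have iu: "indicator uball \<in> borel_measurable (borel :: 'a measure)" by (rule borel_measurable_indicator) simp
  have [measurable]: "h \<in> borel_measurable borel" unfolding h_def
    by (intro borel_measurable_times_ennreal iu) measurable
  have G: "G \<in> borel_measurable borel" unfolding G_def
  proof (rule lborel.borel_measurable_nn_integral)
    have "(\<lambda>z. k (snd z) * F (snd z *\<^sub>R fst z)) \<in> borel_measurable (borel \<Otimes>\<^sub>M lborel)"
      by measurable
    thus "(\<lambda>(\<omega>, t). k t * F (t *\<^sub>R \<omega>)) \<in> borel_measurable (borel \<Otimes>\<^sub>M lborel)"
      by (simp add: case_prod_beta')
  qed
  have 1: "G (sgn x) * indicator uball x = (\<integral>\<^sup>+s. h x * k s * F (s *\<^sub>R x) \<partial>lborel)" for x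
  proof (cases "x = 0")
    case False
    have "G (sgn x) = ennreal (norm x) * (\<integral>\<^sup>+s. k (norm x * s) * F ((norm x * s) *\<^sub>R sgn x) \<partial>lborel)"
      unfolding G_def using False
      by (subst nn_integral_real_affine[where c = "norm x" and t = 0]) auto
    also have "(\<lambda>s. k (norm x * s) * F ((norm x * s) *\<^sub>R sgn x)) = (\<lambda>s. ennreal (norm x ^ n) * (k s * F (s *\<^sub>R x)))"
    proof
      fix s
      have "(norm x * s) *\<^sub>R sgn x = s *\<^sub>R x" using False by (simp add: sgn_div_norm)
      moreover have "k (norm x * s) = ennreal (norm x ^ n) * k s"
        using False unfolding k_def n
        by (auto simp: indicator_def power_mult_distrib ennreal_mult zero_less_mult_iff)
      ultimately show "k (norm x * s) * F ((norm x * s) *\<^sub>R sgn x) = ennreal (norm x ^ n) * (k s * F (s *\<^sub>R x))"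
        by (simp add: mult.assoc)
    qed
    also have "ennreal (norm x) * (\<integral>\<^sup>+s. ennreal (norm x ^ n) * (k s * F (s *\<^sub>R x)) \<partial>lborel)
        = ennreal (norm x ^ ?d) * (\<integral>\<^sup>+s. k s * F (s *\<^sub>R x) \<partial>lborel)"
      unfolding n by (subst nn_integral_cmult) (auto simp: ennreal_mult mult.assoc)
    finally have G1: "G (sgn x) = ennreal (norm x ^ ?d) * (\<integral>\<^sup>+s. k s * F (s *\<^sub>R x) \<partial>lborel)" .
    have "(\<integral>\<^sup>+s. h x * k s * F (s *\<^sub>R x) \<partial>lborel) = h x * (\<integral>\<^sup>+s. k s * F (s *\<^sub>R x) \<partial>lborel)"
      unfolding mult.assoc by (rule nn_integral_cmult) measurable
    thus ?thesis unfolding G1 by (simp add: h_def mult_ac)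
  qed (simp add: h_def)
  \<comment> \<open>The substitution y = s * x contributes s^(-d); with |y|^d / s^d from h and
    s^(d-1) from k the exponent of s becomes -(d+1). The ball condition |x| \<le> 1 turns into s
    \<ge> |y|.\<close>
  have 2: "(\<integral>\<^sup>+x. h x * k s * F (s *\<^sub>R x) \<partial>lborel)
     = (\<integral>\<^sup>+y. F y * ennreal (norm y ^ ?d) * indicator (-{0}) y *
           (ennreal (1 / s ^ Suc ?d) * indicator {norm y..} s) \<partial>lborel)" for s
  proof (cases "0 < s")
    case True
    have "(\<integral>\<^sup>+x. h x * k s * F (s *\<^sub>R x) \<partial>lborel) =
        ennreal ((1 / s) ^ ?d) * (\<integral>\<^sup>+y. h ((1 / s) *\<^sub>R y) * k s * F (s *\<^sub>R ((1 / s) *\<^sub>R y)) \<partial>lborel)"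
      by (rule nn_integral_lborel_scale) (use True in auto)
    also have "\<dots> = (\<integral>\<^sup>+y. ennreal ((1 / s) ^ ?d) * (h ((1 / s) *\<^sub>R y) * k s * F y) \<partial>lborel)"
      using True by (subst nn_integral_cmult) auto
    also have "\<dots> = (\<integral>\<^sup>+y. F y * ennreal (norm y ^ ?d) * indicator (-{0}) y *
           (ennreal (1 / s ^ Suc ?d) * indicator {norm y..} s) \<partial>lborel)"
    proof (rule nn_integral_cong)
      fix y :: 'a
      have h: "h ((1 / s) *\<^sub>R y) = ennreal (norm y ^ ?d / s ^ ?d) * (indicator (-{0}) y * indicator {norm y..} s)"
        unfolding h_def using True by (auto simp: indicator_def power_divide field_simps)
      have "ennreal ((1 / s) ^ ?d) * (ennreal (norm y ^ ?d / s ^ ?d) * ennreal (s ^ n))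
          = ennreal (norm y ^ ?d) * ennreal (1 / s ^ Suc ?d)"
        using True unfolding n
        by (simp add: ennreal_mult[symmetric] power_divide field_simps flip: power_add)
      moreover have "ennreal ((1 / s) ^ ?d) * (h ((1 / s) *\<^sub>R y) * k s * F y)
        = F y * (indicator (-{0}) y * indicator {norm y..} s) *
          (ennreal ((1 / s) ^ ?d) * (ennreal (norm y ^ ?d / s ^ ?d) * ennreal (s ^ n)))"
      proof -
        have "k s = ennreal (s ^ n)" using True by (simp add: k_def n)
        thus ?thesis unfolding h by (simp only: mult_ac)
      qed
      ultimately show "ennreal ((1 / s) ^ ?d) * (h ((1 / s) *\<^sub>R y) * k s * F y) = F y * ennreal (norm y ^ ?d) * indicator (-{0}) y *
           (ennreal (1 / s ^ Suc ?d) * indicator {norm y..} s)"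
        by (simp only: mult_ac)
    qed
    finally show ?thesis .
  next
    case False
    have "F y * ennreal (norm y ^ ?d) * indicator (-{0}) y * (ennreal (1 / s ^ Suc ?d) * indicator {norm y..} s) = 0" for y
    proof (cases "y = 0")
      case y: False
      hence "\<not> norm y \<le> s" using False by (metis not_less order_less_le_trans zero_less_norm_iff)
      thus ?thesis by (simp add: indicator_def)
    qed simp
    thus ?thesis using False by (simp only: k_def) simp
  qed
  have "(\<integral>\<^sup>+\<omega>. G \<omega> \<partial>sphere_measure) = ennreal (1 / unit_vol TYPE('a)) * (\<integral>\<^sup>+x. G (sgn x) * indicator uball x \<partial>lborel)"
    by (rule nn_integral_sphere) (rule borel_measurable_sphere[OF G])
  also have "(\<integral>\<^sup>+x. G (sgn x) * indicator uball x \<partial>lborel) = (\<integral>\<^sup>+x. (\<integral>\<^sup>+s. h x * k s * F (s *\<^sub>R x) \<partial>lborel) \<partial>lborel)"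
    unfolding 1 ..
  also have "\<dots> = (\<integral>\<^sup>+s. (\<integral>\<^sup>+x. h x * k s * F (s *\<^sub>R x) \<partial>lborel) \<partial>lborel)"
    by (rule lborel_pair.Fubini') measurable
  also have "\<dots> = (\<integral>\<^sup>+s. (\<integral>\<^sup>+y. F y * ennreal (norm y ^ ?d) * indicator (-{0}) y *
           (ennreal (1 / s ^ Suc ?d) * indicator {norm y..} s) \<partial>lborel) \<partial>lborel)"
    unfolding 2 ..
  also have "\<dots> = (\<integral>\<^sup>+y. (\<integral>\<^sup>+s. F y * ennreal (norm y ^ ?d) * indicator (-{0}) y *
           (ennreal (1 / s ^ Suc ?d) * indicator {norm y..} s) \<partial>lborel) \<partial>lborel)"
  proof (rule lborel_pair.Fubini')
    show "(\<lambda>(y, s). F y * ennreal (norm y ^ ?d) * indicator (-{0}) y *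
           (ennreal (1 / s ^ Suc ?d) * indicator {norm y..} s)) \<in> borel_measurable (lborel \<Otimes>\<^sub>M lborel)"
    proof -
      have [measurable]: "Measurable.pred (borel \<Otimes>\<^sub>M borel) (\<lambda>x :: 'a \<times> real. snd x \<in> {norm (fst x)..})"
        unfolding atLeast_iff by measurable
      show ?thesis unfolding case_prod_beta' by measurable
    qed
  qed
  \<comment> \<open>The integral of s^(-d-1) from |y| to infinity is 1 / (d * |y|^d), which cancels
    |y|^d; the origin is a null set.\<close>
  also have "\<dots> = (\<integral>\<^sup>+y. ennreal (1 / ?d) * F y \<partial>lborel)"
  proof (rule nn_integral_cong_AE)
    have "AE y in lborel. y \<noteq> (0 :: 'a)" by (rule AE_lborel_singleton)
    thus "AE y in lborel. (\<integral>\<^sup>+s. F y * ennreal (norm y ^ ?d) * indicator (-{0}) y *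
           (ennreal (1 / s ^ Suc ?d) * indicator {norm y..} s) \<partial>lborel) = ennreal (1 / ?d) * F y"
    proof eventually_elim
      case (elim y)
      have "(\<integral>\<^sup>+s. F y * ennreal (norm y ^ ?d) * indicator (-{0}) y *
           (ennreal (1 / s ^ Suc ?d) * indicator {norm y..} s) \<partial>lborel)
         = F y * ennreal (norm y ^ ?d) * ennreal (1 / (?d * norm y ^ ?d))"
        using elim nn_integral_inverse_power[of "norm y" ?d]
        by (subst nn_integral_cmult) (simp_all del: power_Suc)
      also have "\<dots> = F y * (ennreal (norm y ^ ?d) * ennreal (1 / (?d * norm y ^ ?d)))" by (simp only: mult.assoc)
      also have "ennreal (norm y ^ ?d) * ennreal (1 / (?d * norm y ^ ?d)) = ennreal (1 / ?d)"
        using elim by (simp add: ennreal_mult[symmetric])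
      finally show ?case by (simp add: mult.commute)
    qed
  qed
  also have "\<dots> = ennreal (1 / ?d) * (\<integral>\<^sup>+y. F y \<partial>lborel)" by (rule nn_integral_cmult) simp
  finally have "ennreal (?d * unit_vol TYPE('a)) * (\<integral>\<^sup>+\<omega>. G \<omega> \<partial>sphere_measure)
    = (ennreal (?d * unit_vol TYPE('a)) * ennreal (1 / unit_vol TYPE('a)) * ennreal (1 / ?d)) * (\<integral>\<^sup>+y. F y \<partial>lborel)"
    by (simp add: mult.assoc)
  also have "ennreal (?d * unit_vol TYPE('a)) * ennreal (1 / unit_vol TYPE('a)) * ennreal (1 / ?d) = 1"
    using unit_vol_pos[where 'a='a] by (simp add: ennreal_mult[symmetric])
  finally show ?thesis by (simp add: G_def k_def mult.assoc)
qed

text \<open>The factor d * \<open>unit_vol\<close> is the area of the unit sphere and compensates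
  for the normalisation of \<open>sphere_measure\<close>.\<close>

definition polar_weight :: "'a::euclidean_space itself \<Rightarrow> real \<Rightarrow> real" where
  "polar_weight T t = DIM('a) * unit_vol T * t ^ (DIM('a) - 1) * indicator {0<..} t"

lemma polar_weight_nonneg: "0 \<le> polar_weight TYPE('a::euclidean_space) t"
  using unit_vol_pos[where 'a='a] by (auto simp: polar_weight_def indicator_def)

lemma polar_weight_measurable: "polar_weight T \<in> borel_measurable borel"
  unfolding polar_weight_def by measurable

lemma measurable_pair_sphere:
  assumes "f \<in> borel_measurable (borel \<Otimes>\<^sub>M borel)"
  shows "f \<in> borel_measurable (sphere_measure \<Otimes>\<^sub>M lborel)"
proof -
  have "snd \<in> (sphere_measure \<Otimes>\<^sub>M lborel) \<rightarrow>\<^sub>M borel" by measurable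
  hence "(\<lambda>z. (fst z, snd z)) \<in> (sphere_measure \<Otimes>\<^sub>M lborel) \<rightarrow>\<^sub>M (borel \<Otimes>\<^sub>M borel)"
    by (intro measurable_Pair measurable_compose[OF measurable_fst id_measurable_sphere])
  from measurable_compose[OF this assms] show ?thesis by simp
qed

interpretation sphere_line: pair_sigma_finite "sphere_measure :: 'a::euclidean_space measure" "lborel :: real measure" ..

text \<open>Polar coordinates in the form of an identity of measures, so that they carry over from
  nonnegative functions to Bochner integrals with complex values.\<close>

lemma lborel_eq_polar:
  "lborel = distr (density (sphere_measure \<Otimes>\<^sub>M lborel) (\<lambda>z. ennreal (polar_weight TYPE('a) (snd z)))) borel
     (\<lambda>z. snd z *\<^sub>R fst z :: 'a::euclidean_space)" (is "_ = distr (density ?S ?w) borel ?g")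
proof (rule measure_eqI)
  have g: "?g \<in> ?S \<rightarrow>\<^sub>M borel"
    by (rule measurable_pair_sphere) measurable
  have w: "?w \<in> borel_measurable ?S"
    by (intro measurable_pair_sphere measurable_compose[OF _ measurable_ennreal]
        measurable_compose[OF measurable_snd polar_weight_measurable])
  fix A :: "'a set" assume "A \<in> sets lborel"
  hence A: "A \<in> sets borel" by simp
  have ind: "indicator A \<in> borel_measurable (borel :: 'a measure)" using A by (rule borel_measurable_indicator)
  have "emeasure lborel A = (\<integral>\<^sup>+x. indicator A x \<partial>lborel)" using A by simp
  also have "\<dots> = ennreal (DIM('a) * unit_vol TYPE('a)) *
    (\<integral>\<^sup>+\<omega>. (\<integral>\<^sup>+t. ennreal (t ^ (DIM('a) - 1)) * indicator {0<..} t * indicator A (t *\<^sub>R \<omega>) \<partial>lborel) \<partial>sphere_measure)"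
    by (rule nn_integral_polar[OF ind])
  also have "\<dots> = (\<integral>\<^sup>+\<omega>. ennreal (DIM('a) * unit_vol TYPE('a)) *
       (\<integral>\<^sup>+t. ennreal (t ^ (DIM('a) - 1)) * indicator {0<..} t * indicator A (t *\<^sub>R \<omega>) \<partial>lborel) \<partial>sphere_measure)"
  proof (rule nn_integral_cmult[symmetric], rule borel_measurable_sphere, rule lborel.borel_measurable_nn_integral)
    have "(\<lambda>z. ennreal (snd z ^ (DIM('a) - 1)) * indicator {0<..} (snd z) * indicator A (snd z *\<^sub>R fst z))
        \<in> borel_measurable (borel \<Otimes>\<^sub>M lborel)"
      using A by measurable
    thus "(\<lambda>(\<omega>, t). ennreal (t ^ (DIM('a) - 1)) * indicator {0<..} t * indicator A (t *\<^sub>R \<omega>))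
        \<in> borel_measurable (borel \<Otimes>\<^sub>M lborel)" by (simp add: case_prod_beta')
  qed
  also have "\<dots> = (\<integral>\<^sup>+\<omega>. (\<integral>\<^sup>+t. ?w (\<omega>, t) * indicator A (?g (\<omega>, t)) \<partial>lborel) \<partial>sphere_measure)"
  proof (rule nn_integral_cong)
    fix \<omega> :: 'a
    have m: "(\<lambda>t. ennreal (t ^ (DIM('a) - 1)) * indicator {0<..} t * indicator A (t *\<^sub>R \<omega>)) \<in> borel_measurable lborel"
      using A by measurable
    show "ennreal (DIM('a) * unit_vol TYPE('a)) *
       (\<integral>\<^sup>+t. ennreal (t ^ (DIM('a) - 1)) * indicator {0<..} t * indicator A (t *\<^sub>R \<omega>) \<partial>lborel)
      = (\<integral>\<^sup>+t. ?w (\<omega>, t) * indicator A (?g (\<omega>, t)) \<partial>lborel)"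
      unfolding nn_integral_cmult[OF m, symmetric]
    proof (rule nn_integral_cong)
      fix t :: real
      show "ennreal (DIM('a) * unit_vol TYPE('a)) * (ennreal (t ^ (DIM('a) - 1)) * indicator {0<..} t * indicator A (t *\<^sub>R \<omega>))
         = ?w (\<omega>, t) * indicator A (?g (\<omega>, t))"
        using unit_vol_pos[where 'a='a]
        by (cases "0 < t") (auto simp: polar_weight_def ennreal_mult' mult_ac)
    qed
  qed
  also have "\<dots> = (\<integral>\<^sup>+z. ?w z * indicator A (?g z) \<partial>?S)"
    by (rule lborel.nn_integral_fst)
       (intro borel_measurable_times_ennreal w measurable_compose[OF g ind])
  also have "\<dots> = (\<integral>\<^sup>+z. indicator (?g -` A \<inter> space ?S) z \<partial>density ?S ?w)"
    unfolding nn_integral_density[OF w borel_measurable_indicator[OF measurable_sets[OF g A]]]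
    by (intro nn_integral_cong) (simp add: indicator_def)
  also have "\<dots> = emeasure (distr (density ?S ?w) borel ?g) A"
    using g A measurable_sets[OF g A] by (subst emeasure_distr) simp_all
  finally show "emeasure lborel A = emeasure (distr (density ?S ?w) borel ?g) A" .
qed simp

lemma integral_polar:
  fixes f :: "'a::euclidean_space \<Rightarrow> 'b::{banach,second_countable_topology}"
  assumes f: "integrable lborel f"
  shows "integrable sphere_measure (\<lambda>\<omega>. \<integral>t. polar_weight TYPE('a) t *\<^sub>R f (t *\<^sub>R \<omega>) \<partial>lborel)"
    and "integral\<^sup>L lborel f = (\<integral>\<omega>. (\<integral>t. polar_weight TYPE('a) t *\<^sub>R f (t *\<^sub>R \<omega>) \<partial>lborel) \<partial>sphere_measure)"
proof -
  let ?S = "sphere_measure \<Otimes>\<^sub>M lborel :: ('a \<times> real) measure"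
  let ?w = "\<lambda>z :: 'a \<times> real. polar_weight TYPE('a) (snd z)"
  let ?g = "\<lambda>z :: 'a \<times> real. snd z *\<^sub>R fst z"
  have g: "?g \<in> ?S \<rightarrow>\<^sub>M borel" by (rule measurable_pair_sphere) measurable
  have w: "?w \<in> borel_measurable ?S"
    by (intro measurable_pair_sphere measurable_compose[OF measurable_snd polar_weight_measurable])
  have nn: "AE z in ?S. 0 \<le> ?w z" by (rule AE_I2) (rule polar_weight_nonneg)
  have fb: "f \<in> borel_measurable borel" using borel_measurable_integrable[OF f] by simp
  have fg: "(\<lambda>z. f (?g z)) \<in> borel_measurable ?S" by (rule measurable_compose[OF g fb])
  have g': "?g \<in> density ?S ?w \<rightarrow>\<^sub>M borel" using g by simp
  have "integrable (density ?S ?w) (\<lambda>z. f (?g z))"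
    using f unfolding lborel_eq_polar[where 'a='a] integrable_distr_eq[OF g' fb] .
  hence i: "integrable ?S (\<lambda>z. ?w z *\<^sub>R f (?g z))"
    using integrable_density[OF fg w nn] by simp
  have i': "integrable ?S (case_prod (\<lambda>\<omega> t. polar_weight TYPE('a) t *\<^sub>R f (t *\<^sub>R \<omega>)))"
    using i by (simp add: case_prod_beta')
  show "integrable sphere_measure (\<lambda>\<omega>. \<integral>t. polar_weight TYPE('a) t *\<^sub>R f (t *\<^sub>R \<omega>) \<partial>lborel)"
    by (rule sphere_line.integrable_fst[OF i'])
  have "integral\<^sup>L lborel f = integral\<^sup>L ?S (\<lambda>z. ?w z *\<^sub>R f (?g z))"
    unfolding lborel_eq_polar[where 'a='a] integral_distr[OF g' fb]
    by (rule integral_density[OF fg w nn])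
  also have "\<dots> = (\<integral>\<omega>. (\<integral>t. polar_weight TYPE('a) t *\<^sub>R f (t *\<^sub>R \<omega>) \<partial>lborel) \<partial>sphere_measure)"
    unfolding sphere_line.integral_fst[OF i'] by (simp add: case_prod_beta')
  finally show "integral\<^sup>L lborel f = (\<integral>\<omega>. (\<integral>t. polar_weight TYPE('a) t *\<^sub>R f (t *\<^sub>R \<omega>) \<partial>lborel) \<partial>sphere_measure)" .
qed

section \<open>The Cauchy kernel as a dual Radon transform\<close>

lemma power_exp_bound:
  fixes r :: real
  assumes "0 < r"
  obtains B where "0 \<le> B" "\<And>t. 0 \<le> t \<Longrightarrow> t ^ n * exp (- (r * t)) \<le> B * exp (- (r / 2 * t))"
proof (cases "n = 0")
  case True
  show thesis
  proof (rule that[of 1])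
    fix t :: real assume "0 \<le> t"
    thus "t ^ n * exp (- (r * t)) \<le> 1 * exp (- (r / 2 * t))"
      using True assms by (simp add: field_simps)
  qed simp
next
  case False
  \<comment> \<open>The constant comes from (1 + x / n)^n \<le> exp x with x = r t / 2, which gives
    t^n \<le> (2 n / r)^n * exp (r t / 2).\<close>
  define B where "B = (2 * real n / r) ^ n"
  show thesis
  proof (rule that[of B])
    show "0 \<le> B" using assms by (simp add: B_def)
    fix t :: real assume t: "0 \<le> t"
    have "(r / 2 * t / real n) ^ n \<le> (1 + r / 2 * t / real n) ^ n"
      using t assms by (intro power_mono) auto
    also have "\<dots> \<le> exp (r / 2 * t)"
    proof (rule exp_ge_one_plus_x_over_n_power_n)
      have "0 \<le> r / 2 * t" using t assms by simp
      thus "- real n \<le> r / 2 * t" by linarith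
    qed (use False in simp)
    finally have "B * (r / 2 * t / real n) ^ n \<le> B * exp (r / 2 * t)"
      using assms by (intro mult_left_mono) (auto simp: B_def)
    also have "B * (r / 2 * t / real n) ^ n = t ^ n"
      using assms False by (simp add: B_def power_mult_distrib[symmetric])
    finally have "t ^ n * exp (- (r * t)) \<le> B * exp (r / 2 * t) * exp (- (r * t))"
      by (intro mult_right_mono) auto
    also have "\<dots> = B * exp (- (r / 2 * t))"
      by (simp add: mult.assoc exp_add[symmetric])
    finally show "t ^ n * exp (- (r * t)) \<le> B * exp (- (r / 2 * t))" .
  qed
qed

lemma integrable_exp_half_line:
  assumes "0 < r"
  shows "integrable lborel (\<lambda>t::real. indicator {0<..} t * exp (- (r * t)))"
proof (rule integrableI_bounded)
  have "(\<integral>\<^sup>+t. ennreal (norm (indicator {0<..} t * exp (- (r * t)))) \<partial>lborel)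
     \<le> (\<integral>\<^sup>+t. ennreal (exp (- (r * t))) * indicator {0..} t \<partial>lborel)"
    by (intro nn_integral_mono) (auto simp: indicator_def)
  also have "\<dots> = 0 - (- exp (- (r * 0)) / r)"
  proof (rule nn_integral_FTC_atLeast)
    show "((\<lambda>t. - exp (- (r * t)) / r) has_real_derivative exp (- (r * t))) (at t)" for t
      using assms by (auto intro!: derivative_eq_intros)
    have "((\<lambda>t. - exp (- (r * t)) / r) \<longlongrightarrow> - 0 / r) at_top"
      using assms
      by (intro tendsto_intros filterlim_compose[OF exp_at_bot]
           filterlim_compose[OF filterlim_uminus_at_bot_at_top] filterlim_tendsto_pos_mult_at_top[OF tendsto_const]
           filterlim_ident) auto
    thus "((\<lambda>t. - exp (- (r * t)) / r) \<longlongrightarrow> 0) at_top" by simp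
  qed auto
  finally show "(\<integral>\<^sup>+t. ennreal (norm (indicator {0<..} t * exp (- (r * t)))) \<partial>lborel) < \<infinity>"
    using order_le_less_trans by fastforce
qed simp

lemma norm_power_exp:
  assumes "0 \<le> t"
  shows "norm (of_real t ^ n * exp (- (c * of_real t)) :: complex) = t ^ n * exp (- (Re c * t))"
  using assms by (simp add: norm_mult norm_power)

lemma integrable_power_exp:
  assumes "0 < Re c"
  shows "set_integrable lborel {0<..} (\<lambda>t. of_real t ^ n * exp (- (c * of_real t)) :: complex)"
proof -
  obtain B where B: "0 \<le> B" "\<And>t. 0 \<le> t \<Longrightarrow> t ^ n * exp (- (Re c * t)) \<le> B * exp (- (Re c / 2 * t))"
    using power_exp_bound[OF assms] by blast
  have "integrable lborel (\<lambda>t::real. B * (indicator {0<..} t * exp (- (Re c / 2 * t))))"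
    using assms by (intro integrable_mult_right integrable_exp_half_line) simp
  thus ?thesis unfolding set_integrable_def
  proof (rule Bochner_Integration.integrable_bound)
    show "(\<lambda>t. indicator {0<..} t *\<^sub>R (of_real t ^ n * exp (- (c * of_real t))) :: complex) \<in> borel_measurable lborel"
      by measurable
    show "AE t in lborel. norm (indicator {0<..} t *\<^sub>R (of_real t ^ n * exp (- (c * of_real t))) :: complex)
       \<le> norm (B * (indicator {0<..} t * exp (- (Re c / 2 * t))))"
    proof (rule AE_I2)
      fix t :: real
      show "norm (indicator {0<..} t *\<^sub>R (of_real t ^ n * exp (- (c * of_real t))) :: complex)
       \<le> norm (B * (indicator {0<..} t * exp (- (Re c / 2 * t))))"
        using B(1) B(2)[of t] norm_power_exp[of t n c] by (cases "0 < t") auto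
    qed
  qed
qed

lemma tendsto_power_exp:
  assumes "0 < Re c"
  shows "((\<lambda>t. of_real t ^ n * exp (- (c * of_real t)) :: complex) \<longlongrightarrow> 0) at_top"
proof -
  obtain B where B: "\<And>t. 0 \<le> t \<Longrightarrow> t ^ n * exp (- (Re c * t)) \<le> B * exp (- (Re c / 2 * t))"
    using power_exp_bound[OF assms] by blast
  have "((\<lambda>t. B * exp (- (Re c / 2 * t))) \<longlongrightarrow> B * 0) at_top"
    using assms
    by (intro tendsto_intros filterlim_compose[OF exp_at_bot]
         filterlim_compose[OF filterlim_uminus_at_bot_at_top] filterlim_tendsto_pos_mult_at_top[OF tendsto_const]
         filterlim_ident) auto
  hence lim: "((\<lambda>t. B * exp (- (Re c / 2 * t))) \<longlongrightarrow> 0) at_top" by simp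
  show ?thesis
  proof (rule Lim_null_comparison[OF _ lim])
    show "eventually (\<lambda>t. norm (of_real t ^ n * exp (- (c * of_real t)) :: complex) \<le> B * exp (- (Re c / 2 * t))) at_top"
      using eventually_ge_at_top[of 0] by eventually_elim (simp only: norm_power_exp B)
  qed
qed

text \<open>Integrating the derivative of t^(n+1) * exp (- c t) over the half-line yields the
  recursion J (n+1) = (n+1) / c * J n. This works directly for complex c, so no contour has to be
  rotated.\<close>

lemma integral_power_exp:
  assumes c: "0 < Re c"
  shows "(\<integral>t. indicator {0<..} t *\<^sub>R (of_real t ^ n * exp (- (c * of_real t))) \<partial>lborel) = (fact n / c ^ Suc n :: complex)"
proof -
  define J where "J n = (\<integral>t. indicator {0<..} t *\<^sub>R (of_real t ^ n * exp (- (c * of_real t))) \<partial>lborel)" for n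
  have c0: "c \<noteq> 0" using c by auto
  have FTC: "(LBINT t:{0<..}. f t) = B - A"
    if "\<And>t. (F has_vector_derivative f t) (at t)" "\<And>t. isCont f t" "set_integrable lborel {0<..} f"
      "(F \<longlongrightarrow> B) at_top" "isCont F 0" "F 0 = A" for F f :: "real \<Rightarrow> complex" and A B
  proof -
    have "(LBINT t=0..\<infinity>. f t) = B - A"
    proof (rule interval_integral_FTC_integrable[where F = F])
      have "(F \<longlongrightarrow> A) (at_right 0)"
        using that(5,6) by (metis filterlim_at_split isCont_def)
      thus "((F \<circ> real_of_ereal) \<longlongrightarrow> A) (at_right 0)" by (simp add: zero_ereal_def ereal_tendsto_simps)
      show "((F \<circ> real_of_ereal) \<longlongrightarrow> B) (at_left \<infinity>)" using that(4) by (simp add: ereal_tendsto_simps)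
      have "einterval 0 \<infinity> = {0<..}" by (auto simp: einterval_def)
      thus "set_integrable lborel (einterval 0 \<infinity>) f" using that(3) by simp
    qed (use that in auto)
    thus ?thesis by (simp add: interval_lebesgue_integral_0_infty)
  qed
  have "J n = fact n / c ^ Suc n"
  proof (induction n)
    case 0
    have "(LBINT t:{0<..}. of_real t ^ 0 * exp (- (c * of_real t))) = 0 - (- (1 / c))"
    proof (rule FTC[where F = "\<lambda>t. - (1 / c) * exp (- (c * of_real t))"])
      show "((\<lambda>t. - (1 / c) * exp (- (c * of_real t))) has_vector_derivative of_real t ^ 0 * exp (- (c * of_real t))) (at t)" for t
      proof (rule has_vector_derivative_real_field)
        show "((\<lambda>z. - (1 / c) * exp (- (c * z))) has_field_derivative of_real t ^ 0 * exp (- (c * of_real t))) (at (of_real t))"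
          using c0 by (auto intro!: derivative_eq_intros)
      qed
      show "((\<lambda>t. - (1 / c) * exp (- (c * complex_of_real t))) \<longlongrightarrow> 0) at_top"
        using tendsto_mult_right_zero[OF tendsto_power_exp[OF c, of 0], of "- (1 / c)"] by simp
      show "isCont (\<lambda>t. complex_of_real t ^ 0 * exp (- (c * of_real t))) t" for t by (intro continuous_intros)
      show "isCont (\<lambda>t. - (1 / c) * exp (- (c * complex_of_real t))) 0" by (intro continuous_intros)
    qed (use integrable_power_exp[OF c, of 0] in simp_all)
    thus ?case by (simp add: J_def set_lebesgue_integral_def)
  next
    case (Suc n)
    have int: "set_integrable lborel {0<..} (\<lambda>t. of_nat (Suc n) * (of_real t ^ n * exp (- (c * of_real t))))"
      "set_integrable lborel {0<..} (\<lambda>t. c * (of_real t ^ Suc n * exp (- (c * of_real t))))"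
      by (intro set_integrable_mult_right integrable_power_exp[OF c])+
    have "(LBINT t:{0<..}. of_nat (Suc n) * (of_real t ^ n * exp (- (c * of_real t)))
         - c * (of_real t ^ Suc n * exp (- (c * of_real t)))) = 0 - 0"
    proof (rule FTC[where F = "\<lambda>t. of_real t ^ Suc n * exp (- (c * of_real t))"])
      fix t
      have "((\<lambda>z. z ^ Suc n * exp (- (c * z))) has_field_derivative
          of_nat (Suc n) * (of_real t ^ n * exp (- (c * of_real t))) - c * (of_real t ^ Suc n * exp (- (c * of_real t))))
          (at (of_real t))"
      proof (rule DERIV_cong[OF DERIV_mult])
        show "((\<lambda>z::complex. z ^ Suc n) has_field_derivative (1 + of_nat n) * (1 * of_real t ^ n)) (at (of_real t))"
          by (rule DERIV_power_Suc[OF DERIV_ident])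
        show "((\<lambda>z. exp (- (c * z))) has_field_derivative - c * exp (- (c * of_real t))) (at (of_real t))"
          by (auto intro!: derivative_eq_intros)
      qed (simp add: algebra_simps)
      thus "((\<lambda>t. of_real t ^ Suc n * exp (- (c * of_real t))) has_vector_derivative
          of_nat (Suc n) * (of_real t ^ n * exp (- (c * of_real t)))
         - c * (of_real t ^ Suc n * exp (- (c * of_real t)))) (at t)"
        by (rule has_vector_derivative_real_field)
      show "isCont (\<lambda>t. of_nat (Suc n) * (of_real t ^ n * exp (- (c * of_real t)))
         - c * (of_real t ^ Suc n * exp (- (c * of_real t)))) t" by (intro continuous_intros)
    next
      show "isCont (\<lambda>t. of_real t ^ Suc n * exp (- (c * complex_of_real t))) 0" by (intro continuous_intros)
    qed (use int tendsto_power_exp[OF c, of "Suc n"] in \<open>auto intro: set_integral_diff\<close>)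
    hence "of_nat (Suc n) * J n - c * J (Suc n) = 0"
      unfolding set_integral_diff(2)[OF int] set_integral_mult_right
      by (simp only: J_def set_lebesgue_integral_def diff_0_right)
    hence "J (Suc n) = of_nat (Suc n) * J n / c" using c0 by (simp add: field_simps)
    thus ?case using Suc by (simp add: field_simps)
  qed
  thus ?thesis by (simp only: J_def)
qed

text \<open>The arctangent settles the half-line, and the half-line function plus its reflection
  dominates the whole; at 0 the sum counts the value twice.\<close>

lemma integrable_inverse_1_plus_square: "integrable lborel (\<lambda>x::real. 1 / (1 + x\<^sup>2))"
proof -
  define h where "h x = indicator {0..} x * (1 / (1 + x\<^sup>2))" for x :: real
  have h: "integrable lborel h"
  proof (rule integrableI_bounded)
    have "(\<integral>\<^sup>+x. ennreal (norm (h x)) \<partial>lborel) = (\<integral>\<^sup>+x. ennreal (1 / (1 + x\<^sup>2)) * indicator {0..} x \<partial>lborel)"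
      by (intro nn_integral_cong) (auto simp: h_def indicator_def)
    also have "\<dots> = ennreal (pi / 2 - arctan 0)"
    proof (rule nn_integral_FTC_atLeast)
      show "(arctan has_real_derivative 1 / (1 + x\<^sup>2)) (at x)" for x
        by (auto intro!: derivative_eq_intros simp: field_simps)
    qed (auto intro: tendsto_arctan_at_top)
    finally show "(\<integral>\<^sup>+x. ennreal (norm (h x)) \<partial>lborel) < \<infinity>" by simp
  qed (simp add: h_def[abs_def])
  have "integrable lborel (\<lambda>x. h x + h (0 + (-1) * x))"
    by (intro Bochner_Integration.integrable_add h lborel_integrable_real_affine) simp
  thus ?thesis
    by (rule Bochner_Integration.integrable_bound) (auto simp: h_def indicator_def)
qed

text \<open>Splitting at 0 leaves two Laplace integrals with rates 1 - i a and 1 + i a, and 1 / (1 -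
  i a) + 1 / (1 + i a) = 2 / (1 + a^2).\<close>

lemma fourier_laplace_1d:
  fixes a :: real
  shows "integrable lborel (\<lambda>t. exp (- of_real \<bar>t\<bar> + \<i> * of_real (a * t)))"
    and "(\<integral>t. exp (- of_real \<bar>t\<bar> + \<i> * of_real (a * t)) \<partial>lborel) = of_real (2 / (1 + a\<^sup>2))"
proof -
  define G where "G b t = indicator {0<..} t *\<^sub>R exp (- (Complex 1 b * of_real t))" for b t :: real
  have Gi: "integrable lborel (G b)" for b
    using integrable_power_exp[of "Complex 1 b" 0] by (simp add: G_def[abs_def] set_integrable_def)
  have Gv: "integral\<^sup>L lborel (G b) = 1 / Complex 1 b" for b
    using integral_power_exp[of "Complex 1 b" 0] by (simp add: G_def[abs_def])
  have Gi': "integrable lborel (\<lambda>t. G b (- t))" for b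
    using lborel_integrable_real_affine[OF Gi, of "-1" b 0] by simp
  have Gv': "(\<integral>t. G b (- t) \<partial>lborel) = 1 / Complex 1 b" for b
    using lborel_integral_real_affine[of "-1" "G b" 0] Gv by simp
  have ae: "AE t in lborel. G (-a) t + G a (- t) = exp (- of_real \<bar>t\<bar> + \<i> * of_real (a * t))"
    using AE_lborel_singleton[of 0]
  proof eventually_elim
    case (elim t)
    have "Complex 1 b = 1 + \<i> * of_real b" for b
      by (simp add: complex_eq_iff)
    thus ?case using elim by (cases "0 < t") (auto simp: G_def algebra_simps)
  qed
  have m: "(\<lambda>t. exp (- of_real \<bar>t\<bar> + \<i> * of_real (a * t))) \<in> borel_measurable lborel" by measurable
  have i: "integrable lborel (\<lambda>t. G (-a) t + G a (- t))" by (intro Bochner_Integration.integrable_add Gi Gi')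
  show "integrable lborel (\<lambda>t. exp (- of_real \<bar>t\<bar> + \<i> * of_real (a * t)))"
    using integrable_cong_AE[OF borel_measurable_integrable[OF i] m ae] i by blast
  have "(\<integral>t. exp (- of_real \<bar>t\<bar> + \<i> * of_real (a * t)) \<partial>lborel) = (\<integral>t. G (-a) t + G a (- t) \<partial>lborel)"
    using integral_cong_AE[OF borel_measurable_integrable[OF i] m ae] by simp
  also have "\<dots> = 1 / Complex 1 (-a) + 1 / Complex 1 a"
    by (simp only: Bochner_Integration.integral_add[OF Gi Gi'] Gv Gv')
  also have "\<dots> = of_real (2 / (1 + a\<^sup>2))"
  proof -
    have "1 + a\<^sup>2 > 0" by (simp add: add_pos_nonneg)
    hence s: "1 + a * a \<noteq> 0" by (simp add: power2_eq_square)
    have "2 / (1 + a * a) = (2 + 2 * (a * a)) / ((1 + a * a) * (1 + a * a))"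
    proof -
      have "(2 + 2 * (a * a)) / ((1 + a * a) * (1 + a * a)) = (2 * (1 + a * a)) / ((1 + a * a) * (1 + a * a))"
        by (simp only: distrib_left mult_1_right)
      thus ?thesis using nonzero_mult_divide_mult_cancel_right[OF s, of 2 "1 + a * a"] by (simp only:)
    qed
    thus ?thesis
      by (simp add: complex_eq_iff Re_divide Im_divide power2_eq_square add_divide_distrib[symmetric])
  qed
  finally show "(\<integral>t. exp (- of_real \<bar>t\<bar> + \<i> * of_real (a * t)) \<partial>lborel) = of_real (2 / (1 + a\<^sup>2))" .
qed

text \<open>Lebesgue measure is the image of the product of one-dimensional Lebesgue measures under
  the coordinate map, so Fubini for finite products applies.\<close>

lemma integral_prod_lborel:
  fixes f :: "'a::euclidean_space \<Rightarrow> real \<Rightarrow> 'b::{real_normed_field,banach,second_countable_topology}"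
  assumes "\<And>b. b \<in> Basis \<Longrightarrow> integrable lborel (f b)"
  shows "integrable lborel (\<lambda>x. \<Prod>b\<in>Basis. f b (x \<bullet> b))"
    and "(\<integral>x. (\<Prod>b\<in>Basis. f b (x \<bullet> b)) \<partial>lborel) = (\<Prod>b\<in>Basis. integral\<^sup>L lborel (f b))"
proof -
  interpret product_sigma_finite "\<lambda>_::'a. lborel :: real measure" by standard
  let ?T = "\<lambda>g. \<Sum>b\<in>Basis. g b *\<^sub>R b :: 'a"
  have T: "?T \<in> (\<Pi>\<^sub>M b\<in>Basis. lborel) \<rightarrow>\<^sub>M borel" by measurable
  have fm: "(\<lambda>x. \<Prod>b\<in>Basis. f b (x \<bullet> b)) \<in> borel_measurable borel"
  proof (rule borel_measurable_prod)
    fix b :: 'a assume "b \<in> Basis"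
    hence "f b \<in> borel_measurable borel" using borel_measurable_integrable[OF assms] by simp
    thus "(\<lambda>x. f b (x \<bullet> b)) \<in> borel_measurable borel"
      by (rule measurable_compose[rotated]) measurable
  qed
  have fT: "(\<lambda>g. \<Prod>b\<in>Basis. f b (?T g \<bullet> b)) = (\<lambda>g. \<Prod>b\<in>Basis. f b (g b))"
    by (intro ext prod.cong refl) simp
  show "integrable lborel (\<lambda>x. \<Prod>b\<in>Basis. f b (x \<bullet> b))"
    unfolding lborel_eq[where 'a='a] integrable_distr_eq[OF T fm] fT
    by (rule product_integrable_prod) (use assms in auto)
  show "(\<integral>x. (\<Prod>b\<in>Basis. f b (x \<bullet> b)) \<partial>lborel) = (\<Prod>b\<in>Basis. integral\<^sup>L lborel (f b))"
    unfolding lborel_eq[where 'a='a] integral_distr[OF T fm] fT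
    by (rule product_integral_prod) (use assms in auto)
qed

section \<open>The ridge function and its dual Radon transform\<close>

definition l1_norm :: "'a::euclidean_space \<Rightarrow> real" where
  "l1_norm x = (\<Sum>b\<in>Basis. \<bar>x \<bullet> b\<bar>)"

definition cauchy_kernel :: "'a::euclidean_space \<Rightarrow> real" where
  "cauchy_kernel x = (\<Prod>b\<in>Basis. 2 / (1 + (x \<bullet> b)\<^sup>2))"

text \<open>The sphere area d * \<open>unit_vol\<close> from \<open>polar_weight\<close>, times
  (d-1)! from the radial Gamma integral.\<close>

definition ridge_const :: "'a::euclidean_space itself \<Rightarrow> real" where
  "ridge_const T = DIM('a) * unit_vol T * fact (DIM('a) - 1)"

definition ridge :: "'a::euclidean_space \<times> real \<Rightarrow> real" where
  "ridge z = ridge_const TYPE('a) * Re (1 / Complex (l1_norm (fst z)) (- snd z) ^ DIM('a))"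

text \<open>The p-derivative of \<open>ridge\<close>: with l for \<open>l1_norm\<close>,
  \<open>Complex l (- p)\<close> is l - i p, and its power -d has derivative i d times its power
  -d-1.\<close>

definition ridge_deriv :: "'a::euclidean_space \<times> real \<Rightarrow> real" where
  "ridge_deriv z = ridge_const TYPE('a) *
     Re (\<i> * of_nat DIM('a) / Complex (l1_norm (fst z)) (- snd z) ^ Suc DIM('a))"

lemma l1_norm_scaleR: "l1_norm (t *\<^sub>R x) = \<bar>t\<bar> * l1_norm x"
  by (simp add: l1_norm_def abs_mult sum_distrib_left)

text \<open>The l1 norm dominates the Euclidean norm. On the sphere this keeps the denominator l - i
  p at modulus at least 1.\<close>

lemma l1_norm_ge_1: "norm x = 1 \<Longrightarrow> 1 \<le> l1_norm x"
  using norm_le_l1[of x] by (simp add: l1_norm_def)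

lemma continuous_l1_norm [continuous_intros]:
  "continuous_on A f \<Longrightarrow> continuous_on A (\<lambda>x. l1_norm (f x))"
  unfolding l1_norm_def by (intro continuous_intros)

text \<open>Both sides are the Fourier transform of \<open>exp (- l1_norm \<xi>)\<close>, computed once as a product of
  one-dimensional integrals and once in polar coordinates.\<close>
theorem dual_radon_ridge: "dual_radon ridge (x :: 'a::euclidean_space) = cauchy_kernel x"
proof -
  define f where "f \<xi> = (\<Prod>b\<in>Basis. exp (- of_real \<bar>\<xi> \<bullet> b\<bar> + \<i> * of_real ((x \<bullet> b) * (\<xi> \<bullet> b))))" for \<xi> :: 'a
  have f_eq: "f \<xi> = exp (- of_real (l1_norm \<xi>) + \<i> * of_real (x \<bullet> \<xi>))" for \<xi>
    unfolding f_def exp_sum[OF finite_Basis, symmetric] l1_norm_def euclidean_inner[of x \<xi>]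
    by (simp add: sum.distrib sum_negf sum_distrib_left sum_subtractf)
  have fi: "integrable lborel f" unfolding f_def
    by (rule integral_prod_lborel(1)[where f = "\<lambda>b t. exp (- of_real \<bar>t\<bar> + \<i> * of_real ((x \<bullet> b) * t))"])
       (rule fourier_laplace_1d(1))
  have fv: "integral\<^sup>L lborel f = of_real (cauchy_kernel x)" unfolding f_def cauchy_kernel_def
    by (subst integral_prod_lborel(2)[where f = "\<lambda>b t. exp (- of_real \<bar>t\<bar> + \<i> * of_real ((x \<bullet> b) * t))"])
       (simp_all only: fourier_laplace_1d of_real_prod)
  \<comment> \<open>Along the ray through \<omega> the integrand is exp (- c t) with c =
    \<open>l1_norm\<close> \<omega> - i (x \<bullet> \<omega>), so the weight t^(d-1) produces
    (d-1)! / c^d.\<close>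
  have inner: "(\<integral>t. polar_weight TYPE('a) t *\<^sub>R f (t *\<^sub>R \<omega>) \<partial>lborel)
      = of_real (ridge_const TYPE('a)) * (1 / Complex (l1_norm \<omega>) (- (x \<bullet> \<omega>)) ^ DIM('a))"
    if "norm \<omega> = 1" for \<omega> :: 'a
  proof -
    define c where "c = Complex (l1_norm \<omega>) (- (x \<bullet> \<omega>))"
    have c: "0 < Re c" using l1_norm_ge_1[OF that] by (simp add: c_def)
    have c': "c = of_real (l1_norm \<omega>) - \<i> * of_real (x \<bullet> \<omega>)" by (simp add: c_def complex_eq_iff)
    obtain n where n: "DIM('a) = Suc n" using DIM_positive[where 'a='a] gr0_implies_Suc by blast
    have "polar_weight TYPE('a) t *\<^sub>R f (t *\<^sub>R \<omega>) = of_real (DIM('a) * unit_vol TYPE('a)) *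
        (indicator {0<..} t *\<^sub>R (of_real t ^ n * exp (- (c * of_real t))))" for t
    proof (cases "0 < t")
      case True
      hence "f (t *\<^sub>R \<omega>) = exp (- (c * of_real t))"
        unfolding f_eq c' by (simp add: l1_norm_scaleR algebra_simps)
      thus ?thesis using True by (simp add: polar_weight_def n scaleR_conv_of_real mult.assoc)
    qed (simp add: polar_weight_def)
    hence "(\<integral>t. polar_weight TYPE('a) t *\<^sub>R f (t *\<^sub>R \<omega>) \<partial>lborel) = of_real (DIM('a) * unit_vol TYPE('a)) * (fact n / c ^ Suc n)"
      using integral_power_exp[OF c, of n] by (simp only: integral_mult_right_zero)
    thus ?thesis by (simp add: ridge_const_def n c_def)
  qed
  define F where "F \<omega> = of_real (ridge_const TYPE('a)) * (1 / Complex (l1_norm \<omega>) (- (x \<bullet> \<omega>)) ^ DIM('a))" for \<omega> :: 'a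
  have "integrable sphere_measure F \<longleftrightarrow> integrable sphere_measure (\<lambda>\<omega>. \<integral>t. polar_weight TYPE('a) t *\<^sub>R f (t *\<^sub>R \<omega>) \<partial>lborel)"
    by (rule Bochner_Integration.integrable_cong) (simp_all add: inner F_def)
  hence Fi: "integrable sphere_measure F" using integral_polar(1)[OF fi] by blast
  have "integral\<^sup>L sphere_measure F = (\<integral>\<omega>. (\<integral>t. polar_weight TYPE('a) t *\<^sub>R f (t *\<^sub>R \<omega>) \<partial>lborel) \<partial>sphere_measure)"
    by (rule Bochner_Integration.integral_cong) (simp_all add: inner F_def)
  hence "integral\<^sup>L sphere_measure F = of_real (cauchy_kernel x)"
    using integral_polar(2)[OF fi] fv by simp
  \<comment> \<open>The kernel is real, so real parts may be taken inside the sphere integral; this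
    is the origin of \<open>Re\<close> in \<open>ridge\<close>.\<close>
  hence "cauchy_kernel x = Re (integral\<^sup>L sphere_measure F)" by simp
  also have "\<dots> = (\<integral>\<omega>. Re (F \<omega>) \<partial>sphere_measure)" by (rule integral_Re[OF Fi, symmetric])
  also have "\<dots> = dual_radon ridge x"
    unfolding dual_radon_def ridge_def F_def fst_conv snd_conv
    by (simp only: scaleR_conv_of_real[symmetric] scaleR_complex.sel)
  finally show ?thesis ..
qed

section \<open>Size and derivative of the ridge function on the sphere bundle\<close>

lemma norm_Complex_ge:
  assumes "1 \<le> a"
  shows "sqrt (1 + p\<^sup>2) \<le> cmod (Complex a (- p))" "1 \<le> cmod (Complex a (- p))"
proof -
  have "1 \<le> a\<^sup>2" using assms by (simp add: one_le_power)
  thus *: "sqrt (1 + p\<^sup>2) \<le> cmod (Complex a (- p))" by (simp add: cmod_def)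
  have "1 \<le> sqrt (1 + p\<^sup>2)" by simp
  thus "1 \<le> cmod (Complex a (- p))" using * by linarith
qed

lemma ridge_const_pos: "0 < ridge_const TYPE('a::euclidean_space)"
  unfolding ridge_const_def using unit_vol_pos[where 'a='a] by simp

text \<open>All three bounds rest on |l - i p| \<ge> sqrt (1 + p^2) \<ge> 1 and d \<ge> 1. The
  derivative has one more factor in the denominator than the function, which makes it integrable in
  p in every dimension. The alternative \<open>snd z = 0\<close> sets aside the quotient by
  zero.\<close>

lemma ridge_bound:
  assumes "norm (fst z) = 1"
  shows "\<bar>ridge (z :: 'a::euclidean_space \<times> real)\<bar> \<le> ridge_const TYPE('a)"
    "\<bar>ridge z\<bar> \<le> ridge_const TYPE('a) / \<bar>snd z\<bar> \<or> snd z = 0"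
    "\<bar>ridge_deriv z\<bar> \<le> ridge_const TYPE('a) * DIM('a) / (1 + (snd z)\<^sup>2)"
proof -
  define c where "c = Complex (l1_norm (fst z)) (- snd z)"
  have c: "sqrt (1 + (snd z)\<^sup>2) \<le> cmod c" "1 \<le> cmod c"
    unfolding c_def using norm_Complex_ge[OF l1_norm_ge_1[OF assms]] by auto
  have "\<bar>ridge z\<bar> = ridge_const TYPE('a) * \<bar>Re (1 / c ^ DIM('a))\<bar>"
    using ridge_const_pos[where 'a='a] by (simp add: ridge_def c_def abs_mult)
  also have "\<dots> \<le> ridge_const TYPE('a) * cmod (1 / c ^ DIM('a))"
    using ridge_const_pos[where 'a='a] by (intro mult_left_mono abs_Re_le_cmod) simp
  finally have 1: "\<bar>ridge z\<bar> \<le> ridge_const TYPE('a) / cmod c ^ DIM('a)"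
    by (simp add: norm_divide norm_power)
  have 2: "cmod c \<le> cmod c ^ DIM('a)" using power_increasing[of 1 "DIM('a)" "cmod c"] c(2) by (simp add: Suc_leI)
  have "ridge_const TYPE('a) / cmod c ^ DIM('a) \<le> ridge_const TYPE('a) / 1"
    using 2 c(2) ridge_const_pos[where 'a='a] by (intro divide_left_mono) auto
  thus "\<bar>ridge z\<bar> \<le> ridge_const TYPE('a)" using 1 by simp
  have "\<bar>snd z\<bar> \<le> sqrt (1 + (snd z)\<^sup>2)" by (rule real_le_rsqrt) simp
  hence "\<bar>snd z\<bar> \<le> cmod c ^ DIM('a)" using 2 c(1) by linarith
  hence "ridge_const TYPE('a) / cmod c ^ DIM('a) \<le> ridge_const TYPE('a) / \<bar>snd z\<bar>" if "snd z \<noteq> 0"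
    using that c(2) ridge_const_pos[where 'a='a] by (intro divide_left_mono) auto
  thus "\<bar>ridge z\<bar> \<le> ridge_const TYPE('a) / \<bar>snd z\<bar> \<or> snd z = 0" using 1 by force
  have "\<bar>ridge_deriv z\<bar> = ridge_const TYPE('a) * \<bar>Re (\<i> * of_nat DIM('a) / c ^ Suc DIM('a))\<bar>"
    using ridge_const_pos[where 'a='a] by (simp only: ridge_deriv_def c_def abs_mult abs_of_pos)
  also have "\<dots> \<le> ridge_const TYPE('a) * cmod (\<i> * of_nat DIM('a) / c ^ Suc DIM('a))"
    using ridge_const_pos[where 'a='a] by (intro mult_left_mono abs_Re_le_cmod) simp
  also have "\<dots> = ridge_const TYPE('a) * DIM('a) / cmod c ^ Suc DIM('a)"
    by (simp add: norm_divide norm_power norm_mult)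
  also have "\<dots> \<le> ridge_const TYPE('a) * DIM('a) / (1 + (snd z)\<^sup>2)"
  proof (rule divide_left_mono)
    have "1 + (snd z)\<^sup>2 = (sqrt (1 + (snd z)\<^sup>2))\<^sup>2" by simp
    also have "\<dots> \<le> (cmod c)\<^sup>2" using c(1) by (intro power_mono) auto
    also have "\<dots> \<le> cmod c ^ Suc DIM('a)"
      using c(2) DIM_positive[where 'a='a] by (intro power_increasing) auto
    finally show "1 + (snd z)\<^sup>2 \<le> cmod c ^ Suc DIM('a)" .
    have "0 < cmod c" using c(2) by linarith
    thus "0 < cmod c ^ Suc DIM('a) * (1 + (snd z)\<^sup>2)" by (simp add: add_pos_nonneg)
  qed (use ridge_const_pos[where 'a='a] in simp)
  finally show "\<bar>ridge_deriv z\<bar> \<le> ridge_const TYPE('a) * DIM('a) / (1 + (snd z)\<^sup>2)" .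
qed

text \<open>The power of l - i w is differentiated as a holomorphic function of w, restricted to
  real w, and projected by the bounded linear map \<open>Re\<close>.\<close>

lemma ridge_has_derivative:
  assumes "norm \<omega> = 1"
  shows "((\<lambda>p. ridge (\<omega>, p)) has_real_derivative ridge_deriv (\<omega> :: 'a::euclidean_space, p)) (at p)"
proof -
  let ?l = "l1_norm \<omega>" and ?d = "DIM('a)"
  define h where "h w = 1 / (of_real ?l - \<i> * w) ^ ?d" for w
  have e: "of_real ?l - \<i> * of_real q = Complex ?l (- q)" for q by (simp add: complex_eq_iff)
  have nz: "of_real ?l - \<i> * of_real q \<noteq> 0" for q
    using norm_Complex_ge(2)[OF l1_norm_ge_1[OF assms], of q] unfolding e by force
  obtain n where n: "?d = Suc n" using DIM_positive[where 'a='a] gr0_implies_Suc by blast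
  have "(h has_field_derivative (\<i> * of_nat ?d / (of_real ?l - \<i> * of_real p) ^ Suc ?d)) (at (of_real p))"
  proof -
    have "((\<lambda>w. inverse ((of_real ?l - \<i> * w) ^ Suc n)) has_field_derivative
       - ((1 + of_nat n) * (- \<i> * (of_real ?l - \<i> * of_real p) ^ n) *
          inverse (((of_real ?l - \<i> * of_real p) ^ Suc n) ^ Suc (Suc 0)))) (at (of_real p))"
      by (intro DERIV_inverse_fun DERIV_power_Suc) (use nz in \<open>auto intro!: derivative_eq_intros\<close>)
    also have "- ((1 + of_nat n) * (- \<i> * (of_real ?l - \<i> * of_real p) ^ n) *
          inverse (((of_real ?l - \<i> * of_real p) ^ Suc n) ^ Suc (Suc 0)))
       = \<i> * of_nat ?d / (of_real ?l - \<i> * of_real p) ^ Suc ?d"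
    proof -
      have "- ((1 + of_nat n) * (- \<i> * w ^ n) * inverse ((w ^ Suc n) ^ Suc (Suc 0))) = \<i> * of_nat (Suc n) / w ^ Suc (Suc n)"
        if "w \<noteq> 0" for w :: complex
        using that by (simp add: field_simps)
      thus ?thesis using nz[of p] unfolding n .
    qed
    finally show ?thesis unfolding h_def n by (simp add: inverse_eq_divide)
  qed
  hence "((\<lambda>q. h (of_real q)) has_vector_derivative (\<i> * of_nat ?d / Complex ?l (- p) ^ Suc ?d)) (at p)"
    unfolding e by (rule has_vector_derivative_real_field)
  hence "((\<lambda>q. Re (h (of_real q))) has_vector_derivative Re (\<i> * of_nat ?d / Complex ?l (- p) ^ Suc ?d)) (at p)"
    by (rule bounded_linear.has_vector_derivative[OF bounded_linear_Re])
  hence "((\<lambda>q. Re (1 / Complex ?l (- q) ^ ?d)) has_real_derivative Re (\<i> * of_nat ?d / Complex ?l (- p) ^ Suc ?d)) (at p)"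
    unfolding h_def e has_real_derivative_iff_has_vector_derivative .
  thus ?thesis unfolding ridge_def ridge_deriv_def fst_conv snd_conv by (rule DERIV_cmult)
qed

lemma continuous_ridge:
  "continuous_on {z :: 'a::euclidean_space \<times> real. norm (fst z) = 1} ridge"
  "continuous_on {z :: 'a \<times> real. norm (fst z) = 1} ridge_deriv"
proof -
  have "Complex (l1_norm (fst z)) (- snd z) \<noteq> 0" if "norm (fst z) = 1" for z :: "'a \<times> real"
    using norm_Complex_ge(2)[OF l1_norm_ge_1[OF that], of "snd z"] by force
  thus "continuous_on {z :: 'a \<times> real. norm (fst z) = 1} ridge"
    "continuous_on {z :: 'a \<times> real. norm (fst z) = 1} ridge_deriv"
    unfolding ridge_def ridge_deriv_def by (auto intro!: continuous_intros simp del: power_Suc)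
qed

lemma tendsto_ridge:
  assumes "norm \<omega> = 1"
  shows "((\<lambda>p. ridge (\<omega> :: 'a::euclidean_space, p)) \<longlongrightarrow> 0) at_top"
proof (rule Lim_null_comparison)
  show "eventually (\<lambda>p. norm (ridge (\<omega>, p)) \<le> ridge_const TYPE('a) / p) at_top"
    using eventually_gt_at_top[of 0]
  proof eventually_elim
    case (elim p)
    thus ?case using ridge_bound(2)[of "(\<omega>, p)"] assms by simp
  qed
  show "((\<lambda>p. ridge_const TYPE('a) / p) \<longlongrightarrow> 0) at_top"
    by (intro tendsto_divide_0[OF tendsto_const] filterlim_at_top_imp_at_infinity filterlim_ident)
qed

section \<open>Integration by parts against half-space masses\<close>

lemma integrable_inverse_square_sphere:
  "integrable (sphere_measure \<Otimes>\<^sub>M lborel) (\<lambda>z :: 'a::euclidean_space \<times> real. K / (1 + (snd z)\<^sup>2))"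
proof -
  have m: "(\<lambda>z :: 'a \<times> real. K / (1 + (snd z)\<^sup>2)) \<in> borel_measurable (sphere_measure \<Otimes>\<^sub>M lborel)"
    by (rule measurable_pair_sphere) measurable
  have i: "integrable lborel (\<lambda>p. K / (1 + p\<^sup>2))"
    using integrable_mult_right[OF integrable_inverse_1_plus_square, of K] by simp
  show ?thesis
  proof (rule sphere_line.Fubini_integrable[OF m])
    show "AE x in sphere_measure. integrable lborel (\<lambda>y. K / (1 + (snd (x :: 'a, y))\<^sup>2))"
      using i by simp
    show "integrable sphere_measure (\<lambda>x :: 'a. \<integral>y. norm (K / (1 + (snd (x, y))\<^sup>2)) \<partial>lborel)"
      by simp
  qed
qed

text \<open>All half-spaces are sections of a single open set in the product of parameters and
  points, so their masses depend measurably on the parameters.\<close>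

lemma borel_measurable_halfspace_measure:
  fixes M :: "'a::euclidean_space measure"
  assumes "finite_measure M" "sets M = sets borel"
  shows "(\<lambda>z. measure M (halfspace (fst z) (snd z))) \<in> borel_measurable (sphere_measure \<Otimes>\<^sub>M lborel)"
proof (rule measurable_pair_sphere)
  interpret finite_measure M by fact
  let ?Q = "{w :: ('a \<times> real) \<times> 'a. snd w \<bullet> fst (fst w) < snd (fst w)}"
  have "open ?Q" by (intro open_Collect_less continuous_intros)
  hence "?Q \<in> sets ((borel \<Otimes>\<^sub>M borel) \<Otimes>\<^sub>M borel)" unfolding borel_prod by (rule borel_open)
  moreover have "sets ((borel \<Otimes>\<^sub>M borel) \<Otimes>\<^sub>M M) = sets (((borel :: 'a measure) \<Otimes>\<^sub>M (borel :: real measure)) \<Otimes>\<^sub>M (borel :: 'a measure))"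
    by (rule sets_pair_measure_cong[OF refl assms(2)])
  ultimately have "?Q \<in> sets ((borel \<Otimes>\<^sub>M borel) \<Otimes>\<^sub>M M)" by blast
  from measurable_emeasure_Pair[OF this]
  have "(\<lambda>z. emeasure M (Pair z -` ?Q)) \<in> borel_measurable (borel \<Otimes>\<^sub>M borel)" .
  moreover have "Pair z -` ?Q = halfspace (fst z) (snd z)" for z by (auto simp: halfspace_def)
  ultimately have "(\<lambda>z. emeasure M (halfspace (fst z) (snd z))) \<in> borel_measurable (borel \<Otimes>\<^sub>M borel)" by simp
  thus "(\<lambda>z. measure M (halfspace (fst z) (snd z))) \<in> borel_measurable (borel \<Otimes>\<^sub>M borel)"
    unfolding measure_def by (rule borel_measurable_enn2real)
qed

text \<open>The decay rate of \<open>\<psi>'\<close>, the derivative of \<open>\<psi>\<close> in \<open>p\<close>, admits both the smooth compactly supported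
  functions and \<open>ridge\<close>.\<close>
definition radon_test :: "('a::euclidean_space \<times> real \<Rightarrow> real) \<Rightarrow> ('a \<times> real \<Rightarrow> real) \<Rightarrow> bool" where
  "radon_test \<psi> \<psi>' \<longleftrightarrow>
     \<psi>' \<in> borel_measurable (sphere_measure \<Otimes>\<^sub>M lborel) \<and>
     (\<exists>K. \<forall>\<omega> p. norm \<omega> = 1 \<longrightarrow> \<bar>\<psi>' (\<omega>, p)\<bar> \<le> K / (1 + p\<^sup>2)) \<and>
     (\<forall>\<omega>. norm \<omega> = 1 \<longrightarrow>
        (\<forall>p. ((\<lambda>p. \<psi> (\<omega>, p)) has_real_derivative \<psi>' (\<omega>, p)) (at p) \<and> isCont (\<lambda>p. \<psi>' (\<omega>, p)) p) \<and>
        ((\<lambda>p. \<psi> (\<omega>, p)) \<longlongrightarrow> 0) at_top)"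

lemma radon_test_integrable:
  assumes "radon_test \<psi> \<psi>'"
  shows "integrable (sphere_measure \<Otimes>\<^sub>M lborel) (\<psi>' :: 'a::euclidean_space \<times> real \<Rightarrow> real)"
proof -
  obtain K where K: "\<And>\<omega> p. norm \<omega> = 1 \<Longrightarrow> \<bar>\<psi>' (\<omega>, p)\<bar> \<le> K / (1 + p\<^sup>2)"
    using assms unfolding radon_test_def by blast
  show ?thesis
  proof (rule Bochner_Integration.integrable_bound[OF integrable_inverse_square_sphere[of K]])
    show "\<psi>' \<in> borel_measurable (sphere_measure \<Otimes>\<^sub>M lborel)" using assms by (simp add: radon_test_def)
    show "AE z in sphere_measure \<Otimes>\<^sub>M lborel. norm (\<psi>' z) \<le> norm (K / (1 + (snd z)\<^sup>2))"
    proof (rule AE_I2)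
      fix z :: "'a \<times> real" assume "z \<in> space (sphere_measure \<Otimes>\<^sub>M lborel)"
      hence "norm (fst z) = 1" by (auto simp: space_pair_measure)
      from order_trans[OF K[OF this, of "snd z"] abs_ge_self]
      show "norm (\<psi>' z) \<le> norm (K / (1 + (snd z)\<^sup>2))" by (simp only: real_norm_def prod.collapse)
    qed
  qed
qed

text \<open>The boundary term at infinity vanishes by the limit condition in
  \<open>radon_test\<close>.\<close>

lemma radon_test_FTC:
  assumes "radon_test \<psi> \<psi>'" "norm \<omega> = 1"
  shows "\<psi> (\<omega>, q) = - (\<integral>p. indicator {q<..} p * \<psi>' (\<omega>, p) \<partial>lborel)"
proof -
  obtain K where K: "\<And>p. \<bar>\<psi>' (\<omega>, p)\<bar> \<le> K / (1 + p\<^sup>2)"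
    using assms unfolding radon_test_def by blast
  have D: "((\<lambda>p. \<psi> (\<omega>, p)) has_real_derivative \<psi>' (\<omega>, p)) (at p)" and C: "isCont (\<lambda>p. \<psi>' (\<omega>, p)) p"
    and L: "((\<lambda>p. \<psi> (\<omega>, p)) \<longlongrightarrow> 0) at_top" for p
    using assms unfolding radon_test_def by blast+
  have m: "(\<lambda>p. \<psi>' (\<omega>, p)) \<in> borel_measurable borel"
    using C by (intro borel_measurable_continuous_onI continuous_at_imp_continuous_on) simp
  have i: "integrable lborel (\<lambda>p. \<psi>' (\<omega>, p))"
    using integrable_mult_right[OF integrable_inverse_1_plus_square, of K]
    by (rule Bochner_Integration.integrable_bound) (use m K order_trans[OF K abs_ge_self] in auto)
  have e: "einterval (ereal q) \<infinity> = {q<..}" by (auto simp: einterval_def)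
  have "(LBINT p=ereal q..\<infinity>. \<psi>' (\<omega>, p)) = 0 - \<psi> (\<omega>, q)"
  proof (rule interval_integral_FTC_integrable[where F = "\<lambda>p. \<psi> (\<omega>, p)"])
    show "((\<lambda>p. \<psi> (\<omega>, p)) has_vector_derivative \<psi>' (\<omega>, p)) (at p)" for p
      using D by (simp add: has_real_derivative_iff_has_vector_derivative)
    show "set_integrable lborel (einterval (ereal q) \<infinity>) (\<lambda>p. \<psi>' (\<omega>, p))"
      unfolding e set_integrable_def
      by (rule Bochner_Integration.integrable_bound[OF i]) (use m in \<open>auto simp: indicator_def\<close>)
    have "isCont (\<lambda>p. \<psi> (\<omega>, p)) q" using D DERIV_isCont by blast
    hence "((\<lambda>p. \<psi> (\<omega>, p)) \<longlongrightarrow> \<psi> (\<omega>, q)) (at_right q)" by (simp add: isCont_def filterlim_at_split)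
    thus "(((\<lambda>p. \<psi> (\<omega>, p)) \<circ> real_of_ereal) \<longlongrightarrow> \<psi> (\<omega>, q)) (at_right (ereal q))"
      by (simp add: ereal_tendsto_simps)
    show "(((\<lambda>p. \<psi> (\<omega>, p)) \<circ> real_of_ereal) \<longlongrightarrow> 0) (at_left \<infinity>)"
      using L by (simp add: ereal_tendsto_simps)
  qed (use C in auto)
  thus ?thesis by (simp add: interval_lebesgue_integral_def e set_lebesgue_integral_def)
qed

text \<open>Integration by parts in the form of Fubini: \<psi> (\<omega>, x \<bullet> \<omega>) is
  minus the integral of \<psi>' over p > x \<bullet> \<omega>. That condition says that x lies in
  \<open>halfspace\<close> \<omega> p, so integrating over x first leaves the mass of the
  half-space.\<close>

theorem integral_dual_radon:
  fixes M :: "'a::euclidean_space measure"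
  assumes M: "finite_measure M" "sets M = sets borel" and t: "radon_test \<psi> \<psi>'"
  shows "integral\<^sup>L M (dual_radon \<psi>) =
     - (\<integral>z. measure M (halfspace (fst z) (snd z)) * \<psi>' z \<partial>(sphere_measure \<Otimes>\<^sub>M lborel))"
proof -
  let ?S = "sphere_measure \<Otimes>\<^sub>M lborel :: ('a \<times> real) measure"
  interpret finite_measure M by fact
  interpret P: pair_sigma_finite M ?S by standard
  have sp: "space M = UNIV" using sets_eq_imp_space_eq[OF M(2)] by simp
  have \<psi>'m: "\<psi>' \<in> borel_measurable ?S" and \<psi>'i: "integrable ?S \<psi>'"
    using t radon_test_integrable[OF t] by (auto simp: radon_test_def)
  define h where "h x z = indicator (halfspace (fst z) (snd z)) x * \<psi>' z" for x and z :: "'a \<times> real"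
  have fst_m: "(\<lambda>w. fst (snd w)) \<in> borel_measurable (M \<Otimes>\<^sub>M ?S)"
    by (rule measurable_compose[OF measurable_compose[OF measurable_snd measurable_fst] id_measurable_sphere])
  have snd_m: "(\<lambda>w. snd (snd w)) \<in> borel_measurable (M \<Otimes>\<^sub>M ?S)"
    using measurable_compose[OF measurable_snd measurable_snd] by (simp add: measurable_lborel1)
  have x_m: "fst \<in> borel_measurable (M \<Otimes>\<^sub>M ?S)"
    using measurable_fst[of M ?S] measurable_cong_sets[OF refl M(2)] by blast
  have "{w \<in> space (M \<Otimes>\<^sub>M ?S). fst w \<bullet> fst (snd w) < snd (snd w)} \<in> sets (M \<Otimes>\<^sub>M ?S)"
    by (intro borel_measurable_less borel_measurable_inner fst_m snd_m x_m)
  hence "(\<lambda>w. indicator {w \<in> space (M \<Otimes>\<^sub>M ?S). fst w \<bullet> fst (snd w) < snd (snd w)} w * \<psi>' (snd w)) \<in> borel_measurable (M \<Otimes>\<^sub>M ?S)"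
    by (intro borel_measurable_times borel_measurable_indicator measurable_compose[OF measurable_snd \<psi>'m])
  hence hm: "case_prod h \<in> borel_measurable (M \<Otimes>\<^sub>M ?S)"
    by (rule measurable_cong[THEN iffD1, rotated]) (auto simp: h_def halfspace_def indicator_def space_pair_measure)
  have hi: "integrable (M \<Otimes>\<^sub>M ?S) (case_prod h)"
  proof (rule Bochner_Integration.integrable_bound[OF _ hm])
    show "integrable (M \<Otimes>\<^sub>M ?S) (\<lambda>w. \<psi>' (snd w))"
    proof (rule P.Fubini_integrable)
      show "(\<lambda>w. \<psi>' (snd w)) \<in> borel_measurable (M \<Otimes>\<^sub>M ?S)" by (rule measurable_compose[OF measurable_snd \<psi>'m])
    qed (use \<psi>'i in simp_all)
    show "AE w in M \<Otimes>\<^sub>M ?S. norm (case_prod h w) \<le> norm (\<psi>' (snd w))"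
      by (rule AE_I2) (auto simp: h_def indicator_def)
  qed
  have inner: "(\<integral>z. h x z \<partial>?S) = - dual_radon \<psi> x" for x
  proof -
    have i: "integrable ?S (h x)"
    proof (rule Bochner_Integration.integrable_bound[OF \<psi>'i])
      have "x \<in> space M" using sp by simp
      from measurable_Pair2[OF hm this] show "h x \<in> borel_measurable ?S" by simp
    qed (auto simp: h_def indicator_def)
    have "(\<integral>z. h x z \<partial>?S) = (\<integral>\<omega>. (\<integral>p. h x (\<omega>, p) \<partial>lborel) \<partial>sphere_measure)"
      using sphere_line.integral_fst'[OF i] by simp
    also have "\<dots> = (\<integral>\<omega>. - \<psi> (\<omega>, x \<bullet> \<omega>) \<partial>sphere_measure)"
    proof (rule Bochner_Integration.integral_cong[OF refl])
      fix \<omega> :: 'a assume "\<omega> \<in> space sphere_measure"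
      hence "norm \<omega> = 1" by simp
      from radon_test_FTC[OF t this, of "x \<bullet> \<omega>"]
      show "(\<integral>p. h x (\<omega>, p) \<partial>lborel) = - \<psi> (\<omega>, x \<bullet> \<omega>)"
        by (simp add: h_def halfspace_def indicator_def)
    qed
    also have "\<dots> = - dual_radon \<psi> x" by (simp add: dual_radon_def)
    finally show ?thesis .
  qed
  have "- integral\<^sup>L M (dual_radon \<psi>) = (\<integral>x. (\<integral>z. h x z \<partial>?S) \<partial>M)" by (simp add: inner)
  also have "\<dots> = (\<integral>z. (\<integral>x. h x z \<partial>M) \<partial>?S)" by (rule P.Fubini_integral[OF hi, symmetric])
  also have "\<dots> = (\<integral>z. measure M (halfspace (fst z) (snd z)) * \<psi>' z \<partial>?S)"
  proof (rule Bochner_Integration.integral_cong[OF refl])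
    fix z :: "'a \<times> real"
    have "(\<integral>x. h x z \<partial>M) = (\<integral>x. indicator (halfspace (fst z) (snd z)) x \<partial>M) * \<psi>' z"
      unfolding h_def by (rule integral_mult_left_zero)
    also have "(\<integral>x. indicator (halfspace (fst z) (snd z)) x \<partial>M) = measure M (halfspace (fst z) (snd z))"
      using sp by simp
    finally show "(\<integral>x. h x z \<partial>M) = measure M (halfspace (fst z) (snd z)) * \<psi>' z" .
  qed
  finally show ?thesis by simp
qed

text \<open>Makes a limit that is prescribed only almost everywhere accessible to integration: the
  completion absorbs the null set on which it differs from a measurable function.\<close>

lemma measurable_completion_AE:
  fixes f g :: "'b \<Rightarrow> real"
  assumes f: "f \<in> borel_measurable M" and ae: "AE x in M. f x = g x"
  shows "g \<in> borel_measurable (completion M)"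
proof (rule measurableI)
  fix A :: "real set" assume A: "A \<in> sets borel"
  show "g -` A \<inter> space (completion M) \<in> sets (completion M)"
  proof (rule completion.in_sets_AE)
    show "f -` A \<inter> space M \<in> sets (completion M)" using measurable_sets[OF f A] by auto
    have "AE x in M. x \<in> f -` A \<inter> space M \<longleftrightarrow> x \<in> g -` A \<inter> space (completion M)"
      using ae by eventually_elim (simp add: space_completion)
    thus "AE x in completion M. x \<in> f -` A \<inter> space M \<longleftrightarrow> x \<in> g -` A \<inter> space (completion M)"
      by (rule AE_completion)
  qed simp
qed simp

lemma signed_measure_halfspace_measurable:
  assumes "signed_measure \<nu>"
  shows "(\<lambda>z. \<nu> (halfspace (fst z) (snd z))) \<in> borel_measurable (sphere_measure \<Otimes>\<^sub>M lborel)"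
proof -
  have "(\<lambda>z. measure (pos_variation \<nu>) (halfspace (fst z) (snd z)) - measure (neg_variation \<nu>) (halfspace (fst z) (snd z)))
      \<in> borel_measurable (sphere_measure \<Otimes>\<^sub>M lborel)"
    by (rule borel_measurable_diff[OF
          borel_measurable_halfspace_measure[OF finite_pos_variation[OF assms] sets_pos_variation]
          borel_measurable_halfspace_measure[OF finite_neg_variation[OF assms] sets_neg_variation]])
  thus ?thesis by (simp only: signed_measure_decomp[OF assms, symmetric])
qed

lemma abs_signed_measure_le:
  assumes "signed_measure \<nu>"
  shows "\<bar>\<nu> A\<bar> \<le> total_variation \<nu>"
proof -
  have "measure (pos_variation \<nu>) A \<le> measure (pos_variation \<nu>) UNIV"
    using finite_measure.bounded_measure[OF finite_pos_variation[OF assms]] by (metis space_pos_variation)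
  moreover have "measure (neg_variation \<nu>) A \<le> measure (neg_variation \<nu>) UNIV"
    using finite_measure.bounded_measure[OF finite_neg_variation[OF assms]] by (metis space_neg_variation)
  moreover have "0 \<le> measure (pos_variation \<nu>) A" "0 \<le> measure (neg_variation \<nu>) A" by simp_all
  ultimately show ?thesis using total_variation_eq[OF assms] signed_measure_decomp[OF assms, of A]
    by linarith
qed

lemma integrable_halfspace_mult:
  assumes "signed_measure \<nu>" "integrable (sphere_measure \<Otimes>\<^sub>M lborel) g"
  shows "integrable (sphere_measure \<Otimes>\<^sub>M lborel) (\<lambda>z. \<nu> (halfspace (fst z) (snd z)) * (g z :: real))"
proof (rule Bochner_Integration.integrable_bound)
  show "integrable (sphere_measure \<Otimes>\<^sub>M lborel) (\<lambda>z. total_variation \<nu> * g z)"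
    by (rule integrable_mult_right[OF assms(2)])
  show "(\<lambda>z. \<nu> (halfspace (fst z) (snd z)) * g z) \<in> borel_measurable (sphere_measure \<Otimes>\<^sub>M lborel)"
    by (intro borel_measurable_times signed_measure_halfspace_measurable[OF assms(1)] borel_measurable_integrable[OF assms(2)])
  show "AE z in sphere_measure \<Otimes>\<^sub>M lborel. norm (\<nu> (halfspace (fst z) (snd z)) * g z) \<le> norm (total_variation \<nu> * g z)"
  proof (rule AE_I2)
    fix z
    have "\<bar>\<nu> (halfspace (fst z) (snd z))\<bar> \<le> \<bar>total_variation \<nu>\<bar>"
      using abs_signed_measure_le[OF assms(1)] order_trans abs_ge_self by blast
    thus "norm (\<nu> (halfspace (fst z) (snd z)) * g z) \<le> norm (total_variation \<nu> * g z)"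
      by (simp add: abs_mult mult_right_mono)
  qed
qed

lemma signed_integral_dual_radon:
  assumes sm: "signed_measure \<nu>" and t: "radon_test \<psi> \<psi>'"
  shows "signed_integral \<nu> (dual_radon \<psi>) =
     - (\<integral>z. \<nu> (halfspace (fst z) (snd z)) * \<psi>' z \<partial>(sphere_measure \<Otimes>\<^sub>M lborel))"
proof -
  note p = finite_pos_variation[OF sm] sets_pos_variation
  note n = finite_neg_variation[OF sm] sets_neg_variation
  note i = radon_test_integrable[OF t]
  have im: "integrable (sphere_measure \<Otimes>\<^sub>M lborel) (\<lambda>z. measure M (halfspace (fst z) (snd z)) * \<psi>' z)"
    if M: "finite_measure M" "sets M = sets borel" for M
  proof -
    \<comment> \<open>Subtracting the null measure presents M as a signed measure, so that
      \<open>integrable_halfspace_mult\<close> covers it.\<close>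
    have "signed_measure (\<lambda>A. measure M A - measure (null_measure borel) A)"
      by (rule signed_measure_diff_measure) (use M in \<open>auto intro!: finite_measureI\<close>)
    hence "signed_measure (\<lambda>A. measure M A)" by (simp add: measure_def)
    from integrable_halfspace_mult[OF this i] show ?thesis .
  qed
  have "(\<integral>z. \<nu> (halfspace (fst z) (snd z)) * \<psi>' z \<partial>(sphere_measure \<Otimes>\<^sub>M lborel)) =
    (\<integral>z. measure (pos_variation \<nu>) (halfspace (fst z) (snd z)) * \<psi>' z
        - measure (neg_variation \<nu>) (halfspace (fst z) (snd z)) * \<psi>' z \<partial>(sphere_measure \<Otimes>\<^sub>M lborel))"
    by (simp only: signed_measure_decomp[OF sm, symmetric] left_diff_distrib[symmetric])
  also have "\<dots> = (\<integral>z. measure (pos_variation \<nu>) (halfspace (fst z) (snd z)) * \<psi>' z \<partial>(sphere_measure \<Otimes>\<^sub>M lborel))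
        - (\<integral>z. measure (neg_variation \<nu>) (halfspace (fst z) (snd z)) * \<psi>' z \<partial>(sphere_measure \<Otimes>\<^sub>M lborel))"
    by (rule Bochner_Integration.integral_diff[OF im[OF p] im[OF n]])
  finally show ?thesis
    unfolding signed_integral_def integral_dual_radon[OF p t] integral_dual_radon[OF n t] by simp
qed

text \<open>Half-space masses are at most C in modulus and converge almost everywhere, so dominated
  convergence with |C| * |\<psi>'| applies to the half-space formula.\<close>

theorem signed_integral_dual_radon_limit:
  fixes \<mu>s :: "nat \<Rightarrow> 'a::euclidean_space set \<Rightarrow> real"
  assumes sm: "\<And>k. signed_measure (\<mu>s k)" and bdd: "\<And>k. total_variation (\<mu>s k) \<le> C"
    and lim: "AE z in sphere_measure \<Otimes>\<^sub>M lborel. (\<lambda>k. \<mu>s k (halfspace (fst z) (snd z))) \<longlonglongrightarrow> a z"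
    and t: "radon_test \<psi> \<psi>'"
  shows "(\<lambda>k. signed_integral (\<mu>s k) (dual_radon \<psi>)) \<longlonglongrightarrow>
     - integral\<^sup>L (completion (sphere_measure \<Otimes>\<^sub>M lborel)) (\<lambda>z. a z * \<psi>' z)"
proof -
  let ?S = "sphere_measure \<Otimes>\<^sub>M lborel :: ('a \<times> real) measure"
  note i = radon_test_integrable[OF t]
  have m: "(\<lambda>z. \<mu>s k (halfspace (fst z) (snd z)) * \<psi>' z) \<in> borel_measurable ?S" for k
    by (intro borel_measurable_times signed_measure_halfspace_measurable[OF sm] borel_measurable_integrable[OF i])
  \<comment> \<open>The pointwise \<open>lim\<close> of the masses is measurable and agrees with a
    almost everywhere.\<close>
  have "(\<lambda>z. lim (\<lambda>k. \<mu>s k (halfspace (fst z) (snd z)))) \<in> borel_measurable ?S"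
    by (rule borel_measurable_lim_metric) (rule signed_measure_halfspace_measurable[OF sm])
  moreover have "AE z in ?S. lim (\<lambda>k. \<mu>s k (halfspace (fst z) (snd z))) = a z"
    using lim by eventually_elim (rule limI)
  ultimately have am: "a \<in> borel_measurable (completion ?S)" by (rule measurable_completion_AE)
  have "(\<lambda>k. integral\<^sup>L (completion ?S) (\<lambda>z. \<mu>s k (halfspace (fst z) (snd z)) * \<psi>' z))
     \<longlonglongrightarrow> integral\<^sup>L (completion ?S) (\<lambda>z. a z * \<psi>' z)"
  proof (rule integral_dominated_convergence[where w = "\<lambda>z. \<bar>C\<bar> * \<bar>\<psi>' z\<bar>"])
    show "(\<lambda>z. a z * \<psi>' z) \<in> borel_measurable (completion ?S)"
      by (intro borel_measurable_times am measurable_completion borel_measurable_integrable[OF i])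
    show "(\<lambda>z. \<mu>s k (halfspace (fst z) (snd z)) * \<psi>' z) \<in> borel_measurable (completion ?S)" for k
      by (rule measurable_completion[OF m])
    have "integrable ?S (\<lambda>z. \<bar>C\<bar> * \<bar>\<psi>' z\<bar>)" by (intro integrable_mult_right integrable_abs i)
    thus "integrable (completion ?S) (\<lambda>z. \<bar>C\<bar> * \<bar>\<psi>' z\<bar>)"
      using integrable_completion[OF borel_measurable_integrable] by blast
    show "AE z in completion ?S. (\<lambda>k. \<mu>s k (halfspace (fst z) (snd z)) * \<psi>' z) \<longlonglongrightarrow> a z * \<psi>' z"
      by (rule AE_completion) (use lim in eventually_elim, rule tendsto_mult_right)
    show "AE z in completion ?S. norm (\<mu>s k (halfspace (fst z) (snd z)) * \<psi>' z) \<le> \<bar>C\<bar> * \<bar>\<psi>' z\<bar>" for k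
    proof (rule AE_I2)
      fix z
      have "\<bar>\<mu>s k (halfspace (fst z) (snd z))\<bar> \<le> \<bar>C\<bar>"
        using abs_signed_measure_le[OF sm, of k "halfspace (fst z) (snd z)"] bdd[of k] by linarith
      thus "norm (\<mu>s k (halfspace (fst z) (snd z)) * \<psi>' z) \<le> \<bar>C\<bar> * \<bar>\<psi>' z\<bar>"
        by (simp add: abs_mult mult_right_mono)
    qed
  qed
  hence "(\<lambda>k. - integral\<^sup>L (completion ?S) (\<lambda>z. \<mu>s k (halfspace (fst z) (snd z)) * \<psi>' z))
     \<longlonglongrightarrow> - integral\<^sup>L (completion ?S) (\<lambda>z. a z * \<psi>' z)" by (rule tendsto_minus)
  thus ?thesis unfolding signed_integral_dual_radon[OF sm t] integral_completion[OF m] .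
qed

section \<open>Test functions\<close>

text \<open>The polynomial factor makes this class of functions closed under differentiation.\<close>
definition flat :: "real poly \<Rightarrow> real \<Rightarrow> real" where
  "flat p t = (if 0 < t then poly p (1 / t) * exp (- (1 / t)) else 0)"

lemma poly_exp_tendsto_0: "((\<lambda>y. poly p y * exp (- y)) \<longlongrightarrow> (0::real)) at_top"
proof (induction p)
  case (pCons a p)
  have m: "((\<lambda>y::real. y * (poly p y * exp (- y))) \<longlongrightarrow> 0) at_top"
  proof -
    have "((\<lambda>y::real. \<Sum>i\<le>degree p. coeff p i * (y ^ Suc i / exp y)) \<longlongrightarrow> 0) at_top"
      by (intro tendsto_null_sum tendsto_mult_right_zero tendsto_power_div_exp_0)
    thus ?thesis by (simp add: poly_altdef sum_distrib_left sum_distrib_right exp_minus field_simps)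
  qed
  have "((\<lambda>y::real. a * exp (- y)) \<longlongrightarrow> 0) at_top"
    by (intro tendsto_mult_right_zero filterlim_compose[OF exp_at_bot] filterlim_uminus_at_bot_at_top)
  from tendsto_add[OF this m] show ?case by (simp add: algebra_simps)
qed simp

text \<open>For t > 0 the chain rule gives t^(-2) times p - p' evaluated at 1/t, times exp (- 1/t);
  \<open>[:0, 0, 1:]\<close> is the polynomial X^2 for the first factor. At 0 the right difference
  quotient is y * p(y) * exp (- y) with y = 1/t tending to infinity, so the derivative there is
  0.\<close>

lemma flat_has_derivative:
  "(flat p has_real_derivative flat ([:0, 0, 1:] * (p - pderiv p)) t) (at t)"
proof (cases t "0 :: real" rule: linorder_cases)
  case less
  have "((\<lambda>_. 0) has_real_derivative 0) (at t)" by simp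
  moreover have "eventually (\<lambda>x. x \<in> {..<0}) (nhds t)" using less by (intro eventually_nhds_in_open) auto
  hence "eventually (\<lambda>x. flat p x = 0) (nhds t)" by eventually_elim (simp add: flat_def)
  ultimately show ?thesis using less by (subst DERIV_cong_ev[OF refl _ refl]) (auto simp: flat_def)
next
  case greater
  have "((\<lambda>t. poly p (1 / t) * exp (- (1 / t))) has_real_derivative
      flat ([:0, 0, 1:] * (p - pderiv p)) t) (at t)"
    using greater by (auto intro!: derivative_eq_intros DERIV_chain'[OF _ poly_DERIV] simp: flat_def field_simps power2_eq_square)
  moreover have "eventually (\<lambda>x. x \<in> {0<..}) (nhds t)" using greater by (intro eventually_nhds_in_open) auto
  hence "eventually (\<lambda>x. flat p x = poly p (1 / x) * exp (- (1 / x))) (nhds t)"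
    by eventually_elim (simp add: flat_def)
  ultimately show ?thesis by (subst DERIV_cong_ev[OF refl _ refl])
next
  case equal
  have "((\<lambda>h. flat p h / h) \<longlongrightarrow> 0) (at 0)"
  proof (rule filterlim_split_at)
    have "((\<lambda>h. 0) \<longlongrightarrow> (0::real)) (at_left 0)" by simp
    moreover have "eventually (\<lambda>h::real. flat p h / h = 0) (at_left 0)"
      unfolding eventually_at_filter by (rule always_eventually) (auto simp: flat_def)
    ultimately show "((\<lambda>h. flat p h / h) \<longlongrightarrow> 0) (at_left 0)"
      using tendsto_cong[of "\<lambda>h. flat p h / h" "\<lambda>_. 0" "at_left 0"] by simp
    have lim: "((\<lambda>h. poly ([:0, 1:] * p) (inverse h) * exp (- inverse h)) \<longlongrightarrow> 0) (at_right 0)"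
      by (rule filterlim_compose[OF poly_exp_tendsto_0 filterlim_inverse_at_top_right])
    have ev: "eventually (\<lambda>h. flat p h / h = poly ([:0, 1:] * p) (inverse h) * exp (- inverse h)) (at_right 0)"
      unfolding eventually_at_filter by (rule always_eventually) (auto simp: flat_def field_simps)
    show "((\<lambda>h. flat p h / h) \<longlongrightarrow> 0) (at_right 0)"
      unfolding tendsto_cong[OF ev] by (rule lim)
  qed
  thus ?thesis unfolding equal DERIV_def by (simp add: flat_def)
qed

text \<open>The generators are chosen so that the derivative given by each rule is again built from
  the rules. Iterated directional derivatives then stay in the class by induction, with no formula
  for higher derivatives.\<close>

inductive smooth_class :: "('a::euclidean_space \<Rightarrow> real) \<Rightarrow> bool" where
  linear: "bounded_linear f \<Longrightarrow> smooth_class f"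
| const: "smooth_class (\<lambda>_. c)"
| add: "smooth_class f \<Longrightarrow> smooth_class g \<Longrightarrow> smooth_class (\<lambda>x. f x + g x)"
| mult: "smooth_class f \<Longrightarrow> smooth_class g \<Longrightarrow> smooth_class (\<lambda>x. f x * g x)"
| flat: "smooth_class f \<Longrightarrow> smooth_class (\<lambda>x. flat p (f x))"

lemma smooth_class_derivative:
  assumes "smooth_class f"
  obtains D where "\<And>x. (f has_derivative D x) (at x)" "\<And>v. smooth_class (\<lambda>x. D x v)"
proof -
  have "\<exists>D. (\<forall>x. (f has_derivative D x) (at x)) \<and> (\<forall>v. smooth_class (\<lambda>x. D x v))"
    using assms
  proof induction
    case (linear f)
    thus ?case
      by (intro exI[of _ "\<lambda>_. f"] conjI allI bounded_linear_imp_has_derivative smooth_class.const)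
  next
    case (const c)
    show ?case by (intro exI[of _ "\<lambda>_ _. 0"] conjI allI has_derivative_const smooth_class.const)
  next
    case (add f g)
    then obtain D E where "\<And>x. (f has_derivative D x) (at x)" "\<And>v. smooth_class (\<lambda>x. D x v)"
      "\<And>x. (g has_derivative E x) (at x)" "\<And>v. smooth_class (\<lambda>x. E x v)" by blast
    thus ?case by (intro exI[of _ "\<lambda>x v. D x v + E x v"] conjI allI smooth_class.add has_derivative_add)
  next
    case (mult f g)
    then obtain D E where "\<And>x. (f has_derivative D x) (at x)" "\<And>v. smooth_class (\<lambda>x. D x v)"
      "\<And>x. (g has_derivative E x) (at x)" "\<And>v. smooth_class (\<lambda>x. E x v)" by blast
    thus ?case using mult.hyps
    proof (intro exI[of _ "\<lambda>x v. f x * E x v + D x v * g x"] conjI allI)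
      show "((\<lambda>x. f x * g x) has_derivative (\<lambda>v. f x * E x v + D x v * g x)) (at x)" for x
        by (rule has_derivative_mult) fact+
      show "smooth_class (\<lambda>x. f x * E x v + D x v * g x)" for v
        by (intro smooth_class.add[OF smooth_class.mult smooth_class.mult]) fact+
    qed
  next
    case (flat f p)
    then obtain D where D: "\<And>x. (f has_derivative D x) (at x)" "\<And>v. smooth_class (\<lambda>x. D x v)" by blast
    let ?q = "[:0, 0, 1:] * (p - pderiv p)"
    have "((\<lambda>x. flat p (f x)) has_derivative (\<lambda>v. D x v * flat ?q (f x))) (at x)" for x
      by (rule DERIV_compose_FDERIV[OF flat_has_derivative D(1)])
    moreover have "smooth_class (\<lambda>x. D x v * flat ?q (f x))" for v
      by (rule smooth_class.mult[OF D(2) smooth_class.flat[OF flat.hyps]])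
    ultimately show ?case by (intro exI[of _ "\<lambda>x v. D x v * flat ?q (f x)"]) blast
  qed
  thus thesis using that by blast
qed

lemma smooth_class_iter_dderiv: "smooth_class f \<Longrightarrow> smooth_class (iter_dderiv f vs)"
proof (induction vs)
  case (Cons v vs)
  from Cons obtain D where D: "\<And>x. (iter_dderiv f vs has_derivative D x) (at x)" "\<And>v. smooth_class (\<lambda>x. D x v)"
    using smooth_class_derivative[of "iter_dderiv f vs"] by blast
  have "iter_dderiv f (v # vs) = (\<lambda>x. D x v)"
    using frechet_derivative_at[OF D(1)] by simp
  thus ?case using D(2) by simp
qed simp

lemma smooth_class_smooth_fun: "smooth_class f \<Longrightarrow> smooth_fun f"
  unfolding smooth_fun_def differentiable_def
proof (intro allI)
  fix vs x assume f: "smooth_class f"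
  obtain D where "\<And>x. (iter_dderiv f vs has_derivative D x) (at x)" "\<And>v. smooth_class (\<lambda>x. D x v)"
    by (rule smooth_class_derivative[OF smooth_class_iter_dderiv[OF f, of vs]]) (rule that)
  thus "\<exists>D. (iter_dderiv f vs has_derivative D) (at x)" by (intro exI)
qed

lemma smooth_class_polynomial:
  fixes f :: "'a::euclidean_space \<Rightarrow> real"
  shows "real_polynomial_function f \<Longrightarrow> smooth_class f"
proof (induction rule: real_polynomial_function.induct)
  case (linear f)
  thus ?case by (rule smooth_class.linear)
next
  case (const c)
  show ?case by (rule smooth_class.const)
next
  case (add f g)
  show ?case by (rule smooth_class.add[OF add.IH])
next
  case (mult f g)
  show ?case by (rule smooth_class.mult[OF mult.IH])
qed

text \<open>The function exp (- 1 / (1 - |z|^2 / r^2)) inside the ball of radius r, and 0 outside.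
  The squared norm enters as an inner product, which is a polynomial in the coordinates.\<close>

definition bump :: "real \<Rightarrow> 'a::euclidean_space \<Rightarrow> real" where
  "bump r z = flat 1 (1 - (z \<bullet> z) * (1 / r\<^sup>2))"

lemma bump_eq_0:
  assumes "0 < r" "r \<le> norm z"
  shows "bump r z = 0"
proof -
  have "r\<^sup>2 \<le> (norm z)\<^sup>2" using assms by (intro power_mono) auto
  hence "1 - (z \<bullet> z) * (1 / r\<^sup>2) \<le> 0" using assms(1) by (simp add: power2_norm_eq_inner[symmetric])
  thus ?thesis by (simp add: bump_def flat_def)
qed

lemma bump_bounds: "0 \<le> bump r z" "bump r z \<le> 1"
  by (auto simp: bump_def flat_def)

lemma smooth_class_bump: "smooth_class (bump r)"
proof -
  have b: "smooth_class (\<lambda>z::'a. (z \<bullet> b) * (z \<bullet> b))" for b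
    by (intro smooth_class.mult smooth_class.linear bounded_linear_inner_left)
  have sA: "smooth_class (\<lambda>z::'a. \<Sum>b\<in>A. (z \<bullet> b) * (z \<bullet> b))" for A
  proof (induction A rule: infinite_finite_induct)
    case (insert b A)
    show ?case unfolding sum.insert[OF insert(1,2)] by (rule smooth_class.add[OF b insert.IH])
  qed (simp_all add: smooth_class.const)
  have eq: "(\<lambda>z::'a. z \<bullet> z) = (\<lambda>z. \<Sum>b\<in>Basis. (z \<bullet> b) * (z \<bullet> b))"
    by (rule ext) (rule euclidean_inner)
  have q: "smooth_class (\<lambda>z::'a. z \<bullet> z)" unfolding eq by (rule sA)
  have "smooth_class (\<lambda>z::'a. 1 + (z \<bullet> z) * (- (1 / r\<^sup>2)))"
    by (intro smooth_class.add smooth_class.mult smooth_class.const q)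
  from smooth_class.flat[OF this, of 1] show ?thesis by (simp add: bump_def[abs_def])
qed

text \<open>The bump is not normalised: widening it leads to the constant exp (-1) instead of 1, a
  factor cancelled at the end of \<open>dual_radon_eq_if_test_fun_eq\<close>.\<close>

lemma bump_tendsto: "(\<lambda>n. bump (real (Suc n)) z) \<longlonglongrightarrow> exp (- 1)"
proof -
  have "(flat 1 \<longlongrightarrow> flat 1 1) (at 1)" using DERIV_isCont[OF flat_has_derivative] by (simp add: isCont_def)
  have l: "(\<lambda>n. 1 - (z \<bullet> z) * (1 / (real (Suc n))\<^sup>2)) \<longlonglongrightarrow> 1 - (z \<bullet> z) * 0"
  proof (intro tendsto_diff tendsto_mult tendsto_const)
    have "(\<lambda>n. (inverse (real (Suc n)))\<^sup>2) \<longlonglongrightarrow> 0\<^sup>2" by (intro tendsto_power LIMSEQ_inverse_real_of_nat)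
    thus "(\<lambda>n. 1 / (real (Suc n))\<^sup>2) \<longlonglongrightarrow> 0" by (simp only: inverse_eq_divide power_divide power_one zero_power2)
  qed
  have "isCont (flat 1) (1 - (z \<bullet> z) * 0)" using DERIV_isCont[OF flat_has_derivative] .
  from isCont_tendsto_compose[OF this l] show ?thesis by (simp add: bump_def flat_def)
qed

lemma test_fun_polynomial_bump:
  assumes "real_polynomial_function q" "0 < r"
  shows "test_fun (\<lambda>z :: 'a::euclidean_space \<times> real. q z * bump r z)"
  unfolding test_fun_def
proof
  show "smooth_fun (\<lambda>z. q z * bump r z)"
    by (rule smooth_class_smooth_fun[OF smooth_class.mult[OF smooth_class_polynomial[OF assms(1)] smooth_class_bump]])
  have "{z. q z * bump r z \<noteq> 0} \<subseteq> cball 0 r"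
  proof
    fix z assume "z \<in> {z. q z * bump r z \<noteq> 0}"
    hence "\<not> r \<le> norm z" using bump_eq_0[OF assms(2), of z] by auto
    thus "z \<in> cball 0 r" by simp
  qed
  thus "compact (closure {z. q z * bump r z \<noteq> 0})"
    unfolding compact_closure by (rule bounded_subset[OF bounded_cball])
qed

section \<open>Regularity of the dual Radon transform\<close>

lemma sphere_borel_measurable_continuous:
  assumes "continuous_on {z :: 'a::euclidean_space \<times> real. norm (fst z) = 1} \<psi>"
  shows "(\<lambda>\<omega>. \<psi> (\<omega>, x \<bullet> \<omega>) :: real) \<in> borel_measurable sphere_measure"
  unfolding measurable_cong_sets[OF sets_sphere_measure refl]
proof (rule borel_measurable_continuous_on_restrict)
  show "continuous_on (sphere 0 1) (\<lambda>\<omega>. \<psi> (\<omega>, x \<bullet> \<omega>))"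
    by (rule continuous_on_compose2[OF assms]) (auto intro!: continuous_intros)
qed

text \<open>Function and base point vary together, so that one dominated convergence argument serves
  continuity, decay at infinity and approximation of the function.\<close>

lemma dual_radon_LIMSEQ:
  assumes m: "\<And>n. continuous_on {z :: 'a::euclidean_space \<times> real. norm (fst z) = 1} (\<psi> n)"
    and b: "\<And>n z. norm (fst z) = 1 \<Longrightarrow> \<bar>\<psi> n z\<bar> \<le> B"
    and l: "AE \<omega> in sphere_measure. (\<lambda>n. \<psi> n (\<omega>, X n \<bullet> \<omega>)) \<longlonglongrightarrow> g \<omega>"
    and g: "g \<in> borel_measurable sphere_measure"
  shows "(\<lambda>n. dual_radon (\<psi> n) (X n)) \<longlonglongrightarrow> (\<integral>\<omega>. g \<omega> \<partial>sphere_measure)"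
  unfolding dual_radon_def
proof (rule integral_dominated_convergence[where w = "\<lambda>_. B"])
  show "AE \<omega> in sphere_measure. norm (\<psi> n (\<omega>, X n \<bullet> \<omega>)) \<le> B" for n
    by (rule AE_I2) (use b in simp)
qed (use g l sphere_borel_measurable_continuous[OF m] in simp_all)

lemma abs_dual_radon_le:
  assumes m: "continuous_on {z :: 'a::euclidean_space \<times> real. norm (fst z) = 1} \<psi>"
    and b: "\<And>z. norm (fst z) = 1 \<Longrightarrow> \<bar>\<psi> z\<bar> \<le> B"
  shows "\<bar>dual_radon \<psi> x\<bar> \<le> B"
proof -
  have i: "integrable sphere_measure (\<lambda>\<omega>. \<psi> (\<omega>, x \<bullet> \<omega>))"
    by (rule sphere.integrable_const_bound[of _ B]) (use b sphere_borel_measurable_continuous[OF m] in \<open>auto intro!: AE_I2\<close>)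
  have mu: "measure sphere_measure (sphere (0::'a) 1) = 1" using prob_sphere_measure by (simp add: measure_def)
  have "\<bar>dual_radon \<psi> x\<bar> \<le> (\<integral>\<omega>. \<bar>\<psi> (\<omega>, x \<bullet> \<omega>)\<bar> \<partial>sphere_measure)"
    unfolding dual_radon_def by (rule integral_abs_bound)
  also have "\<dots> \<le> (\<integral>\<omega>. B \<partial>(sphere_measure :: 'a measure))"
    by (rule integral_mono) (use i b in auto)
  finally show ?thesis by (simp add: mu)
qed

lemma dual_radon_diff_le:
  assumes m: "continuous_on {z :: 'a::euclidean_space \<times> real. norm (fst z) = 1} \<psi>"
    "continuous_on {z :: 'a::euclidean_space \<times> real. norm (fst z) = 1} \<psi>'"
    and b: "\<And>z. norm (fst z) = 1 \<Longrightarrow> \<bar>\<psi> z\<bar> \<le> B" "\<And>z. norm (fst z) = 1 \<Longrightarrow> \<bar>\<psi>' z\<bar> \<le> B'"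
      "\<And>z. norm (fst z) = 1 \<Longrightarrow> \<bar>\<psi> z - \<psi>' z\<bar> \<le> \<epsilon>"
  shows "\<bar>dual_radon \<psi> x - dual_radon \<psi>' x\<bar> \<le> \<epsilon>"
proof -
  have i: "integrable sphere_measure (\<lambda>\<omega>. \<psi> (\<omega>, x \<bullet> \<omega>))" "integrable sphere_measure (\<lambda>\<omega>. \<psi>' (\<omega>, x \<bullet> \<omega>))"
    by (rule sphere.integrable_const_bound[of _ B] sphere.integrable_const_bound[of _ B'],
        use b sphere_borel_measurable_continuous[OF m(1)] sphere_borel_measurable_continuous[OF m(2)]
        in \<open>auto intro!: AE_I2\<close>)+
  have "dual_radon \<psi> x - dual_radon \<psi>' x = dual_radon (\<lambda>z. \<psi> z - \<psi>' z) x"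
    unfolding dual_radon_def by (rule Bochner_Integration.integral_diff[OF i, symmetric])
  also have "\<bar>\<dots>\<bar> \<le> \<epsilon>" by (rule abs_dual_radon_le) (use m b(3) in \<open>auto intro: continuous_on_diff\<close>)
  finally show ?thesis .
qed

lemma continuous_dual_radon:
  assumes c: "continuous_on {z :: 'a::euclidean_space \<times> real. norm (fst z) = 1} \<psi>"
    and b: "\<And>z. norm (fst z) = 1 \<Longrightarrow> \<bar>\<psi> z\<bar> \<le> B"
  shows "continuous_on UNIV (dual_radon \<psi>)"
  unfolding continuous_on_sequentially
proof (intro ballI allI impI)
  fix X and x :: 'a assume "(\<forall>n. X n \<in> UNIV) \<and> X \<longlonglongrightarrow> x"
  hence X: "X \<longlonglongrightarrow> x" by simp
  have "(\<lambda>n. dual_radon \<psi> (X n)) \<longlonglongrightarrow> (\<integral>\<omega>. \<psi> (\<omega>, x \<bullet> \<omega>) \<partial>sphere_measure)"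
  proof (rule dual_radon_LIMSEQ[OF c b])
    show "AE \<omega> in sphere_measure. (\<lambda>n. \<psi> (\<omega>, X n \<bullet> \<omega>)) \<longlonglongrightarrow> \<psi> (\<omega>, x \<bullet> \<omega>)"
    proof (rule AE_I2)
      fix \<omega> :: 'a assume "\<omega> \<in> space sphere_measure"
      hence w: "norm \<omega> = 1" by simp
      have l: "(\<lambda>n. (\<omega>, X n \<bullet> \<omega>)) \<longlonglongrightarrow> (\<omega>, x \<bullet> \<omega>)" by (intro tendsto_intros X)
      show "(\<lambda>n. \<psi> (\<omega>, X n \<bullet> \<omega>)) \<longlonglongrightarrow> \<psi> (\<omega>, x \<bullet> \<omega>)"
        by (rule continuous_on_tendsto_compose[OF c l]) (use w in auto)
    qed
  qed (use sphere_borel_measurable_continuous[OF c] in auto)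
  thus "(dual_radon \<psi> \<circ> X) \<longlonglongrightarrow> dual_radon \<psi> x" by (simp add: o_def dual_radon_def[of \<psi> x])
qed

text \<open>A hyperplane through 0 is a Lebesgue null set and is invariant under \<open>sgn\<close>
  away from 0, so the cone over its trace on the sphere has volume 0.\<close>

lemma AE_sphere_not_orthogonal:
  assumes "\<theta> \<noteq> (0 :: 'a::euclidean_space)"
  shows "AE \<omega> in sphere_measure. \<theta> \<bullet> \<omega> \<noteq> 0"
proof -
  have cl: "closed {x. \<theta> \<bullet> x = 0}" by (rule closed_hyperplane)
  have "{x. \<theta> \<bullet> x = 0} \<in> null_sets lebesgue"
    using negligible_hyperplane[of \<theta> 0] assms by (simp add: negligible_iff_null_sets)
  hence "{x. \<theta> \<bullet> x = 0} \<in> null_sets lborel"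
    using null_sets_completion_iff[of "{x. \<theta> \<bullet> x = 0}" lborel] borel_closed[OF cl] by simp
  hence n: "emeasure lborel {x. \<theta> \<bullet> x = 0} = 0" by auto
  define f where "f \<omega> = (indicator {x. \<theta> \<bullet> x = 0} \<omega> :: ennreal)" for \<omega>
  have fm: "f \<in> borel_measurable borel" unfolding f_def[abs_def] using borel_closed[OF cl] by (rule borel_measurable_indicator)
  have "(\<integral>\<^sup>+\<omega>. f \<omega> \<partial>sphere_measure) = ennreal (1 / unit_vol TYPE('a)) * (\<integral>\<^sup>+x. f (sgn x) * indicator uball x \<partial>lborel)"
    by (rule nn_integral_sphere) (rule borel_measurable_sphere[OF fm])
  also have "(\<integral>\<^sup>+x. f (sgn x) * indicator uball x \<partial>lborel) \<le> (\<integral>\<^sup>+x. f x \<partial>lborel)"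
    by (intro nn_integral_mono) (auto simp: f_def indicator_def sgn_div_norm)
  also have "(\<integral>\<^sup>+x. f x \<partial>lborel) = 0" unfolding f_def using borel_closed[OF cl] n by simp
  finally have "(\<integral>\<^sup>+\<omega>. f \<omega> \<partial>sphere_measure) = 0" by (simp add: mult_left_mono)
  hence "AE \<omega> in sphere_measure. f \<omega> = 0"
    using nn_integral_0_iff_AE[OF borel_measurable_sphere[OF fm]] by simp
  thus ?thesis by eventually_elim (simp add: f_def indicator_def split: if_splits)
qed

text \<open>If decay failed along a sequence going to infinity, its directions would accumulate at
  some \<theta>. Then |x \<bullet> \<omega>| tends to infinity along a subsequence for every
  \<omega> not orthogonal to \<theta>, hence for almost every \<omega>, and dominated convergence
  gives a contradiction.\<close>

lemma C0_dual_radon: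
  fixes \<psi> :: "'a::euclidean_space \<times> real \<Rightarrow> real"
  assumes c: "continuous_on UNIV \<psi>" and r: "\<And>z. r \<le> norm z \<Longrightarrow> \<psi> z = 0"
  shows "C0 (dual_radon \<psi>)"
proof -
  have "C0 \<psi>" by (rule C0_compact_support[OF c r])
  then obtain B where B: "\<And>z. \<bar>\<psi> z\<bar> \<le> B" using C0_bounded by blast
  have c': "continuous_on {z. norm (fst z) = 1} \<psi>" by (rule continuous_on_subset[OF c]) simp
  have lim: "(dual_radon \<psi> \<longlongrightarrow> 0) at_infinity"
  proof (rule ccontr)
    assume "\<not> ?thesis"
    then obtain e where e: "0 < e" "\<not> eventually (\<lambda>x. dist (dual_radon \<psi> x) 0 < e) at_infinity"
      unfolding tendsto_iff by blast
    have "\<exists>x. real (Suc n) \<le> norm x \<and> e \<le> \<bar>dual_radon \<psi> x\<bar>" for n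
      using e(2) unfolding eventually_at_infinity by (auto simp: not_less)
    then obtain X where X: "\<And>n. real (Suc n) \<le> norm (X n)" "\<And>n. e \<le> \<bar>dual_radon \<psi> (X n)\<bar>" by metis
    have X0: "X n \<noteq> 0" for n using X(1)[of n] by auto
    have "sgn (X n) \<in> sphere 0 1" for n using X0 by (simp add: norm_sgn)
    then obtain \<theta> \<rho> where \<theta>: "\<theta> \<in> sphere 0 1" "strict_mono \<rho>" "((\<lambda>n. sgn (X n)) \<circ> \<rho>) \<longlonglongrightarrow> \<theta>"
      using compact_sphere[of "0::'a" 1] unfolding compact_def by metis
    have th0: "\<theta> \<noteq> 0" using \<theta>(1) by auto
    have "(\<lambda>n. dual_radon \<psi> (X (\<rho> n))) \<longlonglongrightarrow> (\<integral>\<omega>. 0 \<partial>(sphere_measure :: 'a measure))"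
    proof (rule dual_radon_LIMSEQ[OF c' B])
      show "AE \<omega> in sphere_measure. (\<lambda>n. \<psi> (\<omega>, X (\<rho> n) \<bullet> \<omega>)) \<longlonglongrightarrow> 0"
        using AE_sphere_not_orthogonal[OF th0]
      proof eventually_elim
        case (elim \<omega>)
        have "(\<lambda>n. \<bar>sgn (X (\<rho> n)) \<bullet> \<omega>\<bar>) \<longlonglongrightarrow> \<bar>\<theta> \<bullet> \<omega>\<bar>"
          using \<theta>(3) by (intro tendsto_intros) (simp add: o_def)
        hence ev: "eventually (\<lambda>n. \<bar>\<theta> \<bullet> \<omega>\<bar> / 2 < \<bar>sgn (X (\<rho> n)) \<bullet> \<omega>\<bar>) sequentially"
          using elim by (intro order_tendstoD(1)) auto
        \<comment> \<open>For norms of at least N, the eventual lower bound on the direction pushes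
          the second coordinate beyond r and thus out of the support.\<close>
        obtain N where N: "r < real N * (\<bar>\<theta> \<bullet> \<omega>\<bar> / 2)"
          using reals_Archimedean3[of "\<bar>\<theta> \<bullet> \<omega>\<bar> / 2"] elim by auto
        have "eventually (\<lambda>n. \<psi> (\<omega>, X (\<rho> n) \<bullet> \<omega>) = 0) sequentially"
          using ev eventually_ge_at_top[of N]
        proof eventually_elim
          case (elim n)
          have "real N \<le> norm (X (\<rho> n))"
            using elim(2) seq_suble[OF \<theta>(2), of n] X(1)[of "\<rho> n"] by linarith
          hence "real N * (\<bar>\<theta> \<bullet> \<omega>\<bar> / 2) \<le> norm (X (\<rho> n)) * \<bar>sgn (X (\<rho> n)) \<bullet> \<omega>\<bar>"
            using elim(1) by (intro mult_mono) auto
          also have "\<dots> = \<bar>X (\<rho> n) \<bullet> \<omega>\<bar>" using X0[of "\<rho> n"] by (simp add: sgn_div_norm abs_mult)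
          also have "\<dots> \<le> norm (\<omega>, X (\<rho> n) \<bullet> \<omega>)" using norm_snd_le[of "X (\<rho> n) \<bullet> \<omega>" \<omega>] by simp
          finally show ?case using N by (intro r) linarith
        qed
        thus ?case by (rule tendsto_eventually)
      qed
    qed simp
    hence "(\<lambda>n. dual_radon \<psi> (X (\<rho> n))) \<longlonglongrightarrow> 0" by simp
    from tendstoD[OF this e(1)] obtain n where "\<bar>dual_radon \<psi> (X (\<rho> n))\<bar> < e"
      by (auto simp: eventually_sequentially)
    thus False using X(2)[of "\<rho> n"] by simp
  qed
  show ?thesis unfolding C0_def using continuous_dual_radon[OF c' B] lim by blast
qed

text \<open>The p-derivative is the Frechet derivative in the direction (0, 1); it is continuous
  because this first iterated derivative is itself differentiable.\<close>

lemma test_fun_facts: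
  fixes \<psi> :: "'a::euclidean_space \<times> real \<Rightarrow> real"
  assumes "test_fun \<psi>"
  obtains r where "0 < r" "continuous_on UNIV \<psi>" "\<And>z. r \<le> norm z \<Longrightarrow> \<psi> z = 0"
    "\<And>\<omega> p. ((\<lambda>p. \<psi> (\<omega>, p)) has_real_derivative deriv (\<lambda>p. \<psi> (\<omega>, p)) p) (at p)"
    "continuous_on UNIV (\<lambda>z. deriv (\<lambda>p. \<psi> (fst z, p)) (snd z))"
    "\<And>z. r \<le> norm z \<Longrightarrow> deriv (\<lambda>p. \<psi> (fst z, p)) (snd z) = 0"
proof -
  have diff: "iter_dderiv \<psi> vs differentiable (at x)" for vs x
    using conjunct1[OF assms[unfolded test_fun_def]] unfolding smooth_fun_def by blast
  have d: "\<psi> differentiable (at x)" for x using diff[of "[]"] by simp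
  define D where "D z = frechet_derivative \<psi> (at z) (0, 1)" for z
  have Dc: "continuous_on UNIV D"
    using diff[of "[(0, 1)]"] unfolding D_def[abs_def]
    by (intro continuous_at_imp_continuous_on ballI differentiable_imp_continuous_within) simp
  have fd: "((\<lambda>p. \<psi> (\<omega>, p)) has_real_derivative D (\<omega>, p)) (at p)" for \<omega> p
  proof -
    have "((\<lambda>p. (\<omega>, p)) has_derivative (\<lambda>h. (0, h))) (at p)"
      by (auto intro!: derivative_eq_intros)
    from diff_chain_at[OF this, of \<psi> "frechet_derivative \<psi> (at (\<omega>, p))"]
    have "((\<lambda>p. \<psi> (\<omega>, p)) has_derivative (\<lambda>h. frechet_derivative \<psi> (at (\<omega>, p)) (0, h))) (at p)"
      using frechet_derivative_works[THEN iffD1, OF d[of "(\<omega>, p)"]] by (simp add: o_def)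
    moreover have "frechet_derivative \<psi> (at (\<omega>, p)) (0, h) = D (\<omega>, p) * h" for h
    proof -
      have "linear (frechet_derivative \<psi> (at (\<omega>, p)))" by (rule linear_frechet_derivative[OF d])
      from linear_cmul[OF this, of h "(0, 1)"] show ?thesis by (simp add: D_def)
    qed
    ultimately show ?thesis by (simp add: has_field_derivative_def)
  qed
  hence De: "deriv (\<lambda>p. \<psi> (\<omega>, p)) p = D (\<omega>, p)" for \<omega> p by (rule DERIV_imp_deriv)
  have "bounded {z. \<psi> z \<noteq> 0}"
    using assms bounded_subset[OF compact_imp_bounded closure_subset] by (simp add: test_fun_def)
  then obtain b where b: "\<And>z. \<psi> z \<noteq> 0 \<Longrightarrow> norm z \<le> b" unfolding bounded_iff by blast
  \<comment> \<open>The extra 1 puts every z with norm at least r into an open set on which \<psi>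
    vanishes, so that the derivative vanishes there too.\<close>
  define r where "r = max b 0 + 1"
  have r0: "\<psi> z = 0" if "r \<le> norm z" for z
  proof (rule ccontr)
    assume "\<psi> z \<noteq> 0"
    from b[OF this] show False using that by (auto simp: r_def)
  qed
  have D0: "D z = 0" if z: "r \<le> norm z" for z
  proof -
    have "open {z :: 'a \<times> real. b < norm z}" by (intro open_Collect_less continuous_intros)
    moreover have "z \<in> {z. b < norm z}" using z by (auto simp: r_def)
    moreover have "0 = \<psi> x" if "x \<in> {z. b < norm z}" for x using b[of x] that by force
    ultimately have "(\<psi> has_derivative (\<lambda>_. 0)) (at z)"
      by (rule has_derivative_transform_within_open[OF has_derivative_const])
    from frechet_derivative_at[OF this, symmetric] show ?thesis by (simp add: D_def)
  qed
  show thesis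
  proof (rule that[of r])
    show "continuous_on UNIV \<psi>"
      by (intro continuous_at_imp_continuous_on ballI differentiable_imp_continuous_within d)
  qed (use r0 D0 fd Dc in \<open>auto simp: De r_def\<close>)
qed

text \<open>Compact support turns a plain bound B on the derivative into decay: for |p| \<le> r one
  has 1 \<le> (1 + r^2) / (1 + p^2).\<close>

lemma test_fun_radon_test:
  fixes \<psi> :: "'a::euclidean_space \<times> real \<Rightarrow> real"
  assumes "test_fun \<psi>"
  shows "radon_test \<psi> (\<lambda>z. deriv (\<lambda>p. \<psi> (fst z, p)) (snd z))"
proof -
  define D where "D = (\<lambda>z. deriv (\<lambda>p. \<psi> (fst z, p)) (snd z))"
  obtain r where r: "0 < r" "\<And>z. r \<le> norm z \<Longrightarrow> \<psi> z = 0"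
    "\<And>\<omega> p. ((\<lambda>p. \<psi> (\<omega>, p)) has_real_derivative D (\<omega>, p)) (at p)"
    "continuous_on UNIV D" "\<And>z. r \<le> norm z \<Longrightarrow> D z = 0"
    unfolding D_def fst_conv snd_conv using test_fun_facts[OF assms] by metis
  have "C0 D" by (rule C0_compact_support[OF r(4,5)])
  then obtain B where B: "0 < B" "\<And>z. \<bar>D z\<bar> \<le> B" using C0_bounded by blast
  show ?thesis unfolding D_def[symmetric] radon_test_def
  proof (intro conjI allI impI)
    have "D \<in> borel_measurable (borel \<Otimes>\<^sub>M borel)"
      unfolding borel_prod by (rule borel_measurable_continuous_onI[OF r(4)])
    thus "D \<in> borel_measurable (sphere_measure \<Otimes>\<^sub>M lborel)" by (rule measurable_pair_sphere)
    show "\<exists>K. \<forall>\<omega> p. norm \<omega> = 1 \<longrightarrow> \<bar>D (\<omega>, p)\<bar> \<le> K / (1 + p\<^sup>2)"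
    proof (intro exI allI impI)
      fix \<omega> :: 'a and p :: real
      have pos: "0 < 1 + p\<^sup>2" by (simp add: add_pos_nonneg)
      show "\<bar>D (\<omega>, p)\<bar> \<le> B * (1 + r\<^sup>2) / (1 + p\<^sup>2)"
      proof (cases "r \<le> norm (\<omega>, p)")
        case True
        thus ?thesis using r(5)[OF True] B(1) pos by (simp add: divide_nonneg_pos)
      next
        case False
        hence "\<bar>p\<bar> \<le> r" using norm_snd_le[of p \<omega>] by simp
        hence "p\<^sup>2 \<le> r\<^sup>2" using power_mono[of "\<bar>p\<bar>" r 2] by simp
        hence "B * (1 + p\<^sup>2) \<le> B * (1 + r\<^sup>2)" using B(1) by simp
        moreover have "\<bar>D (\<omega>, p)\<bar> * (1 + p\<^sup>2) \<le> B * (1 + p\<^sup>2)" using B(2) pos by (intro mult_right_mono) auto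
        ultimately show ?thesis unfolding pos_le_divide_eq[OF pos] by linarith
      qed
    qed
    fix \<omega> :: 'a
    show "((\<lambda>p. \<psi> (\<omega>, p)) \<longlongrightarrow> 0) at_top"
    proof (rule tendsto_eventually)
      show "eventually (\<lambda>p. \<psi> (\<omega>, p) = 0) at_top"
        using eventually_ge_at_top[of r]
      proof eventually_elim
        case (elim p)
        thus ?case using norm_snd_le[of p \<omega>] by (intro r(2)) simp
      qed
    qed
    fix p
    show "((\<lambda>p. \<psi> (\<omega>, p)) has_real_derivative D (\<omega>, p)) (at p)" by (rule r(3))
    have "continuous_on UNIV (\<lambda>p. D (\<omega>, p))"
      by (rule continuous_on_compose2[OF r(4)]) (auto intro!: continuous_intros)
    thus "isCont (\<lambda>p. D (\<omega>, p)) p" by (simp add: continuous_on_eq_continuous_at)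
  qed
qed

section \<open>Translates and dilates of the ridge function\<close>

definition shifted_ridge :: "'a::euclidean_space \<Rightarrow> real \<Rightarrow> 'a \<times> real \<Rightarrow> real" where
  "shifted_ridge y e z = ridge (fst z, (snd z - y \<bullet> fst z) / e)"

text \<open>Since x \<bullet> \<omega> - y \<bullet> \<omega> = (x - y) \<bullet> \<omega>, the
  shift of p by y \<bullet> \<omega> acts as translation by y in the variable x.\<close>

lemma dual_radon_shifted_ridge: "dual_radon (shifted_ridge y e) x = cauchy_kernel ((1 / e) *\<^sub>R (x - y))"
  by (simp add: dual_radon_def shifted_ridge_def dual_radon_ridge[symmetric] inner_diff_left)

lemma continuous_shifted_ridge:
  "0 < e \<Longrightarrow> continuous_on {z :: 'a::euclidean_space \<times> real. norm (fst z) = 1} (shifted_ridge y e)"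
  unfolding shifted_ridge_def
  by (rule continuous_on_compose2[OF continuous_ridge(1)]) (auto intro!: continuous_intros)

lemma shifted_ridge_bound:
  "norm (fst z) = 1 \<Longrightarrow> \<bar>shifted_ridge y e (z :: 'a::euclidean_space \<times> real)\<bar> \<le> ridge_const TYPE('a)"
  unfolding shifted_ridge_def by (rule ridge_bound(1)) simp

lemma radon_test_shifted_ridge:
  fixes y :: "'a::euclidean_space"
  assumes e: "0 < e"
  shows "radon_test (shifted_ridge y e) (\<lambda>z. ridge_deriv (fst z, (snd z - y \<bullet> fst z) / e) * (1 / e))"
  unfolding radon_test_def
proof (intro conjI allI impI)
  have m: "ridge_deriv \<in> borel_measurable ((borel :: 'a measure) \<Otimes>\<^sub>M borel)"
  proof -
    have "(\<lambda>z :: 'a \<times> real. Complex (l1_norm (fst z)) (- snd z)) \<in> borel_measurable (borel \<Otimes>\<^sub>M borel)"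
      unfolding borel_prod by (intro borel_measurable_continuous_onI continuous_intros)
    thus ?thesis unfolding ridge_deriv_def by measurable
  qed
  have "(\<lambda>z :: 'a \<times> real. (fst z, (snd z - y \<bullet> fst z) / e)) \<in> (borel \<Otimes>\<^sub>M borel) \<rightarrow>\<^sub>M (borel \<Otimes>\<^sub>M borel)"
    unfolding borel_prod by (intro borel_measurable_continuous_onI continuous_intros) (use e in auto)
  from measurable_compose[OF this m]
  show "(\<lambda>z. ridge_deriv (fst z, (snd z - y \<bullet> fst z) / e) * (1 / e)) \<in> borel_measurable (sphere_measure \<Otimes>\<^sub>M lborel)"
    by (intro measurable_pair_sphere borel_measurable_times) auto
  define c where "c = ridge_const TYPE('a) * DIM('a)"
  \<comment> \<open>With p = e q + y \<bullet> \<omega> and (u + v)^2 \<le> 2 u^2 + 2 v^2, this K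
    satisfies 1 + p^2 \<le> K * (1 + q^2), which transfers the decay in q to decay in p.\<close>
  define K where "K = 1 + 2 * (norm y)\<^sup>2 + 2 * e\<^sup>2"
  have c: "0 \<le> c" using ridge_const_pos[where 'a='a] by (simp add: c_def)
  show "\<exists>K. \<forall>\<omega> p. norm \<omega> = 1 \<longrightarrow> \<bar>ridge_deriv (fst (\<omega>, p), (snd (\<omega>, p) - y \<bullet> fst (\<omega>, p)) / e) * (1 / e)\<bar> \<le> K / (1 + p\<^sup>2)"
  proof (intro exI allI impI)
    fix \<omega> :: 'a and p :: real assume w: "norm \<omega> = 1"
    define q where "q = (p - y \<bullet> \<omega>) / e"
    have pq: "0 < 1 + p\<^sup>2" "0 < 1 + q\<^sup>2" by (simp_all add: add_pos_nonneg)
    have "p = e * q + y \<bullet> \<omega>" using e by (simp add: q_def)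
    moreover have "(e * q + y \<bullet> \<omega>)\<^sup>2 \<le> 2 * (e * q)\<^sup>2 + 2 * (y \<bullet> \<omega>)\<^sup>2"
      using zero_le_power2[of "e * q - y \<bullet> \<omega>"] by (simp add: power2_eq_square algebra_simps)
    moreover have "(y \<bullet> \<omega>)\<^sup>2 \<le> (norm y)\<^sup>2"
      using Cauchy_Schwarz_ineq2[of y \<omega>] w by (intro abs_le_square_iff[THEN iffD1]) simp
    ultimately have "1 + p\<^sup>2 \<le> 1 + 2 * (norm y)\<^sup>2 + 2 * e\<^sup>2 * q\<^sup>2" by (simp add: power_mult_distrib)
    also have "\<dots> \<le> K * (1 + q\<^sup>2)"
    proof -
      have "0 \<le> (norm y)\<^sup>2 * q\<^sup>2" "0 \<le> e\<^sup>2" "0 \<le> q\<^sup>2" by simp_all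
      thus ?thesis by (simp add: K_def algebra_simps)
    qed
    finally have "c * (1 + p\<^sup>2) \<le> c * (K * (1 + q\<^sup>2))" using c by (rule mult_left_mono)
    hence "c / (1 + q\<^sup>2) \<le> c * K / (1 + p\<^sup>2)" using pq by (simp add: field_simps)
    moreover have "\<bar>ridge_deriv (\<omega>, q)\<bar> \<le> c / (1 + q\<^sup>2)"
      using ridge_bound(3)[of "(\<omega>, q)"] w by (simp add: c_def)
    ultimately have "\<bar>ridge_deriv (\<omega>, q)\<bar> * (1 / e) \<le> c * K / (1 + p\<^sup>2) * (1 / e)"
      using e by (intro mult_right_mono) auto
    thus "\<bar>ridge_deriv (fst (\<omega>, p), (snd (\<omega>, p) - y \<bullet> fst (\<omega>, p)) / e) * (1 / e)\<bar> \<le> (c * K / e) / (1 + p\<^sup>2)"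
      using e by (simp add: abs_mult q_def mult.commute)
  qed
  fix \<omega> :: 'a assume w: "norm \<omega> = 1"
  have aff: "((\<lambda>p. (p - y \<bullet> \<omega>) / e) has_real_derivative 1 / e) (at p)" for p
    using e by (auto intro!: derivative_eq_intros)
  show "((\<lambda>p. shifted_ridge y e (\<omega>, p)) has_real_derivative
      ridge_deriv (fst (\<omega>, p), (snd (\<omega>, p) - y \<bullet> fst (\<omega>, p)) / e) * (1 / e)) (at p)" for p
    unfolding shifted_ridge_def fst_conv snd_conv
    by (rule DERIV_chain2[OF ridge_has_derivative[OF w] aff])
  have "continuous_on UNIV (\<lambda>p. ridge_deriv (\<omega>, (p - y \<bullet> \<omega>) / e) * (1 / e))"
    by (intro continuous_on_mult continuous_on_const continuous_on_compose2[OF continuous_ridge(2)])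
       (use e w in \<open>auto intro!: continuous_intros\<close>)
  thus "isCont (\<lambda>p. ridge_deriv (fst (\<omega>, p), (snd (\<omega>, p) - y \<bullet> fst (\<omega>, p)) / e) * (1 / e)) p" for p
    by (simp add: continuous_on_eq_continuous_at)
  have "filterlim (\<lambda>p. - (y \<bullet> \<omega> / e) + (1 / e) * p) at_top at_top"
    using e by (intro filterlim_tendsto_add_at_top[OF tendsto_const] filterlim_tendsto_pos_mult_at_top[OF tendsto_const] filterlim_ident) auto
  hence "filterlim (\<lambda>p. (p - y \<bullet> \<omega>) / e) at_top at_top" by (simp add: diff_divide_distrib)
  from filterlim_compose[OF tendsto_ridge[OF w] this]
  show "((\<lambda>p. shifted_ridge y e (\<omega>, p)) \<longlongrightarrow> 0) at_top" by (simp add: shifted_ridge_def)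
qed

section \<open>Approximation by the Cauchy kernel\<close>

lemma signed_integrable_parts:
  assumes "signed_measure \<nu>" "f \<in> borel_measurable borel" "\<And>x. \<bar>f x\<bar> \<le> (B::real)"
  shows "integrable (pos_variation \<nu>) f" "integrable (neg_variation \<nu>) f"
  by (rule integrable_bounded_borel[OF finite_pos_variation[OF assms(1)] sets_pos_variation assms(2), of B],
      use assms(3) in simp)
     (rule integrable_bounded_borel[OF finite_neg_variation[OF assms(1)] sets_neg_variation assms(2), of B],
      use assms(3) in simp)

lemma signed_integral_diff:
  assumes "signed_measure \<nu>" "f \<in> borel_measurable borel" "\<And>x. \<bar>f x\<bar> \<le> B"
    "g \<in> borel_measurable borel" "\<And>x. \<bar>g x\<bar> \<le> B'"
  shows "signed_integral \<nu> (\<lambda>x. f x - g x) = signed_integral \<nu> f - signed_integral \<nu> g"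
  using signed_integrable_parts[OF assms(1-3)] signed_integrable_parts[OF assms(1,4,5)]
  by (simp add: signed_integral_def)

lemma signed_integral_add:
  assumes "signed_measure \<nu>" "f \<in> borel_measurable borel" "\<And>x. \<bar>f x\<bar> \<le> B"
    "g \<in> borel_measurable borel" "\<And>x. \<bar>g x\<bar> \<le> B'"
  shows "signed_integral \<nu> (\<lambda>x. f x + g x) = signed_integral \<nu> f + signed_integral \<nu> g"
  using signed_integrable_parts[OF assms(1-3)] signed_integrable_parts[OF assms(1,4,5)]
  by (simp add: signed_integral_def)

lemma signed_integral_cmult: "signed_integral \<nu> (\<lambda>x. c * f x) = c * signed_integral \<nu> f"
  by (simp add: signed_integral_def right_diff_distrib)

lemma abs_integral_le_const:
  assumes "finite_measure M" "sets M = sets borel" "f \<in> borel_measurable borel" "\<And>x. \<bar>f x\<bar> \<le> (B::real)"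
  shows "\<bar>integral\<^sup>L M f\<bar> \<le> B * measure M UNIV"
proof -
  interpret finite_measure M by fact
  have sp: "space M = UNIV" using sets_eq_imp_space_eq[OF assms(2)] by simp
  have i: "integrable M f" by (rule integrable_bounded_borel[OF assms(1-3), of B]) (use assms(4) in simp)
  have "\<bar>integral\<^sup>L M f\<bar> \<le> (\<integral>x. \<bar>f x\<bar> \<partial>M)" by (rule integral_abs_bound)
  also have "\<dots> \<le> (\<integral>x. B \<partial>M)" by (rule integral_mono) (use i assms(4) in auto)
  finally show ?thesis by (simp add: sp mult.commute)
qed

lemma abs_signed_integral_le:
  assumes "signed_measure \<nu>" "f \<in> borel_measurable borel" "\<And>x. \<bar>f x\<bar> \<le> B"
  shows "\<bar>signed_integral \<nu> f\<bar> \<le> B * total_variation \<nu>"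
  using abs_integral_le_const[OF finite_pos_variation[OF assms(1)] sets_pos_variation assms(2,3)]
    abs_integral_le_const[OF finite_neg_variation[OF assms(1)] sets_neg_variation assms(2,3)]
  unfolding signed_integral_def total_variation_eq[OF assms(1)] distrib_left by linarith

lemma total_variation_nonneg: "signed_measure \<nu> \<Longrightarrow> 0 \<le> total_variation \<nu>"
  by (simp add: total_variation_eq)

lemma signed_integral_LIMSEQ:
  assumes sm: "signed_measure \<nu>" and m: "\<And>n. f n \<in> borel_measurable borel" "g \<in> borel_measurable borel"
    and b: "\<And>n x. \<bar>f n x\<bar> \<le> B" and l: "\<And>x. (\<lambda>n. f n x) \<longlonglongrightarrow> g x"
  shows "(\<lambda>n. signed_integral \<nu> (f n)) \<longlonglongrightarrow> signed_integral \<nu> g"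
proof -
  have *: "(\<lambda>n. integral\<^sup>L M (f n)) \<longlonglongrightarrow> integral\<^sup>L M g" if M: "finite_measure M" "sets M = sets borel" for M
  proof -
    interpret finite_measure M by fact
    have mM: "borel_measurable M = (borel_measurable borel :: ('a \<Rightarrow> real) set)"
      by (rule measurable_cong_sets[OF M(2) refl])
    show ?thesis
    proof (rule integral_dominated_convergence[where w = "\<lambda>_. B"])
      show "g \<in> borel_measurable M" "\<And>n. f n \<in> borel_measurable M" unfolding mM by (rule m)+
    qed (use b l in \<open>auto intro!: AE_I2\<close>)
  qed
  show ?thesis unfolding signed_integral_def
    by (intro tendsto_diff * finite_pos_variation finite_neg_variation sm sets_pos_variation sets_neg_variation)
qed

text \<open>The common bound C makes a uniform approximation of f uniform in k at the level of
  integrals, so the Cauchy property is inherited. It serves twice: from smoothed to compactly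
  supported functions, and from these to C_0.\<close>

lemma convergent_signed_integral_approx:
  fixes \<mu>s :: "nat \<Rightarrow> 'a::euclidean_space set \<Rightarrow> real"
  assumes sm: "\<And>k. signed_measure (\<mu>s k)" and bdd: "\<And>k. total_variation (\<mu>s k) \<le> C"
    and f: "f \<in> borel_measurable borel" "\<And>x. \<bar>f x\<bar> \<le> B"
    and approx: "\<And>\<delta>. 0 < \<delta> \<Longrightarrow> \<exists>g. g \<in> borel_measurable borel \<and> (\<forall>x. \<bar>f x - g x\<bar> \<le> \<delta>) \<and>
       convergent (\<lambda>k. signed_integral (\<mu>s k) g)"
  shows "convergent (\<lambda>k. signed_integral (\<mu>s k) f)"
  unfolding Cauchy_convergent_iff[symmetric]
proof (rule CauchyI)
  fix e :: real assume e: "0 < e"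
  have C: "0 \<le> C" using total_variation_nonneg[OF sm[of 0]] bdd[of 0] by linarith
  \<comment> \<open>Each of the two replacements of f by g costs at most \<delta> * C \<le> e / 4,
    and the Cauchy gap for g another e / 4. The summand 1 covers C = 0.\<close>
  define \<delta> where "\<delta> = e / (4 * (C + 1))"
  have \<delta>: "0 < \<delta>" using e C by (simp add: \<delta>_def)
  have dC: "\<delta> * C \<le> e / 4" using e C by (simp add: \<delta>_def field_simps)
  obtain g where g: "g \<in> borel_measurable borel" "\<And>x. \<bar>f x - g x\<bar> \<le> \<delta>" "convergent (\<lambda>k. signed_integral (\<mu>s k) g)"
    using approx[OF \<delta>] by blast
  have gB: "\<bar>g x\<bar> \<le> B + \<delta>" for x using f(2)[of x] g(2)[of x] by linarith
  have fg: "\<bar>signed_integral (\<mu>s k) f - signed_integral (\<mu>s k) g\<bar> \<le> e / 4" for k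
  proof -
    have "\<bar>signed_integral (\<mu>s k) (\<lambda>x. f x - g x)\<bar> \<le> \<delta> * total_variation (\<mu>s k)"
      by (rule abs_signed_integral_le[OF sm]) (use f g in auto)
    also have "\<dots> \<le> \<delta> * C" using \<delta> bdd by (intro mult_left_mono) auto
    finally show ?thesis using signed_integral_diff[OF sm f g(1) gB, of k] dC by linarith
  qed
  have "Cauchy (\<lambda>k. signed_integral (\<mu>s k) g)" using g(3) by (simp add: Cauchy_convergent_iff)
  from CauchyD[OF this, of "e / 4"] e obtain N where
    N: "\<And>m n. N \<le> m \<Longrightarrow> N \<le> n \<Longrightarrow> \<bar>signed_integral (\<mu>s m) g - signed_integral (\<mu>s n) g\<bar> < e / 4" by auto
  show "\<exists>N. \<forall>m\<ge>N. \<forall>n\<ge>N. norm (signed_integral (\<mu>s m) f - signed_integral (\<mu>s n) f) < e"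
  proof (intro exI allI impI)
    fix m n assume "N \<le> m" "N \<le> n"
    from N[OF this] show "norm (signed_integral (\<mu>s m) f - signed_integral (\<mu>s n) f) < e"
      using fg[of m] fg[of n] e unfolding real_norm_def by linarith
  qed
qed

section \<open>Smoothing with the kernel\<close>

lemma cauchy_kernel_pos: "0 < cauchy_kernel x"
  unfolding cauchy_kernel_def by (intro prod_pos ballI) (simp add: add_pos_nonneg)

lemma cauchy_kernel_le: "cauchy_kernel (x :: 'a::euclidean_space) \<le> 2 ^ DIM('a)"
proof -
  have "cauchy_kernel x \<le> (\<Prod>b\<in>(Basis :: 'a set). 2)"
    unfolding cauchy_kernel_def by (intro prod_mono) (simp add: add_pos_nonneg divide_le_eq)
  thus ?thesis by simp
qed

lemma abs_cauchy_kernel_le: "\<bar>cauchy_kernel (x :: 'a::euclidean_space)\<bar> \<le> 2 ^ DIM('a)"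
  using cauchy_kernel_pos[of x] cauchy_kernel_le[of x] by simp

lemma continuous_cauchy_kernel: "continuous_on A f \<Longrightarrow> continuous_on A (\<lambda>x. cauchy_kernel (f x))"
proof -
  have "1 + t\<^sup>2 \<noteq> 0" for t :: real by (metis add_pos_nonneg less_irrefl zero_le_power2 zero_less_one)
  thus "continuous_on A f \<Longrightarrow> continuous_on A (\<lambda>x. cauchy_kernel (f x))"
    unfolding cauchy_kernel_def by (intro continuous_intros) auto
qed

lemma cauchy_kernel_measurable: "cauchy_kernel \<in> borel_measurable borel"
  using continuous_cauchy_kernel[OF continuous_on_id] by (rule borel_measurable_continuous_onI)

lemma integrable_cauchy_kernel: "integrable lborel cauchy_kernel"
  unfolding cauchy_kernel_def[abs_def]
  using integral_prod_lborel(1)[of "\<lambda>_ t. 2 / (1 + t\<^sup>2)"] integrable_mult_right[OF integrable_inverse_1_plus_square, of 2]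
  by simp

text \<open>A positive function with integral 0 would vanish almost everywhere, which is impossible
  as Lebesgue measure is not zero.\<close>

lemma integral_cauchy_kernel_pos: "0 < integral\<^sup>L lborel (cauchy_kernel :: 'a::euclidean_space \<Rightarrow> real)"
proof -
  have "0 \<le> integral\<^sup>L lborel (cauchy_kernel :: 'a \<Rightarrow> real)"
    by (rule integral_nonneg_AE) (simp add: cauchy_kernel_pos less_imp_le)
  moreover have "integral\<^sup>L lborel (cauchy_kernel :: 'a \<Rightarrow> real) \<noteq> 0"
  proof
    assume "integral\<^sup>L lborel (cauchy_kernel :: 'a \<Rightarrow> real) = 0"
    moreover have "AE x in lborel. 0 \<le> cauchy_kernel (x :: 'a)"
      by (rule AE_I2) (simp add: cauchy_kernel_pos less_imp_le)
    ultimately have "AE x in lborel. cauchy_kernel (x :: 'a) = 0"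
      using integral_nonneg_eq_0_iff_AE[OF integrable_cauchy_kernel[where 'a='a]] by blast
    hence "AE x in (lborel :: 'a measure). False"
      by eventually_elim (use cauchy_kernel_pos in \<open>metis less_irrefl\<close>)
    thus False by (simp add: AE_iff_measurable[of UNIV])
  qed
  ultimately show ?thesis by linarith
qed

text \<open>Convolution with the dilated kernel, without normalisation; the missing factor appears
  as the constant c in \<open>kernel_smooth_uniform_approx\<close>.\<close>

definition kernel_smooth :: "real \<Rightarrow> ('a::euclidean_space \<Rightarrow> real) \<Rightarrow> 'a \<Rightarrow> real" where
  "kernel_smooth e f x = (\<integral>y. f y * cauchy_kernel ((1 / e) *\<^sub>R (x - y)) \<partial>lborel)"

text \<open>Fubini turns the integral of a smoothed function into a superposition of integrals of
  translated kernels, and these are the integrals for which convergence is known.\<close>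

lemma kernel_smooth_integral:
  fixes M :: "'a::euclidean_space measure"
  assumes M: "finite_measure M" "sets M = sets borel" and f: "integrable lborel f"
  shows "integral\<^sup>L M (kernel_smooth e f) = (\<integral>y. f y * (\<integral>x. cauchy_kernel ((1 / e) *\<^sub>R (x - y)) \<partial>M) \<partial>lborel)"
    and "(\<lambda>y. \<integral>x. cauchy_kernel ((1 / e) *\<^sub>R (x - y)) \<partial>M) \<in> borel_measurable borel"
    and "kernel_smooth e f \<in> borel_measurable borel"
proof -
  interpret finite_measure M by fact
  interpret P: pair_sigma_finite M lborel by standard
  have fm: "f \<in> borel_measurable borel" using borel_measurable_integrable[OF f] by simp
  have k: "(\<lambda>z :: 'a \<times> 'a. cauchy_kernel ((1 / e) *\<^sub>R (fst z - snd z))) \<in> borel_measurable (borel \<Otimes>\<^sub>M borel)"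
    unfolding borel_prod by (intro borel_measurable_continuous_onI continuous_cauchy_kernel continuous_intros)
  have k': "(\<lambda>z :: 'a \<times> 'a. cauchy_kernel ((1 / e) *\<^sub>R (snd z - fst z))) \<in> borel_measurable (borel \<Otimes>\<^sub>M borel)"
    unfolding borel_prod by (intro borel_measurable_continuous_onI continuous_cauchy_kernel continuous_intros)
  have h0: "(\<lambda>z. f (snd z) * cauchy_kernel ((1 / e) *\<^sub>R (fst z - snd z))) \<in> borel_measurable (borel \<Otimes>\<^sub>M borel)"
    by (intro borel_measurable_times k measurable_compose[OF measurable_snd fm])
  have s: "sets (M \<Otimes>\<^sub>M lborel) = sets (borel \<Otimes>\<^sub>M borel :: ('a \<times> 'a) measure)"
    by (rule sets_pair_measure_cong[OF M(2)]) simp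
  have h: "case_prod (\<lambda>x y. f y * cauchy_kernel ((1 / e) *\<^sub>R (x - y))) \<in> borel_measurable (M \<Otimes>\<^sub>M lborel)"
    unfolding case_prod_beta' using h0 measurable_cong_sets[OF s refl, of borel] by blast
  have i: "integrable (M \<Otimes>\<^sub>M lborel) (case_prod (\<lambda>x y. f y * cauchy_kernel ((1 / e) *\<^sub>R (x - y))))"
  proof (rule Bochner_Integration.integrable_bound[OF _ h])
    show "integrable (M \<Otimes>\<^sub>M lborel) (\<lambda>z. 2 ^ DIM('a) * f (snd z))"
    proof (rule P.Fubini_integrable)
      have "snd \<in> (M \<Otimes>\<^sub>M lborel) \<rightarrow>\<^sub>M (borel :: 'a measure)"
        using measurable_snd[of M "lborel :: 'a measure"] by simp
      from measurable_compose[OF this fm]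
      show "(\<lambda>z. 2 ^ DIM('a) * f (snd z)) \<in> borel_measurable (M \<Otimes>\<^sub>M lborel)"
        by (intro borel_measurable_times borel_measurable_const)
    qed (use f in \<open>simp_all add: abs_mult\<close>)
    show "AE z in M \<Otimes>\<^sub>M lborel. norm (case_prod (\<lambda>x y. f y * cauchy_kernel ((1 / e) *\<^sub>R (x - y))) z)
        \<le> norm (2 ^ DIM('a) * f (snd z))"
    proof (rule AE_I2)
      fix z :: "'a \<times> 'a"
      have "\<bar>f (snd z)\<bar> * \<bar>cauchy_kernel ((1 / e) *\<^sub>R (fst z - snd z))\<bar> \<le> \<bar>f (snd z)\<bar> * 2 ^ DIM('a)"
        by (intro mult_left_mono abs_cauchy_kernel_le) simp
      thus "norm (case_prod (\<lambda>x y. f y * cauchy_kernel ((1 / e) *\<^sub>R (x - y))) z) \<le> norm (2 ^ DIM('a) * f (snd z))"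
        by (simp add: case_prod_beta' abs_mult mult.commute)
    qed
  qed
  have "integral\<^sup>L M (kernel_smooth e f) = (\<integral>y. (\<integral>x. f y * cauchy_kernel ((1 / e) *\<^sub>R (x - y)) \<partial>M) \<partial>lborel)"
    unfolding kernel_smooth_def by (rule P.Fubini_integral[OF i, symmetric])
  thus "integral\<^sup>L M (kernel_smooth e f) = (\<integral>y. f y * (\<integral>x. cauchy_kernel ((1 / e) *\<^sub>R (x - y)) \<partial>M) \<partial>lborel)"
    by (simp only: integral_mult_right_zero)
  show "(\<lambda>y. \<integral>x. cauchy_kernel ((1 / e) *\<^sub>R (x - y)) \<partial>M) \<in> borel_measurable borel"
  proof (rule borel_measurable_lebesgue_integral)
    have s': "sets (borel \<Otimes>\<^sub>M M) = sets (borel \<Otimes>\<^sub>M borel :: ('a \<times> 'a) measure)"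
      by (rule sets_pair_measure_cong[OF refl M(2)])
    show "(\<lambda>(y, x). cauchy_kernel ((1 / e) *\<^sub>R (x - y))) \<in> borel_measurable (borel \<Otimes>\<^sub>M M)"
      unfolding case_prod_beta' using k' measurable_cong_sets[OF s' refl, of borel] by blast
  qed
  show "kernel_smooth e f \<in> borel_measurable borel" unfolding kernel_smooth_def[abs_def]
  proof (rule lborel.borel_measurable_lebesgue_integral)
    have s': "sets (borel \<Otimes>\<^sub>M lborel) = sets (borel \<Otimes>\<^sub>M borel :: ('a \<times> 'a) measure)"
      by (rule sets_pair_measure_cong) simp_all
    show "(\<lambda>(x, y). f y * cauchy_kernel ((1 / e) *\<^sub>R (x - y))) \<in> borel_measurable (borel \<Otimes>\<^sub>M lborel)"
      unfolding case_prod_beta' using h0 measurable_cong_sets[OF s' refl, of borel] by blast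
  qed
qed

lemma signed_integral_kernel_smooth:
  fixes e :: real
  assumes sm: "signed_measure \<nu>" and f: "integrable lborel f"
  defines "g \<equiv> \<lambda>y. signed_integral \<nu> (\<lambda>x. cauchy_kernel ((1 / e) *\<^sub>R (x - y)))"
  shows "signed_integral \<nu> (kernel_smooth e f) = (\<integral>y. f y * g y \<partial>lborel)"
    and "g \<in> borel_measurable borel" "\<bar>g (y :: 'a::euclidean_space)\<bar> \<le> 2 ^ DIM('a) * total_variation \<nu>"
proof -
  note p = finite_pos_variation[OF sm] sets_pos_variation
  note n = finite_neg_variation[OF sm] sets_neg_variation
  note kp = kernel_smooth_integral[OF p f, of e]
  note kn = kernel_smooth_integral[OF n f, of e]
  have km: "(\<lambda>x. cauchy_kernel ((1 / e) *\<^sub>R (x - y))) \<in> borel_measurable borel" for y :: 'a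
    by (intro borel_measurable_continuous_onI continuous_cauchy_kernel continuous_intros)
  show "g \<in> borel_measurable borel"
    unfolding g_def signed_integral_def by (rule borel_measurable_diff[OF kp(2) kn(2)])
  show "\<bar>g y\<bar> \<le> 2 ^ DIM('a) * total_variation \<nu>" for y unfolding g_def
    by (rule abs_signed_integral_le[OF sm km abs_cauchy_kernel_le])
  have i: "integrable lborel (\<lambda>y. f y * (\<integral>x. cauchy_kernel ((1 / e) *\<^sub>R (x - y)) \<partial>M))"
    if M: "finite_measure M" "sets M = sets borel" for M
  proof (rule Bochner_Integration.integrable_bound)
    show "integrable lborel (\<lambda>y. f y * (2 ^ DIM('a) * measure M UNIV))" using f by simp
    show "(\<lambda>y. f y * (\<integral>x. cauchy_kernel ((1 / e) *\<^sub>R (x - y)) \<partial>M)) \<in> borel_measurable lborel"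
      using borel_measurable_times[OF borel_measurable_integrable[OF f]] kernel_smooth_integral(2)[OF M f, of e] by simp
    have b: "\<bar>\<integral>x. cauchy_kernel ((1 / e) *\<^sub>R (x - y)) \<partial>M\<bar> \<le> 2 ^ DIM('a) * measure M UNIV" for y
      by (rule abs_integral_le_const[OF M km abs_cauchy_kernel_le])
    show "AE y in lborel. norm (f y * (\<integral>x. cauchy_kernel ((1 / e) *\<^sub>R (x - y)) \<partial>M))
       \<le> norm (f y * (2 ^ DIM('a) * measure M UNIV))"
    proof (rule AE_I2)
      fix y :: 'a
      show "norm (f y * (\<integral>x. cauchy_kernel ((1 / e) *\<^sub>R (x - y)) \<partial>M)) \<le> norm (f y * (2 ^ DIM('a) * measure M UNIV))"
        unfolding norm_mult[of "f y"] by (intro mult_left_mono) (use order_trans[OF b abs_ge_self] in auto)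
    qed
  qed
  show "signed_integral \<nu> (kernel_smooth e f) = (\<integral>y. f y * g y \<partial>lborel)"
    unfolding signed_integral_def[of \<nu> "kernel_smooth e f"] kp(1) kn(1) g_def signed_integral_def right_diff_distrib
    by (rule Bochner_Integration.integral_diff[OF i[OF p] i[OF n], symmetric])
qed

lemma kernel_smooth_scaled:
  fixes x :: "'a::euclidean_space"
  assumes "f \<in> borel_measurable borel" "0 < e"
  shows "kernel_smooth e f x = e ^ DIM('a) * (\<integral>u. f (x - e *\<^sub>R u) * cauchy_kernel u \<partial>lborel)"
proof -
  let ?F = "\<lambda>y. f y * cauchy_kernel ((1 / e) *\<^sub>R (x - y))"
  have F: "?F \<in> borel_measurable borel"
    by (intro borel_measurable_times assms borel_measurable_continuous_onI continuous_cauchy_kernel continuous_intros)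
  have T: "(\<lambda>u. x + (-e) *\<^sub>R u) \<in> lborel \<rightarrow>\<^sub>M (borel :: 'a measure)" by measurable
  have "integral\<^sup>L lborel ?F = integral\<^sup>L (density (distr lborel borel (\<lambda>u. x + (-e) *\<^sub>R u)) (\<lambda>_. \<bar>-e\<bar> ^ DIM('a))) ?F"
    using lborel_affine[of "-e" x] assms(2) by simp
  also have "\<dots> = (\<integral>y. \<bar>-e\<bar> ^ DIM('a) *\<^sub>R ?F y \<partial>distr lborel borel (\<lambda>u. x + (-e) *\<^sub>R u))"
    by (rule integral_density) (use F in auto)
  also have "\<dots> = (\<integral>u. \<bar>-e\<bar> ^ DIM('a) *\<^sub>R ?F (x + (-e) *\<^sub>R u) \<partial>lborel)"
    by (rule integral_distr[OF T]) (use F in auto)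
  finally show ?thesis using assms(2) by (simp add: kernel_smooth_def)
qed

text \<open>After the substitution y = x - e u the error is an average of f x - f (x - e u) against
  the kernel. Uniform continuity controls small u, and the tail mass of the integrable kernel
  controls large u.\<close>

lemma kernel_smooth_uniform_approx:
  fixes f :: "'a::euclidean_space \<Rightarrow> real"
  assumes f: "continuous_on UNIV f" "\<And>x. r \<le> norm x \<Longrightarrow> f x = 0" and \<delta>: "0 < \<delta>"
  obtains e c where "0 < e" "\<And>x. \<bar>f x - c * kernel_smooth e f x\<bar> \<le> \<delta>"
proof -
  let ?K = "cauchy_kernel :: 'a \<Rightarrow> real"
  define \<kappa> where "\<kappa> = integral\<^sup>L lborel ?K"
  have \<kappa>: "0 < \<kappa>" unfolding \<kappa>_def by (rule integral_cauchy_kernel_pos)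
  note Ki = integrable_cauchy_kernel[where 'a='a]
  have fm: "f \<in> borel_measurable borel" by (rule borel_measurable_continuous_onI[OF f(1)])
  obtain B where B: "0 < B" "\<And>x. \<bar>f x\<bar> \<le> B" using C0_bounded[OF C0_compact_support[OF f]] by blast
  \<comment> \<open>Uniform continuity on the ball of radius r + 1 is global here: two points at
    distance less than 1 either both lie in that ball or both have norm at least r, where f
    vanishes.\<close>
  obtain \<eta> where \<eta>: "0 < \<eta>" "\<And>x y. dist x y < \<eta> \<Longrightarrow> \<bar>f x - f y\<bar> \<le> \<delta> / 2"
  proof -
    have "uniformly_continuous_on (cball 0 (r + 1)) f"
      by (intro compact_uniformly_continuous continuous_on_subset[OF f(1)]) auto
    from this[unfolded uniformly_continuous_on_def, rule_format, of "\<delta> / 2"] \<delta> obtain d where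
      d: "0 < d" "\<And>x x'. x \<in> cball 0 (r + 1) \<Longrightarrow> x' \<in> cball 0 (r + 1) \<Longrightarrow> dist x' x < d \<Longrightarrow> dist (f x') (f x) < \<delta> / 2"
      by auto
    show thesis
    proof (rule that[of "min d 1"])
      fix x y :: 'a assume xy: "dist x y < min d 1"
      have n: "\<bar>norm x - norm y\<bar> \<le> dist x y" unfolding dist_norm by (rule norm_triangle_ineq3)
      show "\<bar>f x - f y\<bar> \<le> \<delta> / 2"
      proof (cases "norm x \<le> r + 1 \<and> norm y \<le> r + 1")
        case True
        thus ?thesis using d(2)[of y x] xy by (simp add: dist_real_def)
      next
        case False
        hence "r \<le> norm x" "r \<le> norm y" using n xy by auto
        thus ?thesis using f(2) \<delta> by simp
      qed
    qed (use d in simp)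
  qed
  have "(\<lambda>n. \<integral>u. indicator {u. real n < norm u} u * ?K u \<partial>lborel) \<longlonglongrightarrow> (\<integral>u. 0 \<partial>(lborel :: 'a measure))"
  proof (rule integral_dominated_convergence[OF _ _ Ki])
    have "{u :: 'a. real n < norm u} \<in> sets borel" for n by (intro borel_open open_Collect_less continuous_intros)
    thus "(\<lambda>u. indicator {u. real n < norm u} u * ?K u) \<in> borel_measurable lborel" for n
      using cauchy_kernel_measurable by (intro borel_measurable_times borel_measurable_indicator) auto
    show "AE u in lborel. (\<lambda>n. indicator {u. real n < norm u} u * ?K u) \<longlonglongrightarrow> 0"
    proof (rule AE_I2, rule tendsto_eventually)
      fix u :: 'a
      obtain N where "norm u \<le> real N" using real_arch_simple by blast
      thus "eventually (\<lambda>n. indicator {u. real n < norm u} u * ?K u = 0) sequentially"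
        unfolding eventually_sequentially by (intro exI[of _ N]) (auto simp: indicator_def)
    qed
    show "AE u in lborel. norm (indicator {u. real n < norm u} u * ?K u) \<le> ?K u" for n
      by (rule AE_I2) (auto simp: indicator_def cauchy_kernel_pos less_imp_le)
  qed simp
  hence "(\<lambda>n. \<integral>u. indicator {u. real n < norm u} u * ?K u \<partial>lborel) \<longlonglongrightarrow> 0" by simp
  \<comment> \<open>The tail enters with the factor 2 * B, so this threshold limits its share to
    \<delta> * \<kappa> / 2, the same as the share of small u.\<close>
  from order_tendstoD(2)[OF this, of "\<delta> * \<kappa> / (4 * B)"] obtain n where
    n: "(\<integral>u. indicator {u. real n < norm u} u * ?K u \<partial>lborel) < \<delta> * \<kappa> / (4 * B)"
    using \<delta> \<kappa> B by (auto simp: eventually_sequentially)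
  \<comment> \<open>Ensures e * norm u < \<eta> whenever norm u \<le> n; the summand 1 also covers n
    = 0.\<close>
  define e where "e = \<eta> / (real n + 1)"
  have e: "0 < e" "e * real n < \<eta>" using \<eta>(1) by (auto simp: e_def field_simps)
  have nS: "{u :: 'a. real n < norm u} \<in> sets borel" by (intro borel_open open_Collect_less continuous_intros)
  have indK: "integrable lborel (\<lambda>u. indicator {u. real n < norm u} u * ?K u)"
    using Ki by (rule Bochner_Integration.integrable_bound)
      (use nS cauchy_kernel_measurable in \<open>auto simp: indicator_def intro!: borel_measurable_times borel_measurable_indicator\<close>)
  show thesis
  proof (rule that[of e "1 / (e ^ DIM('a) * \<kappa>)"])
    show "0 < e" by (rule e)
    fix x
    have fK: "integrable lborel (\<lambda>u. f (x - e *\<^sub>R u) * ?K u)"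
    proof (rule Bochner_Integration.integrable_bound[OF integrable_mult_right[OF Ki, of B]])
      have "(\<lambda>u. f (x - e *\<^sub>R u)) \<in> borel_measurable borel"
        by (rule measurable_compose[OF _ fm]) measurable
      from borel_measurable_times[OF this cauchy_kernel_measurable]
      show "(\<lambda>u. f (x - e *\<^sub>R u) * ?K u) \<in> borel_measurable lborel" by simp
      show "AE u in lborel. norm (f (x - e *\<^sub>R u) * ?K u) \<le> norm (B * ?K u)"
        by (rule AE_I2) (use B in \<open>auto simp: abs_mult intro!: mult_right_mono\<close>)
    qed
    have "f x - 1 / (e ^ DIM('a) * \<kappa>) * kernel_smooth e f x
        = (1 / \<kappa>) * (f x * \<kappa> - (\<integral>u. f (x - e *\<^sub>R u) * ?K u \<partial>lborel))"
      using e \<kappa> by (simp add: kernel_smooth_scaled[OF fm e(1)] field_simps)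
    also have "f x * \<kappa> - (\<integral>u. f (x - e *\<^sub>R u) * ?K u \<partial>lborel) = (\<integral>u. f x * ?K u - f (x - e *\<^sub>R u) * ?K u \<partial>lborel)"
      using Ki fK by (simp add: \<kappa>_def)
    finally have eq: "f x - 1 / (e ^ DIM('a) * \<kappa>) * kernel_smooth e f x
       = (1 / \<kappa>) * (\<integral>u. f x * ?K u - f (x - e *\<^sub>R u) * ?K u \<partial>lborel)" .
    have "\<bar>\<integral>u. f x * ?K u - f (x - e *\<^sub>R u) * ?K u \<partial>lborel\<bar> \<le> (\<integral>u. \<bar>f x * ?K u - f (x - e *\<^sub>R u) * ?K u\<bar> \<partial>lborel)"
      by (rule integral_abs_bound)
    also have "\<dots> \<le> (\<integral>u. \<delta> / 2 * ?K u + 2 * B * (indicator {u. real n < norm u} u * ?K u) \<partial>lborel)"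
    proof (rule integral_mono)
      show "integrable lborel (\<lambda>u. \<bar>f x * ?K u - f (x - e *\<^sub>R u) * ?K u\<bar>)" using Ki fK by simp
      show "integrable lborel (\<lambda>u. \<delta> / 2 * ?K u + 2 * B * (indicator {u. real n < norm u} u * ?K u))"
        using Ki indK by simp
      fix u :: 'a
      have K0: "0 \<le> ?K u" using cauchy_kernel_pos[of u] by simp
      have "\<bar>f x - f (x - e *\<^sub>R u)\<bar> \<le> \<delta> / 2 + 2 * B * indicator {u. real n < norm u} u"
      proof (cases "real n < norm u")
        case True
        thus ?thesis using B(2)[of x] B(2)[of "x - e *\<^sub>R u"] \<delta> by simp
      next
        case False
        hence "e * norm u \<le> e * real n" using e by (intro mult_left_mono) auto
        hence "e * norm u < \<eta>" using e(2) by linarith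
        hence "dist x (x - e *\<^sub>R u) < \<eta>" using e(1) by (simp add: dist_norm)
        from \<eta>(2)[OF this] False show ?thesis by simp
      qed
      have "\<bar>f x * ?K u - f (x - e *\<^sub>R u) * ?K u\<bar> = \<bar>f x - f (x - e *\<^sub>R u)\<bar> * ?K u"
        using K0 by (simp only: left_diff_distrib[symmetric] abs_mult abs_of_nonneg)
      also have "\<dots> \<le> (\<delta> / 2 + 2 * B * indicator {u. real n < norm u} u) * ?K u"
        by (rule mult_right_mono[OF \<open>\<bar>f x - f (x - e *\<^sub>R u)\<bar> \<le> _\<close> K0])
      finally show "\<bar>f x * ?K u - f (x - e *\<^sub>R u) * ?K u\<bar> \<le> \<delta> / 2 * ?K u + 2 * B * (indicator {u. real n < norm u} u * ?K u)"
        by (simp only: distrib_right mult.assoc)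
    qed
    also have "\<dots> = \<delta> / 2 * \<kappa> + 2 * B * (\<integral>u. indicator {u. real n < norm u} u * ?K u \<partial>lborel)"
      using Ki indK by (simp add: \<kappa>_def)
    also have "\<dots> \<le> \<delta> / 2 * \<kappa> + 2 * B * (\<delta> * \<kappa> / (4 * B))"
      using n B by (intro add_left_mono mult_left_mono) auto
    also have "\<dots> = \<delta> * \<kappa>" using B by simp
    finally show "\<bar>f x - 1 / (e ^ DIM('a) * \<kappa>) * kernel_smooth e f x\<bar> \<le> \<delta>"
      unfolding eq abs_mult using \<kappa> by (simp add: field_simps)
  qed
qed

text \<open>The kernel integrals are bounded uniformly in y and k, so dominated convergence in y
  settles smoothed functions. Two uniform approximations extend the result to compactly supported
  functions and then to C_0.\<close>

theorem kernel_convergence: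
  fixes \<mu>s :: "nat \<Rightarrow> 'a::euclidean_space set \<Rightarrow> real"
  assumes sm: "\<And>k. signed_measure (\<mu>s k)" and bdd: "\<And>k. total_variation (\<mu>s k) \<le> C"
    and conv: "\<And>y e. 0 < e \<Longrightarrow> convergent (\<lambda>k. signed_integral (\<mu>s k) (\<lambda>x. cauchy_kernel ((1 / e) *\<^sub>R (x - y))))"
    and \<phi>: "C0 \<phi>"
  shows "convergent (\<lambda>k. signed_integral (\<mu>s k) \<phi>)"
proof -
  have compact_case: "convergent (\<lambda>k. signed_integral (\<mu>s k) f)"
    if f: "continuous_on UNIV f" "\<And>x. r \<le> norm x \<Longrightarrow> f x = 0" for f :: "'a \<Rightarrow> real" and r
  proof -
    have fm: "f \<in> borel_measurable borel" by (rule borel_measurable_continuous_onI[OF f(1)])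
    obtain B where B: "\<And>x. \<bar>f x\<bar> \<le> B" using C0_bounded[OF C0_compact_support[OF f]] by blast
    have fi: "integrable lborel f"
    proof (rule Bochner_Integration.integrable_bound)
      show "integrable lborel (\<lambda>x :: 'a. B * indicator (cball 0 r) x)"
        using emeasure_lborel_cball_finite[of "0::'a" r] by (intro integrable_mult_right) (simp add: integrable_indicator_iff)
      show "AE x in lborel. norm (f x) \<le> norm (B * indicator (cball 0 r) x)"
      proof (rule AE_I2)
        fix x
        show "norm (f x) \<le> norm (B * indicator (cball 0 r) x)"
          using B[of x] f(2)[of x] by (cases "norm x \<le> r") auto
      qed
    qed (use fm in simp)
    show ?thesis
    proof (rule convergent_signed_integral_approx[OF sm bdd fm B])
      fix \<delta> :: real assume "0 < \<delta>"
      then obtain e c where e: "0 < e" "\<And>x. \<bar>f x - c * kernel_smooth e f x\<bar> \<le> \<delta>"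
        using kernel_smooth_uniform_approx[OF f] by blast
      define g where "g k y = signed_integral (\<mu>s k) (\<lambda>x. cauchy_kernel ((1 / e) *\<^sub>R (x - y)))" for k y
      note gf = signed_integral_kernel_smooth[OF sm fi, where e = e, folded g_def]
      have "(\<lambda>k. \<integral>y. f y * g k y \<partial>lborel) \<longlonglongrightarrow> (\<integral>y. f y * lim (\<lambda>k. g k y) \<partial>lborel)"
      proof (rule integral_dominated_convergence[where w = "\<lambda>y. \<bar>f y\<bar> * (2 ^ DIM('a) * C)"])
        have "(\<lambda>y. lim (\<lambda>k. g k y)) \<in> borel_measurable borel"
          by (rule borel_measurable_lim_metric) (rule gf(2))
        thus "(\<lambda>y. f y * lim (\<lambda>k. g k y)) \<in> borel_measurable lborel" using fm by simp
        show "(\<lambda>y. f y * g k y) \<in> borel_measurable lborel" for k using fm gf(2)[of k] by simp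
        show "integrable lborel (\<lambda>y. \<bar>f y\<bar> * (2 ^ DIM('a) * C))" using fi by simp
        show "AE y in lborel. (\<lambda>k. f y * g k y) \<longlonglongrightarrow> f y * lim (\<lambda>k. g k y)"
          using conv[OF e(1)] unfolding g_def convergent_LIMSEQ_iff by (intro AE_I2 tendsto_mult_left)
        show "AE y in lborel. norm (f y * g k y) \<le> \<bar>f y\<bar> * (2 ^ DIM('a) * C)" for k
        proof (rule AE_I2)
          fix y
          have "\<bar>g k y\<bar> \<le> 2 ^ DIM('a) * C"
            by (rule order_trans[OF gf(3) mult_left_mono[OF bdd]]) simp
          thus "norm (f y * g k y) \<le> \<bar>f y\<bar> * (2 ^ DIM('a) * C)" by (simp add: abs_mult mult_left_mono)
        qed
      qed
      hence "(\<lambda>k. c * signed_integral (\<mu>s k) (kernel_smooth e f)) \<longlonglongrightarrow> c * (\<integral>y. f y * lim (\<lambda>k. g k y) \<partial>lborel)"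
        unfolding gf(1) by (rule tendsto_mult_left)
      hence "convergent (\<lambda>k. signed_integral (\<mu>s k) (\<lambda>x. c * kernel_smooth e f x))"
        unfolding signed_integral_cmult by (rule convergentI)
      moreover have "(\<lambda>x. c * kernel_smooth e f x) \<in> borel_measurable borel"
        using kernel_smooth_integral(3)[OF finite_pos_variation[OF sm[of 0]] sets_pos_variation fi, of e] by simp
      ultimately show "\<exists>g. g \<in> borel_measurable borel \<and> (\<forall>x. \<bar>f x - g x\<bar> \<le> \<delta>) \<and> convergent (\<lambda>k. signed_integral (\<mu>s k) g)"
        using e(2) by blast
    qed
  qed
  obtain B where B: "\<And>x. \<bar>\<phi> x\<bar> \<le> B" using C0_bounded[OF \<phi>] by blast
  show ?thesis
  proof (rule convergent_signed_integral_approx[OF sm bdd C0_measurable[OF \<phi>] B])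
    fix \<delta> :: real assume \<delta>: "0 < \<delta>"
    obtain r where r: "\<And>x. r \<le> norm x \<Longrightarrow> \<bar>\<phi> x\<bar> < \<delta>" using C0_eventually_small[OF \<phi> \<delta>] by blast
    \<comment> \<open>Shrinking \<phi> towards 0 by \<delta> changes it by at most \<delta> and
      makes it vanish wherever |\<phi>| < \<delta>, so g has bounded support.\<close>
    define g where "g x = max (\<phi> x - \<delta>) 0 - max (- \<phi> x - \<delta>) 0" for x
    have gc: "continuous_on UNIV g" unfolding g_def using C0_continuous[OF \<phi>] by (intro continuous_intros)
    have "convergent (\<lambda>k. signed_integral (\<mu>s k) g)"
      by (rule compact_case[OF gc, of r]) (use r in \<open>force simp: g_def abs_less_iff\<close>)
    moreover have "\<bar>\<phi> x - g x\<bar> \<le> \<delta>" for x using \<delta> by (auto simp: g_def)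
    ultimately show "\<exists>g. g \<in> borel_measurable borel \<and> (\<forall>x. \<bar>\<phi> x - g x\<bar> \<le> \<delta>) \<and> convergent (\<lambda>k. signed_integral (\<mu>s k) g)"
      using borel_measurable_continuous_onI[OF gc] by blast
  qed
qed

section \<open>Uniqueness and convergence\<close>

lemma signed_integrals_eq_if_kernel_eq:
  fixes \<mu> \<nu> :: "'a::euclidean_space set \<Rightarrow> real"
  assumes sm: "signed_measure \<mu>" "signed_measure \<nu>"
    and eq: "\<And>y e. 0 < e \<Longrightarrow> signed_integral \<mu> (\<lambda>x. cauchy_kernel ((1 / e) *\<^sub>R (x - y))) =
        signed_integral \<nu> (\<lambda>x. cauchy_kernel ((1 / e) *\<^sub>R (x - y)))"
    and \<phi>: "C0 \<phi>"
  shows "signed_integral \<mu> \<phi> = signed_integral \<nu> \<phi>"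
proof -
  text \<open>Convergence along the alternating sequence \<open>\<mu>, \<nu>, \<mu>, \<nu>, \<dots>\<close> forces equality.\<close>
  define \<mu>s where "\<mu>s k = (if even k then \<mu> else \<nu>)" for k :: nat
  have "convergent (\<lambda>k. signed_integral (\<mu>s k) \<phi>)"
  proof (rule kernel_convergence[OF _ _ _ \<phi>])
    show "signed_measure (\<mu>s k)" for k using sm by (simp add: \<mu>s_def)
    show "total_variation (\<mu>s k) \<le> max (total_variation \<mu>) (total_variation \<nu>)" for k by (simp add: \<mu>s_def)
    show "convergent (\<lambda>k. signed_integral (\<mu>s k) (\<lambda>x. cauchy_kernel ((1 / e) *\<^sub>R (x - y))))" if "0 < e" for y e
    proof -
      have "signed_integral (\<mu>s k) (\<lambda>x. cauchy_kernel ((1 / e) *\<^sub>R (x - y)))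
          = signed_integral \<mu> (\<lambda>x. cauchy_kernel ((1 / e) *\<^sub>R (x - y)))" for k
        using eq[OF that] by (simp add: \<mu>s_def)
      thus ?thesis by (simp add: convergent_const)
    qed
  qed
  then obtain l where l: "(\<lambda>k. signed_integral (\<mu>s k) \<phi>) \<longlonglongrightarrow> l" by (auto simp: convergent_def)
  have "(\<lambda>k. signed_integral (\<mu>s (2 * k)) \<phi>) \<longlonglongrightarrow> l"
    using LIMSEQ_subseq_LIMSEQ[OF l, of "\<lambda>k. 2 * k"] by (simp add: strict_mono_def o_def)
  moreover have "(\<lambda>k. signed_integral (\<mu>s (2 * k + 1)) \<phi>) \<longlonglongrightarrow> l"
    using LIMSEQ_subseq_LIMSEQ[OF l, of "\<lambda>k. 2 * k + 1"] by (simp add: strict_mono_def o_def)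
  ultimately show ?thesis by (simp add: \<mu>s_def LIMSEQ_const_iff)
qed

text \<open>One sequence works for every finite measure, so the limits for the positive and the
  negative variation can be subtracted. The cutoff in \<open>infdist\<close> tends to the indicator
  of F and \<open>ramp\<close> forces decay; for empty F the distance would be 0 by
  convention.\<close>

lemma measure_closed_limit:
  fixes F :: "'a::euclidean_space set"
  assumes F: "closed F" "F \<noteq> {}"
  obtains h where "\<And>n. C0 (h n)" "\<And>M. finite_measure M \<Longrightarrow> sets M = sets borel \<Longrightarrow> (\<lambda>n. integral\<^sup>L M (h n)) \<longlonglongrightarrow> measure M F"
proof -
  define h where "h n x = max 0 (1 - real n * infdist x F) * ramp n x" for n x
  have h01: "0 \<le> h n x" "h n x \<le> ramp n x" for n x
    unfolding h_def by (auto simp: infdist_nonneg ramp_nonneg intro!: mult_left_le_one_le)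
  have hC: "C0 (h n)" for n
  proof (rule C0_dominated[OF C0_ramp[of n]])
    show "continuous_on UNIV (h n)" unfolding h_def
      using C0_continuous[OF C0_ramp[of n]] by (intro continuous_intros)
    show "\<bar>h n x\<bar> \<le> \<bar>ramp n x\<bar>" for x using h01[of n x] by simp
  qed
  have lim: "(\<lambda>n. h n x) \<longlonglongrightarrow> indicator F x" for x
  proof (rule tendsto_eventually)
    obtain N where N: "norm x + 1 \<le> real N" using real_arch_simple by blast
    have r1: "ramp n x = 1" if "N \<le> n" for n using that N by (intro ramp_eq_1) linarith
    show "eventually (\<lambda>n. h n x = indicator F x) sequentially"
    proof (cases "x \<in> F")
      case True
      thus ?thesis unfolding eventually_sequentially
        by (intro exI[of _ N]) (simp add: h_def r1)
    next
      case False
      hence "0 < infdist x F" using F by (intro infdist_pos_not_in_closed) auto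
      then obtain K where K: "1 < real K * infdist x F" using reals_Archimedean3 by blast
      have "h n x = 0" if "K \<le> n" for n
      proof -
        have "real K * infdist x F \<le> real n * infdist x F"
          using that by (intro mult_right_mono) (auto simp: infdist_nonneg)
        thus ?thesis using K by (simp add: h_def)
      qed
      thus ?thesis using False unfolding eventually_sequentially by (intro exI[of _ K]) simp
    qed
  qed
  show thesis
  proof (rule that[OF hC])
    fix M :: "'a measure" assume M: "finite_measure M" "sets M = sets borel"
    interpret finite_measure M by fact
    have mM: "borel_measurable M = (borel_measurable borel :: ('a \<Rightarrow> real) set)"
      by (rule measurable_cong_sets[OF M(2) refl])
    have "(\<lambda>n. integral\<^sup>L M (h n)) \<longlonglongrightarrow> integral\<^sup>L M (indicator F)"
    proof (rule integral_dominated_convergence[where w = "\<lambda>_. 1"])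
      show "(indicator F :: 'a \<Rightarrow> real) \<in> borel_measurable M"
        unfolding mM by (rule borel_measurable_indicator[OF borel_closed[OF F(1)]])
      show "h n \<in> borel_measurable M" for n unfolding mM by (rule C0_measurable[OF hC])
      show "AE x in M. norm (h n x) \<le> 1" for n
      proof (rule AE_I2)
        fix x show "norm (h n x) \<le> 1" using h01[of n x] ramp_le_1[of n x] by simp
      qed
    qed (use lim in auto)
    thus "(\<lambda>n. integral\<^sup>L M (h n)) \<longlonglongrightarrow> measure M F"
      using sets_eq_imp_space_eq[OF M(2)] by simp
  qed
qed

text \<open>Closed sets are stable under intersection and generate the Borel sets, so agreement on
  them spreads by Dynkin's argument. Off the Borel sets both functions are 0 by the convention in
  \<open>signed_measure\<close>.\<close>

lemma signed_measure_eqI_C0: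
  fixes \<mu> \<nu> :: "'a::euclidean_space set \<Rightarrow> real"
  assumes sm: "signed_measure \<mu>" "signed_measure \<nu>"
    and eq: "\<And>\<phi>. C0 \<phi> \<Longrightarrow> signed_integral \<mu> \<phi> = signed_integral \<nu> \<phi>"
  shows "\<mu> = \<nu>"
proof
  fix A
  have closed_case: "\<mu> F = \<nu> F" if F: "closed F" for F
  proof (cases "F = {}")
    case True
    thus ?thesis using sm by (simp add: signed_measure_empty)
  next
    case False
    obtain h where h: "\<And>n. C0 (h n)"
      "\<And>M. finite_measure M \<Longrightarrow> sets M = sets borel \<Longrightarrow> (\<lambda>n. integral\<^sup>L M (h n)) \<longlonglongrightarrow> measure M F"
      using measure_closed_limit[OF F False] by blast
    have l: "(\<lambda>n. signed_integral \<nu> (h n)) \<longlonglongrightarrow> \<nu> F" if "signed_measure \<nu>" for \<nu>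
      unfolding signed_integral_def
      using tendsto_diff[OF h(2)[OF finite_pos_variation[OF that] sets_pos_variation]
           h(2)[OF finite_neg_variation[OF that] sets_neg_variation]]
      by (simp only: signed_measure_decomp[OF that, of F, symmetric])
    have "(\<lambda>n. signed_integral \<mu> (h n)) = (\<lambda>n. signed_integral \<nu> (h n))" using eq[OF h(1)] by blast
    thus ?thesis using l[OF sm(1)] l[OF sm(2)] LIMSEQ_unique by metis
  qed
  show "\<mu> A = \<nu> A"
  proof (cases "A \<in> sets borel")
    case False
    thus ?thesis using sm by (simp add: signed_measure_def)
  next
    case True
    have sb: "sets (borel :: 'a measure) = sigma_sets UNIV (Collect closed)"
      unfolding borel_eq_closed by simp
    have "Int_stable (Collect (closed :: 'a set \<Rightarrow> bool))" by (auto simp: Int_stable_def)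
    moreover have "Collect (closed :: 'a set \<Rightarrow> bool) \<subseteq> Pow UNIV" by simp
    moreover have "A \<in> sigma_sets UNIV (Collect closed)" using True unfolding sb .
    ultimately show ?thesis
    proof (induction rule: sigma_sets_induct_disjoint)
      case (basic B)
      thus ?case by (simp add: closed_case)
    next
      case empty
      show ?case by (simp add: closed_case)
    next
      case (compl B)
      hence "B \<in> sets borel" by (simp add: sb)
      from signed_measure_Diff[OF sm(1) _ this] signed_measure_Diff[OF sm(2) _ this]
      show ?case using compl.IH closed_case[of UNIV] by simp
    next
      case (union B)
      have r: "range B \<subseteq> sets borel" using union.hyps(2) unfolding sb .
      have "(\<lambda>i. \<mu> (B i)) = (\<lambda>i. \<nu> (B i))" using union.IH by blast
      thus ?case
        using signed_measure_sums[OF sm(1) r union.hyps(1)] signed_measure_sums[OF sm(2) r union.hyps(1)]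
          sums_unique2 by metis
    qed
  qed
qed

lemma continuous_bump: "continuous_on A (bump r)"
proof -
  have "isCont (flat p) t" for p t using DERIV_isCont[OF flat_has_derivative] .
  hence "continuous_on UNIV (flat p)" for p by (simp add: continuous_on_eq_continuous_at)
  thus ?thesis unfolding bump_def
    by (rule continuous_on_compose2)
       (intro continuous_on_const continuous_on_diff continuous_on_mult continuous_on_inner continuous_on_id, simp)
qed

text \<open>Polynomials times a bump function are test functions; by Stone-Weierstrass they exhaust, in the sense
  of bounded pointwise convergence, the bounded continuous functions on the sphere bundle.\<close>
lemma dual_radon_eq_if_test_fun_eq:
  fixes \<mu> \<nu> :: "'a::euclidean_space set \<Rightarrow> real" and \<Psi> :: "'a \<times> real \<Rightarrow> real"
  assumes sm: "signed_measure \<mu>" "signed_measure \<nu>"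
    and eq: "\<And>\<psi>. test_fun \<psi> \<Longrightarrow> signed_integral \<mu> (dual_radon \<psi>) = signed_integral \<nu> (dual_radon \<psi>)"
    and \<Psi>: "continuous_on {z. norm (fst z) = 1} \<Psi>" "\<And>z. norm (fst z) = 1 \<Longrightarrow> \<bar>\<Psi> z\<bar> \<le> B"
  shows "signed_integral \<mu> (dual_radon \<Psi>) = signed_integral \<nu> (dual_radon \<Psi>)"
proof -
  let ?S = "{z :: 'a \<times> real. norm (fst z) = 1}"
  have B: "0 \<le> B"
  proof -
    obtain b :: 'a where "b \<in> Basis" by (meson nonempty_Basis ex_in_conv)
    thus ?thesis using \<Psi>(2)[of "(b, 0)"] by simp
  qed
  \<comment> \<open>The bump is applied before approximating: a polynomial is close to \<Psi> only
    on a ball, and outside that ball both products vanish, so closeness becomes uniform on the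
    sphere bundle.\<close>
  define T where "T r z = \<Psi> z * bump r z" for r z
  have Tc: "continuous_on ?S (T r)" for r unfolding T_def by (intro continuous_on_mult \<Psi>(1) continuous_bump)
  have Tb: "\<bar>T r z\<bar> \<le> B" if "norm (fst z) = 1" for r z
  proof -
    have "\<bar>\<Psi> z\<bar> * \<bar>bump r z\<bar> \<le> B * 1" using \<Psi>(2)[OF that] bump_bounds[of r z] B by (intro mult_mono) auto
    thus ?thesis by (simp add: T_def abs_mult)
  qed
  have TR: "dual_radon (T r) \<in> borel_measurable borel" "\<bar>dual_radon (T r) x\<bar> \<le> B" for r x
    using borel_measurable_continuous_onI[OF continuous_dual_radon[OF Tc Tb]] abs_dual_radon_le[OF Tc Tb] by auto
  have T_eq: "signed_integral \<mu> (dual_radon (T r)) = signed_integral \<nu> (dual_radon (T r))" if r: "0 < r" for r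
  proof -
    have "\<exists>q. real_polynomial_function q \<and> (\<forall>z\<in>?S \<inter> cball 0 r. \<bar>\<Psi> z - q z\<bar> < 1 / real (Suc n))" for n
    proof -
      have "closed ?S" by (intro closed_Collect_eq continuous_intros)
      hence "compact (?S \<inter> cball 0 r)" by (intro closed_Int_compact compact_cball)
      from Stone_Weierstrass_real_polynomial_function[OF this continuous_on_subset[OF \<Psi>(1) Int_lower1], of "1 / real (Suc n)"]
      obtain q where "real_polynomial_function q" "\<And>z. z \<in> ?S \<inter> cball 0 r \<Longrightarrow> \<bar>\<Psi> z - q z\<bar> < 1 / real (Suc n)"
        by auto
      thus ?thesis by blast
    qed
    then obtain q where q: "\<And>n. real_polynomial_function (q n)"
      "\<And>n z. z \<in> ?S \<inter> cball 0 r \<Longrightarrow> \<bar>\<Psi> z - q n z\<bar> < 1 / real (Suc n)" by metis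
    define \<psi> where "\<psi> n z = q n z * bump r z" for n z
    have test: "test_fun (\<psi> n)" for n unfolding \<psi>_def by (rule test_fun_polynomial_bump[OF q(1) r])
    have \<psi>c: "continuous_on ?S (\<psi> n)" for n
      using test_fun_facts[OF test[of n]] continuous_on_subset by (metis subset_UNIV)
    have diff: "\<bar>\<psi> n z - T r z\<bar> \<le> 1 / real (Suc n)" if z: "norm (fst z) = 1" for n z
    proof (cases "norm z \<le> r")
      case True
      hence "\<bar>\<Psi> z - q n z\<bar> < 1 / real (Suc n)" using z by (intro q(2)) simp
      hence "\<bar>\<Psi> z - q n z\<bar> * \<bar>bump r z\<bar> \<le> 1 / real (Suc n) * 1"
        using bump_bounds[of r z] by (intro mult_mono) auto
      moreover have "\<psi> n z - T r z = - ((\<Psi> z - q n z) * bump r z)" by (simp add: \<psi>_def T_def algebra_simps)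
      ultimately show ?thesis by (simp only: abs_minus_cancel abs_mult mult_1_right)
    next
      case False
      thus ?thesis using bump_eq_0[OF r, of z] by (simp add: \<psi>_def T_def)
    qed
    have \<psi>b: "\<bar>\<psi> n z\<bar> \<le> B + 1" if "norm (fst z) = 1" for n z
    proof -
      have "1 / real (Suc n) \<le> 1" by simp
      thus ?thesis using diff[OF that, of n] Tb[OF that, of r] by linarith
    qed
    have m: "dual_radon (\<psi> n) \<in> borel_measurable borel" "\<bar>dual_radon (\<psi> n) x\<bar> \<le> B + 1" for n x
      using borel_measurable_continuous_onI[OF continuous_dual_radon[OF \<psi>c \<psi>b]] abs_dual_radon_le[OF \<psi>c \<psi>b] by auto
    have lim: "(\<lambda>n. dual_radon (\<psi> n) x) \<longlonglongrightarrow> dual_radon (T r) x" for x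
    proof (rule LIM_zero_cancel, rule Lim_null_comparison)
      show "eventually (\<lambda>n. norm (dual_radon (\<psi> n) x - dual_radon (T r) x) \<le> inverse (real (Suc n))) sequentially"
        using dual_radon_diff_le[OF \<psi>c Tc \<psi>b Tb diff] by (intro always_eventually) (simp add: inverse_eq_divide)
      show "(\<lambda>n. inverse (real (Suc n))) \<longlonglongrightarrow> 0" by (rule LIMSEQ_inverse_real_of_nat)
    qed
    have "(\<lambda>n. signed_integral \<mu> (dual_radon (\<psi> n))) \<longlonglongrightarrow> signed_integral \<mu> (dual_radon (T r))"
      "(\<lambda>n. signed_integral \<nu> (dual_radon (\<psi> n))) \<longlonglongrightarrow> signed_integral \<nu> (dual_radon (T r))"
      by (rule signed_integral_LIMSEQ[OF _ m(1) TR(1) m(2) lim], rule sm)+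
    thus ?thesis unfolding eq[OF test] by (rule LIMSEQ_unique)
  qed
  have l: "(\<lambda>n. dual_radon (T (real (Suc n))) x) \<longlonglongrightarrow> exp (-1) * dual_radon \<Psi> x" for x
  proof -
    have m: "(\<lambda>\<omega>. \<Psi> (\<omega>, x \<bullet> \<omega>)) \<in> borel_measurable sphere_measure"
      by (rule sphere_borel_measurable_continuous[OF \<Psi>(1)])
    have "(\<lambda>n. dual_radon (T (real (Suc n))) x) \<longlonglongrightarrow> (\<integral>\<omega>. exp (-1) * \<Psi> (\<omega>, x \<bullet> \<omega>) \<partial>sphere_measure)"
    proof (rule dual_radon_LIMSEQ[OF Tc Tb, where X = "\<lambda>_. x"])
      show "AE \<omega> in sphere_measure. (\<lambda>n. T (real (Suc n)) (\<omega>, x \<bullet> \<omega>)) \<longlonglongrightarrow> exp (-1) * \<Psi> (\<omega>, x \<bullet> \<omega>)"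
      proof (rule AE_I2)
        fix \<omega> :: 'a
        from tendsto_mult_left[OF bump_tendsto[of "(\<omega>, x \<bullet> \<omega>)"], of "\<Psi> (\<omega>, x \<bullet> \<omega>)"]
        show "(\<lambda>n. T (real (Suc n)) (\<omega>, x \<bullet> \<omega>)) \<longlonglongrightarrow> exp (-1) * \<Psi> (\<omega>, x \<bullet> \<omega>)"
          by (simp only: T_def mult.commute)
      qed
      show "(\<lambda>\<omega>. exp (-1) * \<Psi> (\<omega>, x \<bullet> \<omega>)) \<in> borel_measurable sphere_measure"
        by (rule borel_measurable_times[OF borel_measurable_const m])
    qed
    thus ?thesis by (simp add: dual_radon_def[of \<Psi>])
  qed
  have Rm: "(\<lambda>x. exp (-1) * dual_radon \<Psi> x) \<in> borel_measurable borel"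
    using borel_measurable_continuous_onI[OF continuous_dual_radon[OF \<Psi>]] by simp
  have "(\<lambda>n. signed_integral \<mu> (dual_radon (T (real (Suc n))))) \<longlonglongrightarrow> signed_integral \<mu> (\<lambda>x. exp (-1) * dual_radon \<Psi> x)"
    "(\<lambda>n. signed_integral \<nu> (dual_radon (T (real (Suc n))))) \<longlonglongrightarrow> signed_integral \<nu> (\<lambda>x. exp (-1) * dual_radon \<Psi> x)"
    by (rule signed_integral_LIMSEQ[OF _ TR(1) Rm TR(2) l], rule sm)+
  moreover have "(\<lambda>n. signed_integral \<mu> (dual_radon (T (real (Suc n))))) = (\<lambda>n. signed_integral \<nu> (dual_radon (T (real (Suc n)))))"
    by (rule ext, rule T_eq) simp
  ultimately have "signed_integral \<mu> (\<lambda>x. exp (-1) * dual_radon \<Psi> x) = signed_integral \<nu> (\<lambda>x. exp (-1) * dual_radon \<Psi> x)"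
    using LIMSEQ_unique by metis
  thus ?thesis by (simp add: signed_integral_cmult)
qed

text \<open>The kernels arise from \<open>shifted_ridge\<close>, which has no compact support.
  Equality on test functions is therefore first extended to bounded continuous functions on the
  sphere bundle, and only then applied to the kernels.\<close>

theorem radon_injective:
  fixes \<mu> \<nu> :: "'a::euclidean_space set \<Rightarrow> real"
  assumes sm: "signed_measure \<mu>" "signed_measure \<nu>"
    and eq: "\<And>\<psi>. test_fun \<psi> \<Longrightarrow> signed_integral \<mu> (dual_radon \<psi>) = signed_integral \<nu> (dual_radon \<psi>)"
  shows "\<mu> = \<nu>"
proof (rule signed_measure_eqI_C0[OF sm signed_integrals_eq_if_kernel_eq[OF sm]])
  fix y :: 'a and e :: real assume e: "0 < e"
  from dual_radon_eq_if_test_fun_eq[OF sm eq continuous_shifted_ridge[OF e, of y] shifted_ridge_bound]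
  show "signed_integral \<mu> (\<lambda>x. cauchy_kernel ((1 / e) *\<^sub>R (x - y))) =
      signed_integral \<nu> (\<lambda>x. cauchy_kernel ((1 / e) *\<^sub>R (x - y)))"
    by (simp only: dual_radon_shifted_ridge[abs_def])
qed

section \<open>Existence of the limit and convergence on bounded functions\<close>

lemma narrow_convergence:
  fixes \<mu>s :: "nat \<Rightarrow> 'a::euclidean_space set \<Rightarrow> real"
  assumes sm: "\<And>k. signed_measure (\<mu>s k)" "signed_measure \<mu>"
    and vague: "\<And>\<phi>. C0 \<phi> \<Longrightarrow> (\<lambda>k. signed_integral (\<mu>s k) \<phi>) \<longlonglongrightarrow> signed_integral \<mu> \<phi>"
    and norming: "\<And>e. e < total_variation \<mu> \<Longrightarrow> \<exists>f. C0 f \<and> (\<forall>x. \<bar>f x\<bar> \<le> 1) \<and> e < signed_integral \<mu> f"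
    and tv: "(\<lambda>k. total_variation (\<mu>s k)) \<longlonglongrightarrow> total_variation \<mu>"
    and \<phi>: "Cb \<phi>"
  shows "(\<lambda>k. signed_integral (\<mu>s k) \<phi>) \<longlonglongrightarrow> signed_integral \<mu> \<phi>"
proof -
  have \<phi>c: "continuous_on UNIV \<phi>" using \<phi> by (simp add: Cb_def)
  have \<phi>m: "\<phi> \<in> borel_measurable borel" by (rule borel_measurable_continuous_onI[OF \<phi>c])
  obtain B where B: "0 < B" "\<And>x. \<bar>\<phi> x\<bar> \<le> B"
    using \<phi> unfolding Cb_def bounded_pos by auto
  \<comment> \<open>C_0 convergence controls only the product of \<phi> with |f|, so the loss must
    be small uniformly in k. This bound reduces it to the gap between total variation and integral
    of f, which converges to the small gap for \<mu>.\<close>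
  have tail: "\<bar>signed_integral \<nu> \<phi> - signed_integral \<nu> (\<lambda>x. \<phi> x * \<bar>f x\<bar>)\<bar> \<le> B * (total_variation \<nu> - signed_integral \<nu> f)"
    if \<nu>: "signed_measure \<nu>" and f: "C0 f" "\<And>x. \<bar>f x\<bar> \<le> 1" for \<nu> f
  proof -
    have part: "\<bar>integral\<^sup>L M \<phi> - integral\<^sup>L M (\<lambda>x. \<phi> x * \<bar>f x\<bar>)\<bar> \<le> B * (measure M UNIV - integral\<^sup>L M (\<lambda>x. \<bar>f x\<bar>))"
      if M: "finite_measure M" "sets M = sets borel" for M
    proof -
      interpret finite_measure M by fact
      have sp: "space M = UNIV" using sets_eq_imp_space_eq[OF M(2)] by simp
      have fm: "(\<lambda>x. \<bar>f x\<bar>) \<in> borel_measurable borel" using C0_measurable[OF f(1)] by (rule borel_measurable_abs)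
      have i1: "integrable M \<phi>" by (rule integrable_bounded_borel[OF M \<phi>m, of B]) (use B in simp)
      have i2: "integrable M (\<lambda>x. \<bar>f x\<bar>)" by (rule integrable_bounded_borel[OF M fm, of 1]) (use f in simp)
      have i3: "integrable M (\<lambda>x. \<phi> x * \<bar>f x\<bar>)"
      proof (rule integrable_bounded_borel[OF M borel_measurable_times[OF \<phi>m fm]])
        show "norm (\<phi> x * \<bar>f x\<bar>) \<le> B * 1" for x
          unfolding norm_mult using B f(2)[of x] by (intro mult_mono) auto
      qed
      have "\<bar>integral\<^sup>L M \<phi> - integral\<^sup>L M (\<lambda>x. \<phi> x * \<bar>f x\<bar>)\<bar> = \<bar>\<integral>x. \<phi> x - \<phi> x * \<bar>f x\<bar> \<partial>M\<bar>"
        using i1 i3 by simp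
      also have "\<dots> \<le> (\<integral>x. \<bar>\<phi> x - \<phi> x * \<bar>f x\<bar>\<bar> \<partial>M)" by (rule integral_abs_bound)
      also have "\<dots> \<le> (\<integral>x. B * (1 - \<bar>f x\<bar>) \<partial>M)"
      proof (rule integral_mono)
        show "integrable M (\<lambda>x. \<bar>\<phi> x - \<phi> x * \<bar>f x\<bar>\<bar>)" using i1 i3 by simp
        show "integrable M (\<lambda>x. B * (1 - \<bar>f x\<bar>))" using i2 by simp
        fix x
        have "\<bar>\<phi> x - \<phi> x * \<bar>f x\<bar>\<bar> = \<bar>\<phi> x\<bar> * (1 - \<bar>f x\<bar>)"
          using f(2)[of x] abs_mult[of "\<phi> x" "1 - \<bar>f x\<bar>"] by (simp add: right_diff_distrib)
        also have "\<dots> \<le> B * (1 - \<bar>f x\<bar>)" using B(2)[of x] f(2)[of x] by (intro mult_right_mono) auto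
        finally show "\<bar>\<phi> x - \<phi> x * \<bar>f x\<bar>\<bar> \<le> B * (1 - \<bar>f x\<bar>)" .
      qed
      also have "\<dots> = B * (measure M UNIV - integral\<^sup>L M (\<lambda>x. \<bar>f x\<bar>))"
        using i2 by (simp add: sp)
      finally show ?thesis .
    qed
    have fle: "\<bar>integral\<^sup>L M f\<bar> \<le> integral\<^sup>L M (\<lambda>x. \<bar>f x\<bar>)" for M by (rule integral_abs_bound)
    let ?P = "pos_variation \<nu>" and ?N = "neg_variation \<nu>"
    have p: "\<bar>integral\<^sup>L ?P \<phi> - integral\<^sup>L ?P (\<lambda>x. \<phi> x * \<bar>f x\<bar>)\<bar> \<le> B * (measure ?P UNIV - integral\<^sup>L ?P (\<lambda>x. \<bar>f x\<bar>))"
      by (rule part[OF finite_pos_variation[OF \<nu>] sets_pos_variation])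
    have n: "\<bar>integral\<^sup>L ?N \<phi> - integral\<^sup>L ?N (\<lambda>x. \<phi> x * \<bar>f x\<bar>)\<bar> \<le> B * (measure ?N UNIV - integral\<^sup>L ?N (\<lambda>x. \<bar>f x\<bar>))"
      by (rule part[OF finite_neg_variation[OF \<nu>] sets_neg_variation])
    have "\<bar>signed_integral \<nu> \<phi> - signed_integral \<nu> (\<lambda>x. \<phi> x * \<bar>f x\<bar>)\<bar> \<le>
       B * (measure ?P UNIV - integral\<^sup>L ?P (\<lambda>x. \<bar>f x\<bar>)) + B * (measure ?N UNIV - integral\<^sup>L ?N (\<lambda>x. \<bar>f x\<bar>))"
      using p n unfolding signed_integral_def by linarith
    also have "\<dots> = B * (total_variation \<nu> - (integral\<^sup>L ?P (\<lambda>x. \<bar>f x\<bar>) + integral\<^sup>L ?N (\<lambda>x. \<bar>f x\<bar>)))"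
      by (simp add: total_variation_eq[OF \<nu>] algebra_simps)
    \<comment> \<open>The integrals of |f| against the two variations sum to at least the signed
      integral of f.\<close>
    also have "\<dots> \<le> B * (total_variation \<nu> - signed_integral \<nu> f)"
      using B(1) fle[of ?P] fle[of ?N] unfolding signed_integral_def by (intro mult_left_mono) linarith+
    finally show ?thesis .
  qed
  show ?thesis
  proof (rule LIMSEQ_I)
    fix e :: real assume e: "0 < e"
    \<comment> \<open>Three errors of at most e / 6 add up: the tails for \<open>\<mu>s k\<close>
      and for \<mu>, each at most B * \<epsilon>, and the C_0 convergence.\<close>
    define \<epsilon> where "\<epsilon> = e / (6 * B)"
    have \<epsilon>: "0 < \<epsilon>" "B * \<epsilon> = e / 6" using e B(1) by (auto simp: \<epsilon>_def)
    obtain f where f: "C0 f" "\<And>x. \<bar>f x\<bar> \<le> 1" "total_variation \<mu> - \<epsilon> < signed_integral \<mu> f"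
      using norming[of "total_variation \<mu> - \<epsilon>"] \<epsilon> by auto
    have "(\<lambda>k. total_variation (\<mu>s k) - signed_integral (\<mu>s k) f) \<longlonglongrightarrow> total_variation \<mu> - signed_integral \<mu> f"
      by (intro tendsto_diff tv vague f)
    hence ev1: "eventually (\<lambda>k. total_variation (\<mu>s k) - signed_integral (\<mu>s k) f < \<epsilon>) sequentially"
      using f(3) by (intro order_tendstoD(2)) auto
    have "C0 (\<lambda>x. B * f x)" by (rule C0_cmult[OF f(1)])
    hence "C0 (\<lambda>x. \<phi> x * \<bar>f x\<bar>)"
    proof (rule C0_dominated)
      show "continuous_on UNIV (\<lambda>x. \<phi> x * \<bar>f x\<bar>)" using \<phi>c C0_continuous[OF f(1)] by (intro continuous_intros)
      show "\<bar>\<phi> x * \<bar>f x\<bar>\<bar> \<le> \<bar>B * f x\<bar>" for x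
        using B by (simp add: abs_mult mult_right_mono)
    qed
    from tendstoD[OF vague[OF this], of "e / 6"] e
    have ev2: "eventually (\<lambda>k. \<bar>signed_integral (\<mu>s k) (\<lambda>x. \<phi> x * \<bar>f x\<bar>) - signed_integral \<mu> (\<lambda>x. \<phi> x * \<bar>f x\<bar>)\<bar> < e / 6) sequentially"
      by (simp add: dist_real_def)
    have t0: "\<bar>signed_integral \<mu> \<phi> - signed_integral \<mu> (\<lambda>x. \<phi> x * \<bar>f x\<bar>)\<bar> \<le> e / 6"
      using tail[OF sm(2) f(1,2)] mult_left_mono[of "total_variation \<mu> - signed_integral \<mu> f" \<epsilon> B] f(3) B(1) \<epsilon>(2) by linarith
    have "eventually (\<lambda>k. norm (signed_integral (\<mu>s k) \<phi> - signed_integral \<mu> \<phi>) < e) sequentially"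
      using ev1 ev2
    proof eventually_elim
      case (elim k)
      have "\<bar>signed_integral (\<mu>s k) \<phi> - signed_integral (\<mu>s k) (\<lambda>x. \<phi> x * \<bar>f x\<bar>)\<bar> \<le> e / 6"
        using tail[OF sm(1) f(1,2), of k] mult_left_mono[of "total_variation (\<mu>s k) - signed_integral (\<mu>s k) f" \<epsilon> B]
          elim(1) B(1) \<epsilon>(2) by linarith
      thus ?case using elim(2) t0 e unfolding real_norm_def by linarith
    qed
    thus "\<exists>N. \<forall>k\<ge>N. norm (signed_integral (\<mu>s k) \<phi> - signed_integral \<mu> \<phi>) < e"
      by (simp add: eventually_sequentially)
  qed
qed

text \<open>The limit functional is bounded by C on the unit ball of C_0, so
  \<open>riesz_signed\<close> represents it. The norming functions stay in the conclusion because
  they give the bound on the total variation here and the control of escaping mass in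
  \<open>narrow_convergence\<close>.\<close>

theorem vague_limit:
  fixes \<mu>s :: "nat \<Rightarrow> 'a::euclidean_space set \<Rightarrow> real"
  assumes sm: "\<And>k. signed_measure (\<mu>s k)" and bdd: "\<And>k. total_variation (\<mu>s k) \<le> C"
    and lim: "AE z in sphere_measure \<Otimes>\<^sub>M lborel. (\<lambda>k. \<mu>s k (halfspace (fst z) (snd z))) \<longlonglongrightarrow> a z"
  obtains \<mu> where "signed_measure \<mu>" "total_variation \<mu> \<le> C"
    "\<And>\<phi>. C0 \<phi> \<Longrightarrow> (\<lambda>k. signed_integral (\<mu>s k) \<phi>) \<longlonglongrightarrow> signed_integral \<mu> \<phi>"
    "\<And>e. e < total_variation \<mu> \<Longrightarrow> \<exists>f. C0 f \<and> (\<forall>x. \<bar>f x\<bar> \<le> 1) \<and> e < signed_integral \<mu> f"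
proof -
  have conv: "convergent (\<lambda>k. signed_integral (\<mu>s k) \<phi>)" if "C0 \<phi>" for \<phi>
  proof (rule kernel_convergence[OF sm bdd _ that])
    fix y :: 'a and e :: real assume "0 < e"
    \<comment> \<open>The translated and dilated kernel is the dual Radon transform of
      \<open>shifted_ridge\<close>, which is admissible in the half-space formula.\<close>
    from signed_integral_dual_radon_limit[OF sm bdd lim radon_test_shifted_ridge[OF this, of y]]
    show "convergent (\<lambda>k. signed_integral (\<mu>s k) (\<lambda>x. cauchy_kernel ((1 / e) *\<^sub>R (x - y))))"
      by (simp only: dual_radon_shifted_ridge[abs_def]) (rule convergentI)
  qed
  define L where "L \<phi> = lim (\<lambda>k. signed_integral (\<mu>s k) \<phi>)" for \<phi>
  have L: "(\<lambda>k. signed_integral (\<mu>s k) \<phi>) \<longlonglongrightarrow> L \<phi>" if "C0 \<phi>" for \<phi>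
    using conv[OF that] by (simp add: L_def convergent_LIMSEQ_iff)
  have L_bound: "L f \<le> C" if f: "C0 f" "\<And>x. \<bar>f x\<bar> \<le> 1" for f
  proof (rule LIMSEQ_le_const2[OF L[OF f(1)]], intro exI allI impI)
    fix k
    have "\<bar>signed_integral (\<mu>s k) f\<bar> \<le> 1 * total_variation (\<mu>s k)"
      by (rule abs_signed_integral_le[OF sm C0_measurable[OF f(1)] f(2)])
    thus "signed_integral (\<mu>s k) f \<le> C" using bdd[of k] by linarith
  qed
  obtain \<mu> where \<mu>: "signed_measure \<mu>" "\<And>\<phi>. C0 \<phi> \<Longrightarrow> signed_integral \<mu> \<phi> = L \<phi>"
    "\<And>e. e < total_variation \<mu> \<Longrightarrow> \<exists>f. C0 f \<and> (\<forall>x. \<bar>f x\<bar> \<le> 1) \<and> e < L f"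
  proof (rule riesz_signed[of L C])
    fix f g :: "'a \<Rightarrow> real" assume f: "C0 f" and g: "C0 g"
    obtain B1 where B1: "\<And>x. \<bar>f x\<bar> \<le> B1" using C0_bounded[OF f] by blast
    obtain B2 where B2: "\<And>x. \<bar>g x\<bar> \<le> B2" using C0_bounded[OF g] by blast
    have "(\<lambda>k. signed_integral (\<mu>s k) (\<lambda>x. f x + g x)) \<longlonglongrightarrow> L f + L g"
      unfolding signed_integral_add[OF sm C0_measurable[OF f] B1 C0_measurable[OF g] B2]
      by (intro tendsto_add L f g)
    from LIMSEQ_unique[OF L[OF C0_add[OF f g]] this] show "L (\<lambda>x. f x + g x) = L f + L g" .
  next
    fix f :: "'a \<Rightarrow> real" and c :: real assume f: "C0 f"
    have "(\<lambda>k. signed_integral (\<mu>s k) (\<lambda>x. c * f x)) \<longlonglongrightarrow> c * L f"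
      unfolding signed_integral_cmult by (intro tendsto_mult_left L f)
    from LIMSEQ_unique[OF L[OF C0_cmult[OF f]] this] show "L (\<lambda>x. c * f x) = c * L f" .
  qed (use L_bound that in auto)
  \<comment> \<open>Otherwise C itself could be norming-tested: some f with |f| \<le> 1 would have L
    f > C.\<close>
  have "total_variation \<mu> \<le> C"
  proof (rule ccontr)
    assume "\<not> ?thesis"
    with \<mu>(3)[of C] obtain f where "C0 f" "\<forall>x. \<bar>f x\<bar> \<le> 1" "C < L f" by auto
    thus False using L_bound[of f] by simp
  qed
  thus thesis
  proof (rule that[OF \<mu>(1)])
    show "(\<lambda>k. signed_integral (\<mu>s k) \<phi>) \<longlonglongrightarrow> signed_integral \<mu> \<phi>" if "C0 \<phi>" for \<phi>
      unfolding \<mu>(2)[OF that] by (rule L[OF that])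
    show "\<exists>f. C0 f \<and> (\<forall>x. \<bar>f x\<bar> \<le> 1) \<and> e < signed_integral \<mu> f" if e: "e < total_variation \<mu>" for e
    proof -
      obtain f where "C0 f" "\<forall>x. \<bar>f x\<bar> \<le> 1" "e < L f" using \<mu>(3)[OF e] by auto
      thus ?thesis using \<mu>(2)[of f] by (intro exI[of _ f]) simp
    qed
  qed
qed

theorem mainTheorem9:
  fixes \<mu>s :: "nat \<Rightarrow> (real^'n) set \<Rightarrow> real"
    and C :: real
    and a :: "(real^'n) \<times> real \<Rightarrow> real"
  assumes sm: "\<And>k. signed_measure (\<mu>s k)"
    and bdd: "\<And>k. total_variation (\<mu>s k) \<le> C"
    and lim: "AE z in sphere_measure \<Otimes>\<^sub>M lborel.
                (\<lambda>k. \<mu>s k (halfspace (fst z) (snd z))) \<longlonglongrightarrow> a z"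
  shows "(\<exists>!\<mu>. signed_measure \<mu> \<and> total_variation \<mu> \<le> C \<and>
            (\<forall>\<phi>. C0 \<phi> \<longrightarrow> (\<lambda>k. signed_integral (\<mu>s k) \<phi>) \<longlonglongrightarrow> signed_integral \<mu> \<phi>))
       \<and> (\<forall>\<mu>. signed_measure \<mu> \<and> total_variation \<mu> \<le> C \<and>
            (\<forall>\<phi>. C0 \<phi> \<longrightarrow> (\<lambda>k. signed_integral (\<mu>s k) \<phi>) \<longlonglongrightarrow> signed_integral \<mu> \<phi>)
          \<longrightarrow> radon_eq_dp \<mu> a
            \<and> (\<forall>\<nu>. signed_measure \<nu> \<and> radon_eq_dp \<nu> a \<longrightarrow> \<nu> = \<mu>)
            \<and> ((\<lambda>k. total_variation (\<mu>s k)) \<longlonglongrightarrow> total_variation \<mu> \<longrightarrow>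
                 (\<forall>\<phi>. Cb \<phi> \<longrightarrow> (\<lambda>k. signed_integral (\<mu>s k) \<phi>) \<longlonglongrightarrow> signed_integral \<mu> \<phi>)))"
proof -
  obtain \<mu>0 where \<mu>0: "signed_measure \<mu>0" "total_variation \<mu>0 \<le> C"
    "\<And>\<phi>. C0 \<phi> \<Longrightarrow> (\<lambda>k. signed_integral (\<mu>s k) \<phi>) \<longlonglongrightarrow> signed_integral \<mu>0 \<phi>"
    "\<And>e. e < total_variation \<mu>0 \<Longrightarrow> \<exists>f. C0 f \<and> (\<forall>x. \<bar>f x\<bar> \<le> 1) \<and> e < signed_integral \<mu>0 f"
    using vague_limit[OF sm bdd lim] by blast
  have unique: "\<mu> = \<mu>0" if "signed_measure \<mu>"
    "\<And>\<phi>. C0 \<phi> \<Longrightarrow> (\<lambda>k. signed_integral (\<mu>s k) \<phi>) \<longlonglongrightarrow> signed_integral \<mu> \<phi>" for \<mu>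
    by (rule signed_measure_eqI_C0[OF that(1) \<mu>0(1)]) (rule LIMSEQ_unique[OF that(2) \<mu>0(3)])
  have radon: "radon_eq_dp \<mu>0 a" unfolding radon_eq_dp_def
  proof (intro allI impI)
    fix \<psi> :: "(real^'n) \<times> real \<Rightarrow> real" assume t: "test_fun \<psi>"
    obtain r where "continuous_on UNIV \<psi>" "\<And>z. r \<le> norm z \<Longrightarrow> \<psi> z = 0"
      by (rule test_fun_facts[OF t]) (rule that)
    \<comment> \<open>Vague convergence tests only C_0, so R* \<psi> has to vanish at infinity
      before the vague limit can be compared with the half-space limit.\<close>
    hence "C0 (dual_radon \<psi>)" by (rule C0_dual_radon)
    from LIMSEQ_unique[OF \<mu>0(3)[OF this] signed_integral_dual_radon_limit[OF sm bdd lim test_fun_radon_test[OF t]]]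
    show "signed_integral \<mu>0 (dual_radon \<psi>) =
       - integral\<^sup>L (completion (sphere_measure \<Otimes>\<^sub>M lborel)) (\<lambda>z. a z * deriv (\<lambda>p. \<psi> (fst z, p)) (snd z))" .
  qed
  \<comment> \<open>Both measures satisfy the equation with the same right-hand side, so a drops out
    and injectivity on test functions decides.\<close>
  have radon_unique: "\<nu> = \<mu>0" if "signed_measure \<nu>" "radon_eq_dp \<nu> a" for \<nu>
    by (rule radon_injective[OF that(1) \<mu>0(1)]) (use that(2) radon in \<open>simp add: radon_eq_dp_def\<close>)
  have narrow: "(\<lambda>k. signed_integral (\<mu>s k) \<phi>) \<longlonglongrightarrow> signed_integral \<mu>0 \<phi>"
    if "(\<lambda>k. total_variation (\<mu>s k)) \<longlonglongrightarrow> total_variation \<mu>0" "Cb \<phi>" for \<phi>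
    by (rule narrow_convergence[OF sm \<mu>0(1,3,4) that])
  show ?thesis
  proof (intro conjI ex1I[of _ \<mu>0] allI impI)
    fix \<mu> assume *: "signed_measure \<mu> \<and> total_variation \<mu> \<le> C \<and>
            (\<forall>\<phi>. C0 \<phi> \<longrightarrow> (\<lambda>k. signed_integral (\<mu>s k) \<phi>) \<longlonglongrightarrow> signed_integral \<mu> \<phi>)"
    thus e: "\<mu> = \<mu>0" by (intro unique) auto
    show "radon_eq_dp \<mu> a" unfolding e by (rule radon)
    show "\<nu> = \<mu>" if "signed_measure \<nu> \<and> radon_eq_dp \<nu> a" for \<nu> unfolding e using that by (intro radon_unique) auto
    show "(\<lambda>k. signed_integral (\<mu>s k) \<phi>) \<longlonglongrightarrow> signed_integral \<mu> \<phi>"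
      if "(\<lambda>k. total_variation (\<mu>s k)) \<longlonglongrightarrow> total_variation \<mu>" "Cb \<phi>" for \<phi>
      using narrow that unfolding e by blast
  qed (use \<mu>0 in auto)
qed

end
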